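(* Let $(M,g)$ be a complete $n$-dimensional Riemannian manifold. Suppose $\gamma:[0,\rho]\to M$ is a unit-speed geodesic such that $\gamma(\rho)$ is the first conjugate point to $\gamma(0)$ along $\gamma$, and suppose that the average radial Ricci curvature $q(r)=\frac{1}{n-1}\operatorname{Ric}(\dot\gamma,\dot\gamma)(r)$ along $\gamma$ is non-negative. Let $\psi$ be a positive and monotonic function on $[0,\infty)$. Then $$\int_0^\rho\frac{\psi q}{\psi^2+q}\,dr<2+\frac14\left|\log\frac{\psi(\rho)}{\psi(0)}\right|.$$
   Context: Here $n\ge 2$, $\rho>0$ is finite, and $M$ has no boundary. *)

theory Defs
  imports "HOL-Analysis.Analysis"
begin

section \<open>Smooth functions\<close>

text \<open>Meant for open \<open>S\<close>: the derivative is the one with respect to the full filter \<open>at x\<close>.\<close>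

primrec k_smooth_on ::
    "nat \<Rightarrow> 'a::euclidean_space set \<Rightarrow> ('a \<Rightarrow> 'b::real_normed_vector) \<Rightarrow> bool" where
  "k_smooth_on 0 S f \<longleftrightarrow> continuous_on S f"
| "k_smooth_on (Suc k) S f \<longleftrightarrow>
     (\<forall>x\<in>S. f differentiable (at x)) \<and>
     (\<forall>v. k_smooth_on k S (\<lambda>x. frechet_derivative f (at x) v))"

definition smooth_on :: "'a::euclidean_space set \<Rightarrow> ('a \<Rightarrow> 'b::real_normed_vector) \<Rightarrow> bool" where
  "smooth_on S f \<longleftrightarrow> (\<forall>k. k_smooth_on k S f)"


section \<open>Riemannian manifolds\<close>

text \<open>
  A chart is a pair of its domain and its coordinate map; values of the map off the domain are
  irrelevant. The dimension of the manifold is \<open>CARD('n)\<close>.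

  A tangent vector is given by its components in all charts of the atlas around its base point,
  related by the Jacobians of the transition maps; it is set to \<open>0\<close> on everything that is not a
  chart of the atlas around the base point, so that equality of functions is equality of tangent
  vectors.
\<close>

type_synonym ('m, 'n) chart = "'m set \<times> ('m \<Rightarrow> real ^ 'n)"
type_synonym ('m, 'n) tvec = "('m, 'n) chart \<Rightarrow> real ^ 'n"

record ('m, 'n::finite) manifold =
  mtop :: "'m topology"
  atlas :: "('m, 'n) chart set"
  rmetric :: "'m \<Rightarrow> ('m, 'n) tvec \<Rightarrow> ('m, 'n) tvec \<Rightarrow> real"

definition is_chart :: "'m topology \<Rightarrow> ('m, 'n::finite) chart \<Rightarrow> bool" where
  "is_chart X c \<longleftrightarrow>
     openin X (fst c) \<and> open (snd c ` fst c) \<and>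
     homeomorphic_map (subtopology X (fst c)) (top_of_set (snd c ` fst c)) (snd c)"

definition chart_inv :: "('m, 'n::finite) chart \<Rightarrow> real ^ 'n \<Rightarrow> 'm" where
  "chart_inv c = inv_into (fst c) (snd c)"

definition transition ::
    "('m, 'n::finite) chart \<Rightarrow> ('m, 'n) chart \<Rightarrow> real ^ 'n \<Rightarrow> real ^ 'n" where
  "transition c d = snd d \<circ> chart_inv c"

definition smooth_manifold :: "('m, 'n::finite, 'z) manifold_scheme \<Rightarrow> bool" where
  "smooth_manifold M \<longleftrightarrow>
     Hausdorff_space (mtop M) \<and> second_countable (mtop M) \<and>
     (\<forall>c\<in>atlas M. is_chart (mtop M) c) \<and>
     (\<Union>c\<in>atlas M. fst c) = topspace (mtop M) \<and>
     (\<forall>c\<in>atlas M. \<forall>d\<in>atlas M. smooth_on (snd c ` (fst c \<inter> fst d)) (transition c d))"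

definition chart_at :: "('m, 'n::finite, 'z) manifold_scheme \<Rightarrow> 'm \<Rightarrow> ('m, 'n) chart \<Rightarrow> bool" where
  "chart_at M p c \<longleftrightarrow> c \<in> atlas M \<and> p \<in> fst c"

definition tangent_space :: "('m, 'n::finite, 'z) manifold_scheme \<Rightarrow> 'm \<Rightarrow> ('m, 'n) tvec set" where
  "tangent_space M p =
     {v. (\<forall>c d. chart_at M p c \<longrightarrow> chart_at M p d \<longrightarrow>
            v d = frechet_derivative (transition c d) (at (snd c p)) (v c)) \<and>
         (\<forall>c. \<not> chart_at M p c \<longrightarrow> v c = 0)}"

text \<open>The tangent vector at \<open>p\<close> whose components in the chart \<open>c\<close> are \<open>a\<close>; for \<open>a = axis i 1\<close>
  it is the coordinate vector \<open>\<partial>\<^sub>i\<close>.\<close>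

definition coord_vec ::
    "('m, 'n::finite, 'z) manifold_scheme \<Rightarrow> ('m, 'n) chart \<Rightarrow> 'm \<Rightarrow> real ^ 'n \<Rightarrow> ('m, 'n) tvec" where
  "coord_vec M c p a =
     (\<lambda>d. if chart_at M p d then frechet_derivative (transition c d) (at (snd c p)) a else 0)"

text \<open>The matrix \<open>g\<^sub>i\<^sub>j\<close> of the metric in the chart \<open>c\<close>, as a function of the coordinates.\<close>

definition gmat ::
    "('m, 'n::finite, 'z) manifold_scheme \<Rightarrow> ('m, 'n) chart \<Rightarrow> real ^ 'n \<Rightarrow> real ^ 'n ^ 'n" where
  "gmat M c x =
     (\<chi> i j. rmetric M (chart_inv c x)
        (coord_vec M c (chart_inv c x) (axis i 1)) (coord_vec M c (chart_inv c x) (axis j 1)))"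

definition riemannian_manifold :: "('m, 'n::finite, 'z) manifold_scheme \<Rightarrow> bool" where
  "riemannian_manifold M \<longleftrightarrow>
     smooth_manifold M \<and>
     (\<forall>p\<in>topspace (mtop M). \<forall>u\<in>tangent_space M p. \<forall>v\<in>tangent_space M p.
        rmetric M p u v = rmetric M p v u \<and>
        (u \<noteq> (\<lambda>_. 0) \<longrightarrow> rmetric M p u u > 0) \<and>
        (\<forall>w\<in>tangent_space M p. \<forall>a b.
           rmetric M p (\<lambda>c. a *\<^sub>R u c + b *\<^sub>R v c) w = a * rmetric M p u w + b * rmetric M p v w)) \<and>
     (\<forall>c\<in>atlas M. smooth_on (snd c ` fst c) (gmat M c))"


section \<open>Levi-Civita connection and curvature\<close>

definition partial_deriv :: "'n::finite \<Rightarrow> (real ^ 'n \<Rightarrow> real) \<Rightarrow> real ^ 'n \<Rightarrow> real" where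
  "partial_deriv i f x = frechet_derivative f (at x) (axis i 1)"

text \<open>\<open>christoffel M c k i j\<close> is \<open>\<Gamma>\<^sup>k\<^sub>i\<^sub>j\<close>, so that \<open>\<nabla>\<^sub>\<partial>\<^sub>i \<partial>\<^sub>j = \<Sum>k. \<Gamma>\<^sup>k\<^sub>i\<^sub>j \<partial>\<^sub>k\<close>.\<close>

definition christoffel ::
    "('m, 'n::finite, 'z) manifold_scheme \<Rightarrow> ('m, 'n) chart \<Rightarrow> 'n \<Rightarrow> 'n \<Rightarrow> 'n \<Rightarrow> real ^ 'n \<Rightarrow> real" where
  "christoffel M c k i j x =
     (\<Sum>l\<in>UNIV. matrix_inv (gmat M c x) $ k $ l *
        (partial_deriv i (\<lambda>y. gmat M c y $ j $ l) x +
         partial_deriv j (\<lambda>y. gmat M c y $ i $ l) x -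
         partial_deriv l (\<lambda>y. gmat M c y $ i $ j) x)) / 2"

text \<open>\<open>riemann M c l i j k\<close> is the \<open>\<partial>\<^sub>l\<close> component of \<open>R(\<partial>\<^sub>i, \<partial>\<^sub>j) \<partial>\<^sub>k\<close>, with the sign convention
  \<open>R(X,Y)Z = \<nabla>\<^sub>X \<nabla>\<^sub>Y Z - \<nabla>\<^sub>Y \<nabla>\<^sub>X Z - \<nabla>\<^sub>[\<^sub>X\<^sub>,\<^sub>Y\<^sub>] Z\<close>.\<close>

definition riemann ::
    "('m, 'n::finite, 'z) manifold_scheme \<Rightarrow> ('m, 'n) chart \<Rightarrow>
       'n \<Rightarrow> 'n \<Rightarrow> 'n \<Rightarrow> 'n \<Rightarrow> real ^ 'n \<Rightarrow> real" where
  "riemann M c l i j k x =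
     partial_deriv i (christoffel M c l j k) x - partial_deriv j (christoffel M c l i k) x +
     (\<Sum>p\<in>UNIV. christoffel M c l i p x * christoffel M c p j k x -
               christoffel M c l j p x * christoffel M c p i k x)"

text \<open>The curvature endomorphism: \<open>curv M p u v w\<close> is the tangent vector \<open>R(u,v)w\<close> at \<open>p\<close>.\<close>

definition curv ::
    "('m, 'n::finite, 'z) manifold_scheme \<Rightarrow> 'm \<Rightarrow>
       ('m, 'n) tvec \<Rightarrow> ('m, 'n) tvec \<Rightarrow> ('m, 'n) tvec \<Rightarrow> ('m, 'n) tvec" where
  "curv M p u v w =
     (\<lambda>c. if chart_at M p c
          then \<chi> l. \<Sum>i\<in>UNIV. \<Sum>j\<in>UNIV. \<Sum>k\<in>UNIV.
                 riemann M c l i j k (snd c p) * u c $ i * v c $ j * w c $ k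
          else 0)"

text \<open>\<open>Ric(v,w)\<close> is the trace of the endomorphism \<open>u \<mapsto> R(u,v)w\<close> of the tangent space; the trace is
  computed in the coordinate basis of an arbitrary chart around \<open>p\<close> and does not depend on it.\<close>

definition ricci ::
    "('m, 'n::finite, 'z) manifold_scheme \<Rightarrow> 'm \<Rightarrow> ('m, 'n) tvec \<Rightarrow> ('m, 'n) tvec \<Rightarrow> real" where
  "ricci M p v w =
     (let c = (SOME c. chart_at M p c)
      in \<Sum>i\<in>UNIV. curv M p (coord_vec M c p (axis i 1)) v w c $ i)"


section \<open>Geodesics, completeness and conjugate points\<close>

text \<open>Curves and fields along them are considered on an interval \<open>I\<close> with more than one point.
  All derivatives are taken within \<open>I\<close>, hence one-sided at end points of \<open>I\<close> belonging to it.\<close>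

definition velocity ::
    "('m, 'n::finite, 'z) manifold_scheme \<Rightarrow> real set \<Rightarrow> (real \<Rightarrow> 'm) \<Rightarrow> real \<Rightarrow> ('m, 'n) tvec" where
  "velocity M I \<gamma> t =
     (\<lambda>c. if chart_at M (\<gamma> t) c then vector_derivative (snd c \<circ> \<gamma>) (at t within I) else 0)"

definition differentiable_along ::
    "('m, 'n::finite, 'z) manifold_scheme \<Rightarrow> real set \<Rightarrow> (real \<Rightarrow> 'm) \<Rightarrow> (real \<Rightarrow> ('m, 'n) tvec) \<Rightarrow> bool"
where
  "differentiable_along M I \<gamma> V \<longleftrightarrow>
     (\<forall>t\<in>I. \<forall>c. chart_at M (\<gamma> t) c \<longrightarrow> (\<lambda>s. V s c) differentiable (at t within I))"

text \<open>The covariant derivative \<open>DV/dt\<close> of the vector field \<open>V\<close> along \<open>\<gamma>\<close>.\<close>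

definition cov_deriv ::
    "('m, 'n::finite, 'z) manifold_scheme \<Rightarrow> real set \<Rightarrow> (real \<Rightarrow> 'm) \<Rightarrow>
       (real \<Rightarrow> ('m, 'n) tvec) \<Rightarrow> real \<Rightarrow> ('m, 'n) tvec" where
  "cov_deriv M I \<gamma> V t =
     (\<lambda>c. if chart_at M (\<gamma> t) c
          then vector_derivative (\<lambda>s. V s c) (at t within I) +
               (\<chi> k. \<Sum>i\<in>UNIV. \<Sum>j\<in>UNIV.
                  christoffel M c k i j (snd c (\<gamma> t)) * velocity M I \<gamma> t c $ i * V t c $ j)
          else 0)"

definition geodesic_on ::
    "('m, 'n::finite, 'z) manifold_scheme \<Rightarrow> real set \<Rightarrow> (real \<Rightarrow> 'm) \<Rightarrow> bool" where
  "geodesic_on M I \<gamma> \<longleftrightarrow>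
     continuous_map (top_of_set I) (mtop M) \<gamma> \<and>
     (\<forall>t\<in>I. \<forall>c. chart_at M (\<gamma> t) c \<longrightarrow> (snd c \<circ> \<gamma>) differentiable (at t within I)) \<and>
     differentiable_along M I \<gamma> (velocity M I \<gamma>) \<and>
     (\<forall>t\<in>I. cov_deriv M I \<gamma> (velocity M I \<gamma>) t = (\<lambda>_. 0))"

definition unit_speed_on ::
    "('m, 'n::finite, 'z) manifold_scheme \<Rightarrow> real set \<Rightarrow> (real \<Rightarrow> 'm) \<Rightarrow> bool" where
  "unit_speed_on M I \<gamma> \<longleftrightarrow>
     (\<forall>t\<in>I. sqrt (rmetric M (\<gamma> t) (velocity M I \<gamma> t) (velocity M I \<gamma> t)) = 1)"

text \<open>Geodesic completeness (the exponential map is defined on every tangent space).\<close>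

definition complete_manifold :: "('m, 'n::finite, 'z) manifold_scheme \<Rightarrow> bool" where
  "complete_manifold M \<longleftrightarrow>
     (\<forall>p\<in>topspace (mtop M). \<forall>v\<in>tangent_space M p.
        \<exists>\<gamma>. geodesic_on M UNIV \<gamma> \<and> \<gamma> 0 = p \<and> velocity M UNIV \<gamma> 0 = v)"

text \<open>Solutions of the Jacobi equation \<open>J'' + R(J,\<gamma>')\<gamma>' = 0\<close>.\<close>

definition jacobi_field ::
    "('m, 'n::finite, 'z) manifold_scheme \<Rightarrow> real set \<Rightarrow> (real \<Rightarrow> 'm) \<Rightarrow>
       (real \<Rightarrow> ('m, 'n) tvec) \<Rightarrow> bool" where
  "jacobi_field M I \<gamma> J \<longleftrightarrow>
     (\<forall>t\<in>I. J t \<in> tangent_space M (\<gamma> t)) \<and>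
     differentiable_along M I \<gamma> J \<and>
     differentiable_along M I \<gamma> (cov_deriv M I \<gamma> J) \<and>
     (\<forall>t\<in>I. \<forall>c. cov_deriv M I \<gamma> (cov_deriv M I \<gamma> J) t c +
                 curv M (\<gamma> t) (J t) (velocity M I \<gamma> t) (velocity M I \<gamma> t) c = 0)"

definition conjugate_along ::
    "('m, 'n::finite, 'z) manifold_scheme \<Rightarrow> real set \<Rightarrow> (real \<Rightarrow> 'm) \<Rightarrow> real \<Rightarrow> real \<Rightarrow> bool" where
  "conjugate_along M I \<gamma> s t \<longleftrightarrow>
     (\<exists>J. jacobi_field M I \<gamma> J \<and> J s = (\<lambda>_. 0) \<and> J t = (\<lambda>_. 0) \<and> (\<exists>r\<in>I. J r \<noteq> (\<lambda>_. 0)))"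

definition first_conjugate_along ::
    "('m, 'n::finite, 'z) manifold_scheme \<Rightarrow> real set \<Rightarrow> (real \<Rightarrow> 'm) \<Rightarrow> real \<Rightarrow> real \<Rightarrow> bool" where
  "first_conjugate_along M I \<gamma> s t \<longleftrightarrow>
     s < t \<and> conjugate_along M I \<gamma> s t \<and> (\<forall>r. s < r \<and> r < t \<longrightarrow> \<not> conjugate_along M I \<gamma> s r)"

definition avg_radial_ricci ::
    "('m, 'n::finite, 'z) manifold_scheme \<Rightarrow> real set \<Rightarrow> (real \<Rightarrow> 'm) \<Rightarrow> real \<Rightarrow> real" where
  "avg_radial_ricci M I \<gamma> r =
     ricci M (\<gamma> r) (velocity M I \<gamma> r) (velocity M I \<gamma> r) / (real CARD('n) - 1)"

end

theory Submission
  imports Defs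
begin

text \<open>
  As there is no conjugate point before \<open>\<rho>\<close>, the Jacobi fields vanishing at \<open>0\<close> span the tangent
  spaces along the interior of the geodesic. Writing the covariant derivatives of such a frame in
  the frame itself gives a matrix \<open>A\<close> with \<open>A' = - R - A\<^sup>2\<close>, self-adjoint for the metric and with
  eigenvalue \<open>1/t\<close> on the field \<open>t \<gamma>'\<close>. Cauchy-Schwarz on the complement shows that
  \<open>u = (tr A - 1/t) / (n - 1)\<close> satisfies \<open>u' \<le> - (u\<^sup>2 + q)\<close>.

  The function \<open>F = u / (\<psi> + |u|)\<close> takes values in \<open>(-1, 1)\<close>. It is chosen because
  \<open>1 / (1 + |w|)\<^sup>2\<close> is the largest value of \<open>s / ((1 + s) (w\<^sup>2 + s))\<close> over \<open>s > 0\<close>: for constant \<open>\<psi>\<close>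
  this gives \<open>F' \<le> - \<psi> q / (\<psi>\<^sup>2 + q)\<close>, hence the bound \<open>2\<close>. The dependence of \<open>F\<close> on
  \<open>log \<psi>\<close> is Lipschitz with constant \<open>1/4\<close>, which accounts for the logarithmic term.
\<close>

section \<open>A Riccati comparison\<close>

text \<open>Two obstacles shape the analysis. \<open>\<psi>\<close> is only monotone, so
  \<open>F\<close> may jump and cannot be differentiated. \<open>\<psi>\<close> is therefore frozen
  at the left end of short intervals, where a derivative argument applies; the price is length times
  variation of \<open>\<psi>\<close>, which disappears under subdivision. Moreover nothing bounds
  \<open>u\<close> near the two ends, so all estimates live on closed intervals inside the open one.
  A strict inequality there would not survive the limit, so the gain has to be uniform in the end
  points. In the geometry, the direction of the geodesic is split off because R(v,v)v = 0 for the
  velocity v: it adds nothing to the Ricci trace but 1/t to the trace of \<open>A\<close>, and its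
  removal gives the divisor n - 1. Self-adjointness of \<open>A\<close> comes from a conserved
  Wronskian of Jacobi fields that vanish at 0. As tangent vectors are families of components over
  all charts, computations take place in one chart, and the transformation laws of Christoffel
  symbols and curvature, drawn from the Koszul formula, make them agree between charts.\<close>

definition integrand :: "real \<Rightarrow> real \<Rightarrow> real" where
  "integrand p q = p * q / (p\<^sup>2 + q)"

lemma integrand_bounds:
  assumes "p > 0" "q \<ge> 0"
  shows "0 \<le> integrand p q" "integrand p q \<le> p"
proof -
  have "p\<^sup>2 + q > 0" using assms by (simp add: add_pos_nonneg)
  then show "0 \<le> integrand p q" "integrand p q \<le> p" using assms by (auto simp: integrand_def divide_simps power2_eq_square algebra_simps)
qed

text \<open>The derivative in \<open>p\<close> is q (q - p^2) / (p^2 + q)^2, of modulus at most 1.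
  That the constant does not depend on \<open>q\<close> allows \<open>\<psi>\<close> to be frozen
  uniformly along the geodesic.\<close>

lemma integrand_lipschitz:
  assumes "p > 0" "p' > 0" "q \<ge> 0"
  shows "\<bar>integrand p q - integrand p' q\<bar> \<le> \<bar>p - p'\<bar>"
proof -
  have pos: "p\<^sup>2 + q > 0" "p'\<^sup>2 + q > 0" using assms by (simp_all add: add_pos_nonneg)
  have eq: "integrand p q - integrand p' q = (p - p') * (q * (q - p * p') / ((p\<^sup>2 + q) * (p'\<^sup>2 + q)))"
    using pos unfolding integrand_def by (simp add: field_simps power2_eq_square)
  have "\<bar>q * (q - p * p')\<bar> \<le> q * (q + p * p')"
    using assms by (simp add: abs_mult mult_left_mono abs_le_iff)
  also have "\<dots> \<le> (p\<^sup>2 + q) * (p'\<^sup>2 + q)"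
  proof -
    have "p * p' \<le> p\<^sup>2 + p'\<^sup>2"
      using sum_squares_bound[of p p'] assms mult_pos_pos[of p p'] by linarith
    then have "q * (p * p') \<le> q * (p\<^sup>2 + p'\<^sup>2)" using assms by (simp add: mult_left_mono)
    moreover have "0 \<le> p\<^sup>2 * p'\<^sup>2" by simp
    ultimately have "q * (q + p * p') \<le> q * q + q * (p\<^sup>2 + p'\<^sup>2) + p\<^sup>2 * p'\<^sup>2"
      unfolding distrib_left[of q q] by linarith
    also have "\<dots> = (p\<^sup>2 + q) * (p'\<^sup>2 + q)" by (simp add: algebra_simps)
    finally show ?thesis .
  qed
  finally have "\<bar>q * (q - p * p') / ((p\<^sup>2 + q) * (p'\<^sup>2 + q))\<bar> \<le> 1"
    using pos by (simp add: divide_simps abs_mult)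
  then show ?thesis unfolding eq abs_mult
    by (metis abs_ge_zero mult_left_le)
qed

text \<open>The kink of the absolute value at 0 enters the quotient only to second order, so the
  slope there is 1/p from both sides. Hence \<open>u\<close> may later change sign freely.\<close>

lemma ratio_has_derivative:
  fixes p :: real
  assumes "p > 0"
  shows "((\<lambda>u. u / (p + \<bar>u\<bar>)) has_real_derivative p / (p + \<bar>u\<bar>)\<^sup>2) (at u)"
proof (cases "u = 0")
  case True
  have "((\<lambda>h. (h / (p + \<bar>h\<bar>) - 0) / h) \<longlongrightarrow> 1 / p) (at 0)"
  proof (rule Lim_transform_eventually)
    show "((\<lambda>h. 1 / (p + \<bar>h\<bar>)) \<longlongrightarrow> 1 / p) (at 0)"
      by (rule tendsto_eq_intros refl | use assms in simp)+
    show "\<forall>\<^sub>F h in at 0. 1 / (p + \<bar>h\<bar>) = (h / (p + \<bar>h\<bar>) - 0) / h"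
      by (auto simp: eventually_at_filter)
  qed
  then show ?thesis using True assms by (simp add: has_field_derivative_iff power2_eq_square)
next
  case False
  then consider "u > 0" | "u < 0" by linarith
  then show ?thesis
  proof cases
    case 1
    have "((\<lambda>u. u / (p + u)) has_real_derivative p / (p + u)\<^sup>2) (at u)"
      using 1 assms by (auto intro!: derivative_eq_intros simp: power2_eq_square)
    then have "((\<lambda>u. u / (p + \<bar>u\<bar>)) has_real_derivative p / (p + u)\<^sup>2) (at u)"
      by (rule DERIV_cong_ev[THEN iffD1, rotated 3])
         (use 1 in \<open>auto intro!: eventually_mono[OF eventually_gt_at_top] eventually_nhds_in_open[of "{0<..}", THEN eventually_mono]\<close>)
    with 1 show ?thesis by simp
  next
    case 2
    have "((\<lambda>u. u / (p - u)) has_real_derivative p / (p - u)\<^sup>2) (at u)"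
      using 2 assms by (auto intro!: derivative_eq_intros simp: power2_eq_square)
    then have "((\<lambda>u. u / (p + \<bar>u\<bar>)) has_real_derivative p / (p - u)\<^sup>2) (at u)"
      by (rule DERIV_cong_ev[THEN iffD1, rotated 3])
         (use 2 in \<open>auto intro!: eventually_nhds_in_open[of "{..<0}", THEN eventually_mono]\<close>)
    with 2 show ?thesis by simp
  qed
qed

text \<open>Completing the square: the loss in the optimization over \<open>q\<close> is explicit
  and vanishes exactly when q = p |u|. The inequality needs only its sign, strictness needs its
  size.\<close>

lemma slope_integrand_gap:
  fixes p q u :: real
  assumes "p > 0" "q \<ge> 0"
  shows "p * (u\<^sup>2 + q) / (p + \<bar>u\<bar>)\<^sup>2 = integrand p q + p * (\<bar>u\<bar> * p - q)\<^sup>2 / ((p + \<bar>u\<bar>)\<^sup>2 * (p\<^sup>2 + q))"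
proof -
  define w where "w = \<bar>u\<bar>"
  have "u\<^sup>2 = w\<^sup>2" "w \<ge> 0" by (auto simp: w_def)
  moreover have "p\<^sup>2 + q \<noteq> 0" "p + w \<noteq> 0" using assms \<open>w \<ge> 0\<close>
    by (smt (verit) zero_less_power, linarith)
  ultimately show ?thesis unfolding integrand_def w_def[symmetric]
    by (simp add: divide_simps) (simp add: algebra_simps power2_eq_square)
qed

text \<open>In the variable ln p the derivative of w / (p + w) is - p w / (p + w)^2, and 4 p w \<le>
  (p + w)^2 gives the constant 1/4.\<close>

lemma ratio_log_bound:
  fixes u p p' :: real
  assumes "p > 0" "p' > 0"
  shows "\<bar>u / (p + \<bar>u\<bar>) - u / (p' + \<bar>u\<bar>)\<bar> \<le> 1/4 * \<bar>ln p - ln p'\<bar>"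
proof -
  have *: "\<bar>u / (p + \<bar>u\<bar>) - u / (p' + \<bar>u\<bar>)\<bar> \<le> 1/4 * (ln p' - ln p)"
    if pp: "p > 0" "p \<le> p'" for p p' :: real
  proof -
    define w where "w = \<bar>u\<bar>"
    have w: "w \<ge> 0" by (simp add: w_def)
    define h where "h x = ln x / 4 + w / (x + w)" for x
    have "h p \<le> h p'"
    proof (rule DERIV_nonneg_imp_nondecreasing[OF pp(2)])
      fix x assume "p \<le> x" "x \<le> p'"
      then have x: "x > 0" using pp by simp
      have "(h has_real_derivative (1 / x / 4 - w / (x + w)\<^sup>2)) (at x)"
        unfolding h_def using x w by (auto intro!: derivative_eq_intros simp: power2_eq_square)
      moreover have "1 / x / 4 - w / (x + w)\<^sup>2 \<ge> 0"
      proof -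
        have "4 * (x * w) \<le> (x + w)\<^sup>2" using sum_squares_bound[of x w] by (simp add: power2_sum algebra_simps)
        then have "w / (x + w)\<^sup>2 \<le> 1 / (4 * x)"
          using x w by (simp add: divide_simps add_pos_nonneg mult_ac)
        then show ?thesis by simp
      qed
      ultimately show "\<exists>y. (h has_real_derivative y) (at x) \<and> 0 \<le> y" by blast
    qed
    then have "w / (p + w) - w / (p' + w) \<le> 1/4 * (ln p' - ln p)" unfolding h_def by argo
    moreover have "w / (p' + w) \<le> w / (p + w)" using pp w by (intro divide_left_mono) auto
    moreover have "\<bar>u / (p + \<bar>u\<bar>) - u / (p' + \<bar>u\<bar>)\<bar> = \<bar>w / (p + w) - w / (p' + w)\<bar>"
      unfolding w_def by (cases "u \<ge> 0") auto
    ultimately show ?thesis by linarith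
  qed
  show ?thesis
  proof (cases "p \<le> p'")
    case True
    then have "ln p \<le> ln p'" using assms by simp
    with *[OF assms(1) True] show ?thesis by (simp add: abs_minus_commute)
  next
    case False
    then have "ln p' \<le> ln p" "p' \<le> p" using assms by auto
    with *[OF assms(2) this(2)] show ?thesis by (simp add: abs_minus_commute)
  qed
qed

text \<open>Bisecting an interval \<open>k\<close> times improves the right-hand side by the factor \<open>2 ^ - k\<close>. This
  replaces differentiation of terms containing \<open>\<psi>\<close>, which need not even be continuous.\<close>

lemma nonincreasing_if_superlinear_gap:
  fixes E h :: "real \<Rightarrow> real"
  assumes gap: "\<And>s t. a \<le> s \<Longrightarrow> s \<le> t \<Longrightarrow> t \<le> b \<Longrightarrow> E t - E s \<le> (t - s) * (h t - h s)"
    and "a \<le> b"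
  shows "E b \<le> E a"
proof -
  have *: "E t - E s \<le> (t - s) * (h t - h s) / 2 ^ k" if "a \<le> s" "s \<le> t" "t \<le> b" for s t k
    using that
  proof (induction k arbitrary: s t)
    case 0
    then show ?case using gap by simp
  next
    case (Suc k)
    define m where "m = (s + t) / 2"
    have m: "s \<le> m" "m \<le> t" "m - s = (t - s) / 2" "t - m = (t - s) / 2"
      using Suc.prems by (auto simp: m_def field_simps)
    have "E t - E m \<le> (t - s) / 2 * (h t - h m) / 2 ^ k"
      using Suc.IH[of m t] m Suc.prems by simp
    moreover have "E m - E s \<le> (t - s) / 2 * (h m - h s) / 2 ^ k"
      using Suc.IH[of s m] m Suc.prems by simp
    ultimately have "E t - E s \<le> (t - s) / 2 * (h t - h m) / 2 ^ k + (t - s) / 2 * (h m - h s) / 2 ^ k"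
      by linarith
    also have "\<dots> = (t - s) * (h t - h s) / 2 ^ Suc k" by (simp add: field_simps)
    finally show ?case .
  qed
  have "(\<lambda>k. (b - a) * (h b - h a) / 2 ^ k) \<longlonglongrightarrow> 0"
    using LIMSEQ_divide_realpow_zero[of 2] by simp
  then have "E b - E a \<le> 0"
    by (rule LIMSEQ_le_const) (use * assms(2) in auto)
  then show ?thesis by simp
qed

text \<open>The sign \<open>\<epsilon>\<close> makes \<open>\<epsilon> * \<psi>\<close> increasing, so that both monotonicity cases are treated at once.\<close>

locale riccati_supersolution =
  fixes \<rho> :: real and q u \<psi> :: "real \<Rightarrow> real" and \<epsilon> :: real
  assumes rho: "\<rho> > 0"
    and q_cont: "continuous_on {0..\<rho>} q"
    and q_nonneg: "\<And>r. r \<in> {0..\<rho>} \<Longrightarrow> q r \<ge> 0"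
    and psi_pos: "\<And>r. r \<ge> 0 \<Longrightarrow> \<psi> r > 0"
    and eps: "\<epsilon> = 1 \<or> \<epsilon> = -1"
    and psi_mono: "\<And>s t. 0 \<le> s \<Longrightarrow> s \<le> t \<Longrightarrow> \<epsilon> * \<psi> s \<le> \<epsilon> * \<psi> t"
    and riccati: "\<And>t. 0 < t \<Longrightarrow> t < \<rho> \<Longrightarrow> \<exists>d. (u has_real_derivative d) (at t) \<and> d \<le> - ((u t)\<^sup>2 + q t)"
begin

abbreviation f where "f r \<equiv> integrand (\<psi> r) (q r)"
definition F where "F r = u r / (\<psi> r + \<bar>u r\<bar>)"

text \<open>Variations turn into differences of one increasing function, and such differences
  telescope.\<close>

lemma abs_psi_diff: "0 \<le> s \<Longrightarrow> s \<le> t \<Longrightarrow> \<bar>\<psi> t - \<psi> s\<bar> = \<epsilon> * \<psi> t - \<epsilon> * \<psi> s"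
  using eps psi_mono[of s t] by auto

lemma ln_psi_mono: "0 \<le> s \<Longrightarrow> s \<le> t \<Longrightarrow> \<epsilon> * ln (\<psi> s) \<le> \<epsilon> * ln (\<psi> t)"
  using eps psi_mono[of s t] psi_pos[of s] psi_pos[of t] by auto

lemma abs_ln_psi_diff: "0 \<le> s \<Longrightarrow> s \<le> t \<Longrightarrow> \<bar>ln (\<psi> t) - ln (\<psi> s)\<bar> = \<epsilon> * ln (\<psi> t) - \<epsilon> * ln (\<psi> s)"
  using eps ln_psi_mono[of s t] by auto

lemma f_integrable:
  assumes "0 \<le> a" "b \<le> \<rho>"
  shows "f integrable_on {a..b}"
proof -
  have "\<psi> \<in> borel_measurable (restrict_space borel {0..\<rho>})"
  proof -
    have "(\<lambda>r. \<epsilon> * \<psi> r) \<in> borel_measurable (restrict_space borel {0..\<rho>})"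
      by (rule borel_measurable_mono_on_fnc) (auto intro!: mono_onI psi_mono)
    then have "(\<lambda>r. \<epsilon> * (\<epsilon> * \<psi> r)) \<in> borel_measurable (restrict_space borel {0..\<rho>})"
      by simp
    then show ?thesis using eps by (auto simp: mult.assoc[symmetric])
  qed
  moreover have "q \<in> borel_measurable (restrict_space borel {0..\<rho>})"
    by (rule borel_measurable_continuous_on_restrict[OF q_cont])
  ultimately have meas: "f \<in> borel_measurable (restrict_space borel {0..\<rho>})"
    unfolding integrand_def by measurable
  have "set_integrable lborel {0..\<rho>} f"
    unfolding set_integrable_def
  \<comment> \<open>\<open>\<psi> 0 + \<psi> \<rho>\<close> dominates \<open>\<psi>\<close> on the
    interval whether it increases or decreases, and \<open>integrand\<close> never exceeds its first
    argument.\<close>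
  proof (rule integrableI_bounded_set[where A = "{0..\<rho>}" and B = "\<psi> 0 + \<psi> \<rho>"])
    show "(\<lambda>x. indicat_real {0..\<rho>} x *\<^sub>R f x) \<in> borel_measurable lborel"
      using meas by (simp add: borel_measurable_restrict_space_iff mult.commute)
    have "\<bar>f x\<bar> \<le> \<psi> 0 + \<psi> \<rho>" if "x \<in> {0..\<rho>}" for x
      using integrand_bounds[OF psi_pos q_nonneg, of x x] that psi_mono[of 0 x] psi_mono[of x \<rho>] eps
        psi_pos[of 0] psi_pos[of \<rho>] by auto
    then show "AE x in lborel. x \<in> {0..\<rho>} \<longrightarrow> norm (indicat_real {0..\<rho>} x *\<^sub>R f x) \<le> \<psi> 0 + \<psi> \<rho>"
      by simp
  qed (auto simp: rho less_imp_le)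
  then have "f integrable_on {0..\<rho>}" by (rule set_borel_integral_eq_integral)
  then show ?thesis using assms by (auto intro: integrable_on_subinterval)
qed

text \<open>With the weight frozen at \<open>p\<close> the ratio is differentiable, and the Riccati
  inequality turns the pointwise estimate into a decreasing quantity. \<open>\<kappa>\<close> is 0
  for the plain bound and positive where a strict gain is available.\<close>

lemma constant_integrand_integral_le:
  assumes st: "0 < s" "s \<le> t" "t < \<rho>" and p: "p > 0"
    and gain: "\<And>r. s \<le> r \<Longrightarrow> r \<le> t \<Longrightarrow> integrand p (q r) + \<kappa> \<le> p * ((u r)\<^sup>2 + q r) / (p + \<bar>u r\<bar>)\<^sup>2"
  shows "integral {s..t} (\<lambda>r. integrand p (q r)) + \<kappa> * (t - s) \<le> u s / (p + \<bar>u s\<bar>) - u t / (p + \<bar>u t\<bar>)"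
    and "(\<lambda>r. integrand p (q r)) integrable_on {s..t}"
proof -
  have pq: "p\<^sup>2 + q r > 0" if "r \<in> {0..\<rho>}" for r
    using q_nonneg[OF that] p by (simp add: add_pos_nonneg)
  have cont: "continuous_on {s..t} (\<lambda>r. integrand p (q r))"
    unfolding integrand_def using st pq
    by (intro continuous_intros continuous_on_subset[OF q_cont]) (force simp: less_imp_neq[symmetric] dest: pq)+
  show int: "(\<lambda>r. integrand p (q r)) integrable_on {s..t}"
    by (rule integrable_continuous_interval[OF cont])
  define h where "h r = u r / (p + \<bar>u r\<bar>) + integral {s..r} (\<lambda>r. integrand p (q r)) + \<kappa> * (r - s)" for r
  have "h t \<le> h s"
  proof (rule DERIV_nonpos_imp_decreasing_open[OF st(2)])
    fix r assume r: "s < r" "r < t"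
    then obtain d where d: "(u has_real_derivative d) (at r)" "d \<le> - ((u r)\<^sup>2 + q r)"
      using riccati[of r] st by auto
    have "((\<lambda>r. integral {s..r} (\<lambda>r. integrand p (q r))) has_real_derivative integrand p (q r)) (at r within {s..t})"
      by (rule integral_has_real_derivative[OF cont]) (use r in auto)
    then have 1: "((\<lambda>r. integral {s..r} (\<lambda>r. integrand p (q r))) has_real_derivative integrand p (q r)) (at r)"
      using r at_within_Icc_at[of s r t] by simp
    have 2: "((\<lambda>r. u r / (p + \<bar>u r\<bar>)) has_real_derivative p / (p + \<bar>u r\<bar>)\<^sup>2 * d) (at r)"
      by (rule DERIV_chain'[OF d(1) ratio_has_derivative[OF p]])
    have der: "(h has_real_derivative (p / (p + \<bar>u r\<bar>)\<^sup>2 * d + integrand p (q r) + \<kappa>)) (at r)"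
      unfolding h_def by (rule derivative_eq_intros 1 2 refl | simp)+
    have "p / (p + \<bar>u r\<bar>)\<^sup>2 * d \<le> p / (p + \<bar>u r\<bar>)\<^sup>2 * (- ((u r)\<^sup>2 + q r))"
      using d(2) p by (intro mult_left_mono) auto
    moreover have "p / (p + \<bar>u r\<bar>)\<^sup>2 * (- ((u r)\<^sup>2 + q r)) = - (p * ((u r)\<^sup>2 + q r) / (p + \<bar>u r\<bar>)\<^sup>2)"
      by (simp only: mult_minus_right times_divide_eq_left)
    ultimately have "p / (p + \<bar>u r\<bar>)\<^sup>2 * d + integrand p (q r) + \<kappa> \<le> 0"
      using gain[of r] r by argo
    with der show "\<exists>y. (h has_real_derivative y) (at r) \<and> y \<le> 0" by blast
  next
    have "continuous_on {s..t} u"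
      using riccati st
      by (intro continuous_at_imp_continuous_on) (meson DERIV_isCont atLeastAtMost_iff le_less_trans less_le_trans)
    moreover have "p + \<bar>u r\<bar> \<noteq> 0" for r using p by linarith
    ultimately show "continuous_on {s..t} h" unfolding h_def
      by (intro continuous_intros indefinite_integral_continuous_1 int) auto
  qed
  then show "integral {s..t} (\<lambda>r. integrand p (q r)) + \<kappa> * (t - s) \<le> u s / (p + \<bar>u s\<bar>) - u t / (p + \<bar>u t\<bar>)"
    by (simp add: h_def)
qed

text \<open>The logarithmic term in \<open>E\<close> pays for the change of \<open>F\<close> caused
  by \<open>\<psi>\<close> alone, so that only an error of second order in the interval
  remains.\<close>

lemma integral_le_F_diff:
  assumes ab: "0 < a" "a \<le> b" "b < \<rho>"
    and gain: "\<And>r s. a \<le> r \<Longrightarrow> r \<le> b \<Longrightarrow> a \<le> s \<Longrightarrow> s \<le> b \<Longrightarrow>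
       integrand (\<psi> s) (q r) + \<kappa> \<le> \<psi> s * ((u r)\<^sup>2 + q r) / (\<psi> s + \<bar>u r\<bar>)\<^sup>2"
  shows "integral {a..b} f + \<kappa> * (b - a) \<le> F a - F b + 1/4 * (\<epsilon> * ln (\<psi> b) - \<epsilon> * ln (\<psi> a))"
proof -
  define E where "E t = integral {a..t} f + \<kappa> * t + F t - 1/4 * (\<epsilon> * ln (\<psi> t))" for t
  have "E b \<le> E a"
  \<comment> \<open>The error on an interval is its length times the variation of
    \<open>\<psi>\<close>, which is the increment of \<open>\<epsilon> * \<psi>\<close>.\<close>
  proof (rule nonincreasing_if_superlinear_gap[where E = E and a = a and b = b and h = "\<lambda>t. \<epsilon> * \<psi> t"])
    fix s t assume st: "a \<le> s" "s \<le> t" "t \<le> b"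
    let ?p = "\<psi> s"
    have s0: "0 < s" "t < \<rho>" and p: "?p > 0" using st ab psi_pos[of s] by auto
    note c = constant_integrand_integral_le[of s t ?p \<kappa>, OF s0(1) st(2) s0(2) p]
    have c1: "integral {s..t} (\<lambda>r. integrand ?p (q r)) + \<kappa> * (t - s) \<le> u s / (?p + \<bar>u s\<bar>) - u t / (?p + \<bar>u t\<bar>)"
      and c2: "(\<lambda>r. integrand ?p (q r)) integrable_on {s..t}"
      using c gain st by auto
    have split: "integral {a..t} f = integral {a..s} f + integral {s..t} f"
      by (rule Henstock_Kurzweil_Integration.integral_combine[symmetric]) (use st ab in \<open>auto intro!: f_integrable\<close>)
    have "integral {s..t} f \<le> integral {s..t} (\<lambda>r. integrand ?p (q r) + (\<epsilon> * \<psi> t - \<epsilon> * \<psi> s))"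
    proof (rule integral_le)
      fix r assume r: "r \<in> {s..t}"
      have "\<bar>f r - integrand ?p (q r)\<bar> \<le> \<bar>\<psi> r - \<psi> s\<bar>"
        by (rule integrand_lipschitz) (use r s0 p in \<open>auto intro!: psi_pos q_nonneg\<close>)
      also have "\<dots> = \<epsilon> * \<psi> r - \<epsilon> * \<psi> s" by (rule abs_psi_diff) (use r s0 in auto)
      also have "\<dots> \<le> \<epsilon> * \<psi> t - \<epsilon> * \<psi> s" using psi_mono[of r t] r s0 by auto
      finally show "f r \<le> integrand ?p (q r) + (\<epsilon> * \<psi> t - \<epsilon> * \<psi> s)" by linarith
    qed (use st ab c2 in \<open>auto intro!: f_integrable integrable_add\<close>)
    also have "\<dots> = integral {s..t} (\<lambda>r. integrand ?p (q r)) + (t - s) * (\<epsilon> * \<psi> t - \<epsilon> * \<psi> s)"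
      using st by (subst integral_add[OF c2]) auto
    finally have "integral {s..t} f + \<kappa> * (t - s) \<le>
        u s / (?p + \<bar>u s\<bar>) - u t / (?p + \<bar>u t\<bar>) + (t - s) * (\<epsilon> * \<psi> t - \<epsilon> * \<psi> s)" using c1 by linarith
    moreover have "\<bar>F t - u t / (?p + \<bar>u t\<bar>)\<bar> \<le> 1/4 * \<bar>ln (\<psi> t) - ln (\<psi> s)\<bar>"
      unfolding F_def by (rule ratio_log_bound) (use s0 st in \<open>auto intro!: psi_pos\<close>)
    moreover have "\<bar>ln (\<psi> t) - ln (\<psi> s)\<bar> = \<epsilon> * ln (\<psi> t) - \<epsilon> * ln (\<psi> s)"
      by (rule abs_ln_psi_diff) (use s0 st in auto)
    ultimately have "\<kappa> * (t - s) + integral {s..t} f + F t - F s \<le>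
        (t - s) * (\<epsilon> * \<psi> t - \<epsilon> * \<psi> s) + 1/4 * (\<epsilon> * ln (\<psi> t) - \<epsilon> * ln (\<psi> s))"
      unfolding F_def[of s] abs_le_iff by argo
    moreover have "\<kappa> * (t - s) = \<kappa> * t - \<kappa> * s" by (simp add: algebra_simps)
    ultimately show "E t - E s \<le> (t - s) * (\<epsilon> * \<psi> t - \<epsilon> * \<psi> s)"
      unfolding E_def split by argo
  qed (use ab in auto)
  then show ?thesis by (simp add: E_def algebra_simps)
qed

lemma slope_ge_integrand:
  assumes "0 \<le> r" "r \<le> \<rho>" "0 \<le> s"
  shows "integrand (\<psi> s) (q r) \<le> \<psi> s * ((u r)\<^sup>2 + q r) / (\<psi> s + \<bar>u r\<bar>)\<^sup>2"
  using psi_pos[of s] q_nonneg[of r] assms by (subst slope_integrand_gap) (auto intro!: divide_nonneg_nonneg)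

lemma F_less: "0 \<le> r \<Longrightarrow> \<bar>F r\<bar> < 1"
  using psi_pos[of r] by (auto simp: F_def divide_simps abs_if)

lemma u_antimono: "0 < s \<Longrightarrow> s \<le> t \<Longrightarrow> t < \<rho> \<Longrightarrow> u t \<le> u s"
proof (rule DERIV_nonpos_imp_nonincreasing[where f = u])
  fix r assume "0 < s" "s \<le> t" "t < \<rho>" "s \<le> r" "r \<le> t"
  then obtain d where "(u has_real_derivative d) (at r)" "d \<le> - ((u r)\<^sup>2 + q r)"
    using riccati[of r] by auto
  moreover have "0 \<le> (u r)\<^sup>2 + q r" using q_nonneg[of r] \<open>0 < s\<close> \<open>s \<le> r\<close> \<open>r \<le> t\<close> \<open>t < \<rho>\<close> by auto
  ultimately show "\<exists>y. (u has_real_derivative y) (at r) \<and> y \<le> 0" by (intro exI[of _ d]) auto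
qed auto

abbreviation "\<Lambda> \<equiv> \<epsilon> * ln (\<psi> \<rho>) - \<epsilon> * ln (\<psi> 0)"

text \<open>Strictness: either \<open>u\<close> is bounded above, so that \<open>F\<close> stays away from \<open>1\<close>, or \<open>u\<close> is large on
  some interval, where the pointwise inequality \<open>slope_ge_integrand\<close> is strict.\<close>

lemma uniform_gap:
  obtains \<delta> c d where "\<delta> > 0" "0 < c" "c \<le> d" "d < \<rho>"
    "\<And>a b. 0 < a \<Longrightarrow> a \<le> c \<Longrightarrow> d \<le> b \<Longrightarrow> b < \<rho> \<Longrightarrow> integral {a..b} f \<le> 2 - \<delta> + 1/4 * \<Lambda>"
proof -
  have basic: "integral {a..b} f \<le> F a - F b + 1/4 * (\<epsilon> * ln (\<psi> b) - \<epsilon> * ln (\<psi> a))"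
    if "0 < a" "a \<le> b" "b < \<rho>" for a b
    using integral_le_F_diff[of a b 0] slope_ge_integrand that by auto
  have lam: "\<epsilon> * ln (\<psi> b) - \<epsilon> * ln (\<psi> a) \<le> \<Lambda>" if "0 < a" "a \<le> b" "b < \<rho>" for a b
    using ln_psi_mono[of 0 a] ln_psi_mono[of b \<rho>] that by auto
  define m where "m = min (\<psi> 0) (\<psi> \<rho>)"
  define P where "P = max (\<psi> 0) (\<psi> \<rho>)"
  have m: "m > 0" using psi_pos[of 0] psi_pos[of \<rho>] rho by (auto simp: m_def)
  have mP: "m \<le> \<psi> r" "\<psi> r \<le> P" if "r \<in> {0..\<rho>}" for r
    using that eps psi_mono[of 0 r] psi_mono[of r \<rho>] by (auto simp: m_def P_def)
  obtain Q where Q: "\<And>r. r \<in> {0..\<rho>} \<Longrightarrow> q r \<le> Q"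
    using compact_continuous_image[OF q_cont compact_Icc, THEN compact_imp_bounded]
    unfolding bounded_iff by (metis abs_le_D1 image_eqI real_norm_def)
  have Q0: "Q \<ge> 0" using Q[of 0] q_nonneg[of 0] rho by auto
  \<comment> \<open>Chosen so that u \<ge> B forces u \<psi> - q \<ge> 1: the square in
    \<open>slope_integrand_gap\<close> is then bounded below.\<close>
  define B where "B = (Q + 1) / m"
  have B: "B > 0" using Q0 m by (simp add: B_def)
  show thesis
  proof (cases "\<exists>b. 0 < b \<and> b < \<rho> \<and> B \<le> u b")
    case False
    \<comment> \<open>1 - \<open>\<delta>\<close> is the ratio u / (\<psi> + u) at u = B, \<psi> =
      m, the extreme case because it grows with u and falls with \<psi>.\<close>
    define \<delta> where "\<delta> = m / (m + B)"
    have \<delta>: "\<delta> > 0" using m B by (simp add: \<delta>_def)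
    have F1: "F a \<le> 1 - \<delta>" if "0 < a" "a < \<rho>" for a
    proof -
      have a: "m \<le> \<psi> a" "u a < B" using mP[of a] False that by auto
      show ?thesis
      proof (cases "u a \<ge> 0")
        case True
        have "m * u a \<le> \<psi> a * B" using a m True by (intro mult_mono) auto
        then show ?thesis using True a m B by (simp add: F_def \<delta>_def divide_simps algebra_simps)
      next
        case neg: False
        have "F a \<le> 0" using neg a m by (simp add: F_def divide_nonpos_nonneg)
        also have "0 \<le> 1 - \<delta>" using m B by (simp add: \<delta>_def)
        finally show ?thesis .
      qed
    qed
    show thesis
    proof (rule that[of \<delta> "\<rho>/2" "\<rho>/2"])
      fix a b assume "0 < a" "a \<le> \<rho>/2" "\<rho>/2 \<le> b" "b < \<rho>"
      then show "integral {a..b} f \<le> 2 - \<delta> + 1/4 * \<Lambda>"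
        using basic[of a b] lam[of a b] F1[of a] F_less[of b] rho by (auto simp: abs_less_iff) argo?
    qed (use \<delta> rho in auto)
  next
    case True
    then obtain b0 where b0: "0 < b0" "b0 < \<rho>" "B \<le> u b0" by blast
    \<comment> \<open>As \<open>u\<close> decreases, it stays above \<open>B\<close> on all of
      [a0, b0]. Starting at a positive point also supplies the upper bound \<open>U\<close>, which
      need not exist near 0.\<close>
    define a0 where "a0 = b0 / 2"
    have a0: "0 < a0" "a0 < b0" "a0 < \<rho>" using b0 by (auto simp: a0_def)
    define U where "U = u a0"
    \<comment> \<open>A lower bound for the square term of \<open>slope_integrand_gap\<close>: the
      smallest numerator over the largest denominator.\<close>
    define \<kappa> where "\<kappa> = m / ((P + U)\<^sup>2 * (P\<^sup>2 + Q))"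
    have P: "P > 0" using m by (auto simp: m_def P_def)
    have U: "U > 0" using u_antimono[of a0 b0] a0 b0 B by (auto simp: U_def)
    have \<kappa>: "\<kappa> > 0" using P U Q0 m by (auto simp: \<kappa>_def intro!: divide_pos_pos mult_pos_pos add_pos_nonneg)
    have gain: "integrand (\<psi> s) (q r) + \<kappa> \<le> \<psi> s * ((u r)\<^sup>2 + q r) / (\<psi> s + \<bar>u r\<bar>)\<^sup>2"
      if r: "a0 \<le> r" "r \<le> b0" and s: "a0 \<le> s" "s \<le> b0" for r s
    proof -
      have u: "B \<le> u r" "u r \<le> U" "u r > 0"
        using u_antimono[of r b0] u_antimono[of a0 r] r a0 b0 B by (auto simp: U_def)
      have ps: "m \<le> \<psi> s" "\<psi> s \<le> P" "0 < \<psi> s" using mP[of s] s a0 b0 m by auto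
      have qr: "0 \<le> q r" "q r \<le> Q" using q_nonneg[of r] Q[of r] r a0 b0 by auto
      have "Q + 1 = B * m" using m by (simp add: B_def)
      also have "\<dots> \<le> u r * \<psi> s" using u ps m B by (intro mult_mono) auto
      finally have "1 \<le> u r * \<psi> s - q r" using qr by linarith
      then have 1: "1 \<le> (u r * \<psi> s - q r)\<^sup>2" by (simp add: one_le_power)
      have "\<kappa> \<le> \<psi> s * 1 / ((\<psi> s + u r)\<^sup>2 * ((\<psi> s)\<^sup>2 + q r))"
        unfolding \<kappa>_def mult_1_right
      proof (rule frac_le)
        show "(\<psi> s + u r)\<^sup>2 * ((\<psi> s)\<^sup>2 + q r) \<le> (P + U)\<^sup>2 * (P\<^sup>2 + Q)"
          using ps u qr P by (intro mult_mono power_mono add_mono) auto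
        show "0 < (\<psi> s + u r)\<^sup>2 * ((\<psi> s)\<^sup>2 + q r)"
          using ps u qr by (intro mult_pos_pos add_pos_nonneg) auto
      qed (use ps in auto)
      also have "\<dots> \<le> \<psi> s * (u r * \<psi> s - q r)\<^sup>2 / ((\<psi> s + u r)\<^sup>2 * ((\<psi> s)\<^sup>2 + q r))"
        using 1 ps qr by (intro divide_right_mono mult_left_mono) auto
      finally show ?thesis
        using slope_integrand_gap[of "\<psi> s" "q r" "u r"] ps qr u by simp
    qed
    show thesis
    proof (rule that[of "\<kappa> * (b0 - a0)" a0 b0])
      show "\<kappa> * (b0 - a0) > 0" using \<kappa> a0 by simp
    next
      fix a b assume ab: "0 < a" "a \<le> a0" "b0 \<le> b" "b < \<rho>"
      have "integral {a..b} f = integral {a..a0} f + integral {a0..b} f"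
        by (rule Henstock_Kurzweil_Integration.integral_combine[symmetric]) (use ab a0 in \<open>auto intro!: f_integrable\<close>)
      also have "integral {a0..b} f = integral {a0..b0} f + integral {b0..b} f"
        by (rule Henstock_Kurzweil_Integration.integral_combine[symmetric]) (use ab a0 in \<open>auto intro!: f_integrable\<close>)
      finally have "integral {a..b} f = integral {a..a0} f + (integral {a0..b0} f + integral {b0..b} f)" .
      moreover have "integral {a0..b0} f + \<kappa> * (b0 - a0) \<le> F a0 - F b0 + 1/4 * (\<epsilon> * ln (\<psi> b0) - \<epsilon> * ln (\<psi> a0))"
        by (rule integral_le_F_diff) (use a0 b0 gain in auto)
      ultimately show "integral {a..b} f \<le> 2 - \<kappa> * (b0 - a0) + 1/4 * \<Lambda>"
        using basic[of a a0] basic[of b0 b] lam[of a b] F_less[of a] F_less[of b] ab a0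
        by (auto simp: abs_less_iff) argo?
    qed (use a0 b0 in auto)
  qed
qed

text \<open>The bounded integrand makes the two end pieces arbitrarily small, while the gain
  \<open>\<delta>\<close> is independent of where they are cut.\<close>

lemma integral_less: "integral {0..\<rho>} f < 2 + 1/4 * \<Lambda>"
proof -
  obtain \<delta> c d where gap: "\<delta> > 0" "0 < c" "c \<le> d" "d < \<rho>"
    "\<And>a b. 0 < a \<Longrightarrow> a \<le> c \<Longrightarrow> d \<le> b \<Longrightarrow> b < \<rho> \<Longrightarrow> integral {a..b} f \<le> 2 - \<delta> + 1/4 * \<Lambda>"
    using uniform_gap by blast
  define C where "C = \<psi> 0 + \<psi> \<rho>"
  have C: "C > 0" using psi_pos[of 0] psi_pos[of \<rho>] rho by (simp add: C_def)
  have fC: "f x \<le> C" if "x \<in> {0..\<rho>}" for x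
    using integrand_bounds[OF psi_pos q_nonneg, of x x] that psi_mono[of 0 x] psi_mono[of x \<rho>] eps
      psi_pos[of 0] psi_pos[of \<rho>] by (auto simp: C_def)
  have small: "integral {a..b} f \<le> C * (b - a)" if "0 \<le> a" "a \<le> b" "b \<le> \<rho>" for a b
    using integral_le[of f "{a..b}" "\<lambda>_. C"] fC that f_integrable[of a b] by (auto simp: mult.commute)
  \<comment> \<open>Each end piece costs at most a quarter of \<open>\<delta>\<close>, so half of
    the gain is left.\<close>
  define \<eta> where "\<eta> = \<delta> / (4 * C)"
  have \<eta>: "\<eta> > 0" "C * \<eta> = \<delta> / 4" using gap C by (auto simp: \<eta>_def)
  define a where "a = min c \<eta>"
  define b where "b = max d (\<rho> - \<eta>)"
  have ab: "0 < a" "a \<le> c" "a \<le> \<eta>" "d \<le> b" "b < \<rho>" "\<rho> - b \<le> \<eta>" "a \<le> b"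
    using gap \<eta> by (auto simp: a_def b_def)
  have "integral {0..\<rho>} f = integral {0..a} f + integral {a..\<rho>} f"
    by (rule Henstock_Kurzweil_Integration.integral_combine[symmetric]) (use ab in \<open>auto intro!: f_integrable\<close>)
  also have "integral {a..\<rho>} f = integral {a..b} f + integral {b..\<rho>} f"
    by (rule Henstock_Kurzweil_Integration.integral_combine[symmetric]) (use ab in \<open>auto intro!: f_integrable\<close>)
  finally have "integral {0..\<rho>} f = integral {0..a} f + (integral {a..b} f + integral {b..\<rho>} f)" .
  moreover have "integral {0..a} f \<le> C * \<eta>"
    by (rule order_trans[OF small mult_left_mono]) (use ab C in auto)
  moreover have "integral {b..\<rho>} f \<le> C * \<eta>"
    by (rule order_trans[OF small mult_left_mono]) (use ab C in auto)
  moreover have "integral {a..b} f \<le> 2 - \<delta> + 1/4 * \<Lambda>" using gap ab by blast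
  ultimately show ?thesis using \<eta> gap(1) by linarith
qed

end

theorem riccati_integral_bound:
  fixes q u \<psi> :: "real \<Rightarrow> real"
  assumes "\<rho> > 0"
    and "continuous_on {0..\<rho>} q"
    and "\<And>r. r \<in> {0..\<rho>} \<Longrightarrow> q r \<ge> 0"
    and "\<And>r. r \<ge> 0 \<Longrightarrow> \<psi> r > 0"
    and mon: "mono_on {0..} \<psi> \<or> antimono_on {0..} \<psi>"
    and "\<And>t. 0 < t \<Longrightarrow> t < \<rho> \<Longrightarrow> \<exists>d. (u has_real_derivative d) (at t) \<and> d \<le> - ((u t)\<^sup>2 + q t)"
  shows "(\<lambda>r. \<psi> r * q r / ((\<psi> r)\<^sup>2 + q r)) integrable_on {0..\<rho>}"
    and "integral {0..\<rho>} (\<lambda>r. \<psi> r * q r / ((\<psi> r)\<^sup>2 + q r)) < 2 + 1 / 4 * \<bar>ln (\<psi> \<rho> / \<psi> 0)\<bar>"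
proof -
  obtain \<epsilon> :: real where \<epsilon>: "\<epsilon> = 1 \<or> \<epsilon> = -1"
    "\<And>s t. 0 \<le> s \<Longrightarrow> s \<le> t \<Longrightarrow> \<epsilon> * \<psi> s \<le> \<epsilon> * \<psi> t"
    using mon
  proof
    assume "mono_on {0..} \<psi>"
    then show thesis by (intro that[of 1]) (auto simp: monotone_on_def)
  next
    assume "antimono_on {0..} \<psi>"
    then show thesis by (intro that[of "-1"]) (auto simp: monotone_on_def)
  qed
  interpret riccati_supersolution \<rho> q u \<psi> \<epsilon>
    by unfold_locales (use assms \<epsilon> in auto)
  have pos: "\<psi> \<rho> > 0" "\<psi> 0 > 0" using assms by auto
  have "\<bar>ln (\<psi> \<rho> / \<psi> 0)\<bar> = \<epsilon> * ln (\<psi> \<rho>) - \<epsilon> * ln (\<psi> 0)"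
    using abs_ln_psi_diff[of 0 \<rho>] pos rho by (simp add: ln_div)
  then show "(\<lambda>r. \<psi> r * q r / ((\<psi> r)\<^sup>2 + q r)) integrable_on {0..\<rho>}"
    "integral {0..\<rho>} (\<lambda>r. \<psi> r * q r / ((\<psi> r)\<^sup>2 + q r)) < 2 + 1 / 4 * \<bar>ln (\<psi> \<rho> / \<psi> 0)\<bar>"
    using f_integrable[of 0 \<rho>] integral_less by (simp_all add: integrand_def)
qed

section \<open>A trace inequality for self-adjoint matrices\<close>

lemma matrix_mult_scaleR:
  fixes A :: "real^'m^'n" and B :: "real^'k^'m"
  shows "A ** (c *\<^sub>R B) = c *\<^sub>R (A ** B)" "(c *\<^sub>R A) ** B = c *\<^sub>R (A ** B)"
  by (simp_all add: vec_eq_iff matrix_matrix_mult_def sum_distrib_left mult_ac)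

lemma matrix_mult_diff:
  fixes A :: "real^'m^'n"
  shows "A ** (B - C) = A ** B - A ** C" "(A - A') ** B = A ** B - A' ** B"
  by (simp_all add: vec_eq_iff matrix_matrix_mult_def sum_subtractf algebra_simps)

definition mform :: "real^'n^'n \<Rightarrow> real^'n \<Rightarrow> real^'n \<Rightarrow> real" where
  "mform H u v = u \<bullet> (H *v v)"

lemma bilinear_mform:
  fixes H :: "real^'n^'n"
  shows "bilinear (mform H)"
proof -
  have "H *v (c *\<^sub>R x) = c *\<^sub>R (H *v x)" for c and x :: "real^'n"
    by (rule linear_scale[OF matrix_vector_mul_linear])
  then show ?thesis
    unfolding bilinear_def mform_def
    by (intro conjI allI linearI) (simp_all add: inner_add_left inner_add_right matrix_vector_right_distrib)
qed

lemma dot_transpose_left: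
  fixes A :: "real^'n^'m"
  shows "(transpose A *v x) \<bullet> y = x \<bullet> (A *v y)"
  unfolding transpose_matrix_vector by (rule dot_lmul_matrix)

lemma mform_sym: "transpose H = H \<Longrightarrow> mform H u v = mform H v u"
  by (simp add: mform_def inner_commute[of u] dot_transpose_left[of H v u, symmetric])

text \<open>Orthonormal vectors are added one index at a time; each new one lies in the kernel of
  the pairings with the old ones and is then normalized.\<close>

lemma orthonormal_family_exists:
  fixes H :: "real^'n^'n"
  assumes sym: "transpose H = H" and pos: "\<And>v. v \<noteq> 0 \<Longrightarrow> mform H v v > 0"
  shows "\<exists>v. \<forall>i\<in>(S::'n set). \<forall>j\<in>S. mform H (v i) (v j) = (if i = j then 1 else 0)"
proof (induction S rule: infinite_finite_induct)
  case (insert k S)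
  then obtain v where v: "\<And>i j. i \<in> S \<Longrightarrow> j \<in> S \<Longrightarrow> mform H (v i) (v j) = (if i = j then 1 else 0)" by blast
  interpret bil: bounded_bilinear "mform H" by (rule bilinear_conv_bounded_bilinear[THEN iffD1, OF bilinear_mform])
  define L where "L w = (\<chi> i. if i \<in> S then mform H (v i) w else 0)" for w :: "real^'n"
  have lin: "linear L"
    by (rule linearI) (auto simp: L_def vec_eq_iff bil.add_right bil.scaleR_right)
  \<comment> \<open>Coordinate \<open>k\<close> of \<open>L\<close> is always 0 since
    \<open>k\<close> is not in \<open>S\<close>. In equal finite dimensions failure of surjectivity
    produces a kernel vector.\<close>
  have "\<not> surj L"
  proof
    assume "surj L"
    then obtain w where "L w = axis k 1" by (metis surjD)
    then have "L w $ k = 1" by simp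
    then show False using insert.hyps by (simp add: L_def)
  qed
  then have "\<not> inj L" using linear_injective_imp_surjective[OF lin] by blast
  then obtain w where w: "w \<noteq> 0" "L w = 0" using linear_injective_0[OF lin] by blast
  define e where "e = (1 / sqrt (mform H w w)) *\<^sub>R w"
  have "mform H (v i) w = 0" if "i \<in> S" for i
    using w(2) that by (auto simp: L_def vec_eq_iff dest!: spec[of _ i])
  then have 1: "mform H (v i) e = 0" "mform H e (v i) = 0" if "i \<in> S" for i
    using that mform_sym[OF sym, of e "v i"] by (auto simp: e_def bil.scaleR_right)
  have 2: "mform H e e = 1"
    using pos[OF w(1)] by (simp add: e_def bil.scaleR_right bil.scaleR_left)
  show ?case
    by (rule exI[of _ "v(k := e)"]) (use v 1 2 insert.hyps in auto)
qed (auto intro: exI[of _ undefined])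

text \<open>In an \<open>H\<close>-orthonormal basis a self-adjoint map has a symmetric matrix
  \<open>B\<close>, and the trace of its square is the sum of the squared entries.
  \<open>transpose C ** H\<close> is the inverse of the change of basis \<open>C\<close>.\<close>

lemma trace_square_nonneg:
  fixes H S :: "real^'n^'n"
  assumes sym: "transpose H = H" and pos: "\<And>v. v \<noteq> 0 \<Longrightarrow> mform H v v > 0"
    and adj: "transpose (H ** S) = H ** S"
  shows "trace (S ** S) \<ge> 0"
proof -
  obtain v :: "'n \<Rightarrow> real^'n" where v: "\<And>i j. mform H (v i) (v j) = (if i = j then 1 else 0)"
    using orthonormal_family_exists[OF sym pos, of UNIV] by auto
  define C :: "real^'n^'n" where "C = (\<chi> i j. v j $ i)"
  have colC: "C *v axis j 1 = v j" for j
    by (simp add: C_def vec_eq_iff matrix_vector_mult_def axis_def if_distrib cong: if_cong)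
  have entry: "(transpose C ** A ** C) $ i $ j = v i \<bullet> (A *v v j)" for A i j
  proof -
    have "(transpose C ** A ** C) $ i $ j = ((transpose C ** A ** C) *v axis j 1) \<bullet> axis i 1"
      by (simp add: inner_axis matrix_vector_mul_component)
    also have "\<dots> = (transpose C *v (A *v (C *v axis j 1))) \<bullet> axis i 1"
      by (simp add: matrix_vector_mul_assoc matrix_mul_assoc)
    also have "\<dots> = (A *v (C *v axis j 1)) \<bullet> (C *v axis i 1)" by (rule dot_transpose_left)
    finally show ?thesis by (simp add: colC inner_commute)
  qed
  have CHC: "transpose C ** H ** C = mat 1"
    unfolding vec_eq_iff using entry[of H] v by (simp add: mform_def mat_def)
  then have inv: "C ** (transpose C ** H) = mat 1" by (simp add: matrix_left_right_inverse)
  define B where "B = transpose C ** (H ** S) ** C"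
  have "S ** S = C ** (transpose C ** H) ** S ** (C ** (transpose C ** H)) ** S" by (simp add: inv)
  also have "\<dots> = C ** (transpose C ** (H ** S) ** C ** (transpose C ** (H ** S)))"
    by (simp add: matrix_mul_assoc)
  finally have "trace (S ** S) = trace (transpose C ** (H ** S) ** C ** (transpose C ** (H ** S)) ** C)"
    by (subst trace_mul_sym) simp
  also have "\<dots> = trace (B ** B)" by (simp add: B_def matrix_mul_assoc)
  also have "transpose B = B"
    unfolding B_def by (subst matrix_transpose_mul, subst matrix_transpose_mul) (simp add: adj matrix_mul_assoc)
  then have "trace (B ** B) = trace (transpose B ** B)" by simp
  also have "\<dots> = (\<Sum>i\<in>UNIV. \<Sum>k\<in>UNIV. (B $ k $ i)\<^sup>2)"
    by (simp add: trace_def matrix_matrix_mult_def transpose_def power2_eq_square)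
  also have "\<dots> \<ge> 0" by (intro sum_nonneg) auto
  finally show ?thesis .
qed

lemma trace_scaleR: "trace (c *\<^sub>R A) = c * trace (A :: real^'n^'n)"
  by (simp add: trace_def sum_distrib_left)

text \<open>With \<open>P\<close> the \<open>H\<close>-orthogonal projection onto the eigenvector \<open>e\<close> and \<open>\<mu>\<close> the mean of the remaining
  eigenvalues, this is \<open>trace (S ** S) \<ge> 0\<close> for \<open>S = M - \<mu> *\<^sub>R mat 1 - (\<nu> - \<mu>) *\<^sub>R P\<close>.\<close>

lemma trace_square_ge:
  fixes H M :: "real^'n^'n"
  assumes sym: "transpose H = H" and pos: "\<And>v. v \<noteq> 0 \<Longrightarrow> mform H v v > 0"
    and adj: "transpose (H ** M) = H ** M"
    and eig: "M *v e = \<nu> *\<^sub>R e" "e \<noteq> 0"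
    and n: "CARD('n) \<ge> 2"
  shows "trace (M ** M) - \<nu>\<^sup>2 \<ge> (trace M - \<nu>)\<^sup>2 / (real CARD('n) - 1)"
proof -
  define c where "c = mform H e e"
  have c: "c > 0" using pos eig by (simp add: c_def)
  define P :: "real^'n^'n" where "P = (\<chi> i j. e $ i * (H *v e) $ j / c)"
  have Pv: "P *v x = (mform H e x / c) *\<^sub>R e" for x
  proof -
    have "mform H e x = (H *v e) \<bullet> x"
      by (metis mform_sym[OF sym] mform_def inner_commute)
    then show ?thesis
      by (simp add: vec_eq_iff P_def matrix_vector_mult_def inner_vec_def sum_distrib_left sum_divide_distrib mult_ac)
  qed
  have HM: "mform H (M *v x) y = mform H x (M *v y)" for x y
  proof -
    have "mform H x (M *v y) = x \<bullet> ((H ** M) *v y)" by (simp add: mform_def matrix_vector_mul_assoc)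
    also have "\<dots> = ((H ** M) *v x) \<bullet> y" using dot_transpose_left[of "H ** M" x y] by (simp add: adj)
    also have "\<dots> = mform H y (M *v x)" by (simp add: mform_def matrix_vector_mul_assoc inner_commute)
    finally show ?thesis using mform_sym[OF sym] by metis
  qed
  interpret bil: bounded_bilinear "mform H" by (rule bilinear_conv_bounded_bilinear[THEN iffD1, OF bilinear_mform])
  \<comment> \<open>\<open>PM\<close> is where self-adjointness enters: pairing \<open>e\<close>
    with \<open>M *v x\<close> equals pairing \<open>M *v e\<close> with \<open>x\<close>.\<close>
  have PP: "P ** P = P" and MP: "M ** P = \<nu> *\<^sub>R P" and PM: "P ** M = \<nu> *\<^sub>R P"
    unfolding matrix_eq
    using c by (auto simp: matrix_vector_mul_assoc[symmetric] Pv bil.scaleR_right bil.scaleR_left c_def[symmetric]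
        matrix_vector_mult_scaleR scaleR_matrix_vector_assoc[symmetric] eig HM[symmetric])
  have trP: "trace P = 1"
    using c by (simp add: trace_def P_def c_def mform_def inner_vec_def sum_divide_distrib[symmetric])
  have trI: "trace (mat 1 :: real^'n^'n) = CARD('n)" by (simp add: trace_def mat_def)
  define t where "t = trace M - \<nu>"
  define m where "m = real CARD('n) - 1"
  have m: "m > 0" using n by (simp add: m_def)
  define \<mu> where "\<mu> = t / m"
  \<comment> \<open>\<open>S\<close> annihilates \<open>e\<close> and has trace 0, so it is the
    trace-free part of \<open>M\<close> on the complement of \<open>e\<close>.\<close>
  define S where "S = M - \<mu> *\<^sub>R mat 1 - (\<nu> - \<mu>) *\<^sub>R P"
  have HP: "transpose (H ** P) = H ** P"
  proof -
    have "(H ** P) $ i $ j = (H *v e) $ i * (H *v e) $ j / c" for i j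
    proof -
      have "(H ** P) $ i $ j = (\<Sum>k\<in>UNIV. H $ i $ k * e $ k) * (H *v e) $ j / c"
        by (simp add: matrix_matrix_mult_def P_def sum_distrib_left sum_distrib_right sum_divide_distrib mult_ac)
      then show ?thesis by (simp add: matrix_vector_mult_def)
    qed
    then show ?thesis by (simp add: vec_eq_iff transpose_def mult.commute)
  qed
  have "transpose (H ** S) = H ** S"
    unfolding S_def using adj HP sym
    by (simp add: matrix_mult_diff transpose_def vec_eq_iff matrix_mult_scaleR)
  then have "trace (S ** S) \<ge> 0" using trace_square_nonneg[of H S] sym pos by blast
  moreover have "S ** S = M ** M - (2 * \<mu>) *\<^sub>R M + \<mu>\<^sup>2 *\<^sub>R mat 1 - (\<nu> - \<mu>)\<^sup>2 *\<^sub>R P"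
  proof -
    have "S ** S = M ** M - \<mu> *\<^sub>R M - (\<nu> - \<mu>) *\<^sub>R (\<nu> *\<^sub>R P) - \<mu> *\<^sub>R (M - \<mu> *\<^sub>R mat 1 - (\<nu> - \<mu>) *\<^sub>R P)
       - (\<nu> - \<mu>) *\<^sub>R (\<nu> *\<^sub>R P - \<mu> *\<^sub>R P - (\<nu> - \<mu>) *\<^sub>R P)"
      unfolding S_def
      by (simp add: matrix_mult_diff matrix_mult_scaleR PP MP PM)
    then show ?thesis by (simp add: vec_eq_iff) (simp add: algebra_simps power2_eq_square)
  qed
  ultimately have "0 \<le> trace (M ** M) - 2 * \<mu> * trace M + \<mu>\<^sup>2 * CARD('n) - (\<nu> - \<mu>)\<^sup>2"
    by (simp add: trace_sub trace_add trace_scaleR trP trI)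
  also have "\<dots> = (trace (M ** M) - \<nu>\<^sup>2) - 2 * \<mu> * t + m * \<mu>\<^sup>2"
    by (simp add: t_def m_def algebra_simps power2_eq_square)
  also have "\<dots> = (trace (M ** M) - \<nu>\<^sup>2) - t\<^sup>2 / m"
    using m by (simp add: \<mu>_def field_simps power2_eq_square)
  finally show ?thesis by (simp add: t_def m_def)
qed

section \<open>Smooth functions and their second derivatives\<close>

abbreviation D where "D f x \<equiv> frechet_derivative f (at x)"

lemma D_works: "f differentiable (at x) \<Longrightarrow> (f has_derivative D f x) (at x)"
  using frechet_derivative_works by blast

lemma D_eqI: "(f has_derivative f') (at x) \<Longrightarrow> D f x = f'"
  using frechet_derivative_at by metis

lemma D_cong:
  assumes "open S" "x \<in> S" "\<And>y. y \<in> S \<Longrightarrow> f y = g y" "f differentiable (at x)"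
  shows "D f x = D g x"
  using has_derivative_transform_within_open[OF D_works[OF assms(4)] assms(1-3)] D_eqI by metis

lemma differentiable_cong_open:
  assumes "open S" "x \<in> S" "\<And>y. y \<in> S \<Longrightarrow> f y = g y" "f differentiable (at x)"
  shows "g differentiable (at x)"
  using has_derivative_transform_within_open[OF D_works[OF assms(4)] assms(1-3)] differentiable_def by blast

text \<open>Openness carries the induction: functions equal on an open set have equal derivatives
  there.\<close>

lemma k_smooth_on_cong:
  assumes "open S" "k_smooth_on k S f" "\<And>x. x \<in> S \<Longrightarrow> f x = g x"
  shows "k_smooth_on k S g"
  using assms(2,3)
proof (induction k arbitrary: f g)
  case 0
  then show ?case by (simp cong: continuous_on_cong)
next
  case (Suc k)
  have d: "f differentiable (at x)" if "x \<in> S" for x using Suc.prems that by simp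
  have "k_smooth_on k S (\<lambda>x. D g x v)" for v
    by (rule Suc.IH[of "\<lambda>x. D f x v"])
      (use Suc.prems in \<open>simp, metis D_cong[OF assms(1) _ Suc.prems(2) d]\<close>)
  moreover have "g differentiable (at x)" if "x \<in> S" for x
    by (rule differentiable_cong_open[OF assms(1) that Suc.prems(2) d[OF that]])
  ultimately show ?case by simp
qed

lemma k_smooth_on_Suc_imp: "k_smooth_on (Suc k) S f \<Longrightarrow> k_smooth_on k S f"
proof (induction k arbitrary: f)
  case 0
  then show ?case
    by (auto intro!: continuous_at_imp_continuous_on differentiable_imp_continuous_within)
next
  case (Suc k)
  then show ?case by (metis k_smooth_on.simps(2))
qed

lemma k_smooth_on_const: "k_smooth_on k S (\<lambda>x. c)"
  by (induction k arbitrary: c) simp_all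

lemma k_smooth_on_add:
  assumes "open S" "k_smooth_on k S f" "k_smooth_on k S g"
  shows "k_smooth_on k S (\<lambda>x. f x + g x)"
  using assms(2,3)
proof (induction k arbitrary: f g)
  case (Suc k)
  have "k_smooth_on k S (\<lambda>x. D (\<lambda>x. f x + g x) x v)" for v
    by (rule k_smooth_on_cong[OF assms(1) Suc.IH[of "\<lambda>x. D f x v" "\<lambda>x. D g x v"]])
      (use Suc.prems in \<open>auto intro!: D_eqI[THEN fun_cong, symmetric] has_derivative_add D_works\<close>)
  with Suc.prems show ?case by auto
qed (auto intro: continuous_intros)

lemma (in bounded_linear) k_smooth_on:
  assumes "open S" "k_smooth_on k S g"
  shows "k_smooth_on k S (\<lambda>x. f (g x))"
  using assms(2)
proof (induction k arbitrary: g)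
  case 0
  then show ?case by (auto intro: continuous_on)
next
  case (Suc k)
  have d: "((\<lambda>x. f (g x)) has_derivative (\<lambda>h. f (D g x h))) (at x)" if "x \<in> S" for x
    by (rule has_derivative, rule D_works) (use Suc.prems that in auto)
  have "k_smooth_on k S (\<lambda>x. D (\<lambda>x. f (g x)) x v)" for v
    by (rule k_smooth_on_cong[OF assms(1) Suc.IH[of "\<lambda>x. D g x v"]])
      (use Suc.prems D_eqI[OF d] in auto)
  with d show ?case by (auto simp: differentiable_def)
qed

text \<open>By the product rule each term of the derivative pairs one differentiated factor with one
  untouched factor; the latter is lowered by one order so that the induction hypothesis
  applies.\<close>

lemma (in bounded_bilinear) k_smooth_on:
  assumes "open S" "k_smooth_on k S f" "k_smooth_on k S g"
  shows "k_smooth_on k S (\<lambda>x. prod (f x) (g x))"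
  using assms(2,3)
proof (induction k arbitrary: f g)
  case 0
  then show ?case by (auto intro: continuous_on)
next
  case (Suc k)
  have d: "((\<lambda>x. prod (f x) (g x)) has_derivative (\<lambda>h. prod (f x) (D g x h) + prod (D f x h) (g x))) (at x)" if "x \<in> S" for x
    by (rule FDERIV; rule D_works) (use Suc.prems that in auto)
  have "k_smooth_on k S (\<lambda>x. D (\<lambda>x. prod (f x) (g x)) x v)" for v
    by (rule k_smooth_on_cong[OF assms(1) k_smooth_on_add[OF assms(1) Suc.IH[of f "\<lambda>x. D g x v"] Suc.IH[of "\<lambda>x. D f x v" g]]])
      (use Suc.prems k_smooth_on_Suc_imp D_eqI[OF d] in auto)
  with d show ?case by (auto simp: differentiable_def)
qed

text \<open>The derivative of 1/f is a product of 1/f, f' and 1/f, so the induction feeds on the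
  inverse itself at the previous order.\<close>

lemma k_smooth_on_inverse:
  fixes f :: "'a::euclidean_space \<Rightarrow> real"
  assumes "open S" "k_smooth_on k S f" "\<And>x. x \<in> S \<Longrightarrow> f x \<noteq> 0"
  shows "k_smooth_on k S (\<lambda>x. inverse (f x))"
  using assms(2)
proof (induction k)
  case 0
  then show ?case using assms(3) by (auto intro!: continuous_intros)
next
  case (Suc k)
  note mult = bounded_bilinear.k_smooth_on[OF bounded_bilinear_mult assms(1)]
  have d: "((\<lambda>x. inverse (f x)) has_derivative (\<lambda>h. (- 1) * (inverse (f x) * D f x h * inverse (f x)))) (at x)" if "x \<in> S" for x
    using Deriv.has_derivative_inverse[where f = f, OF assms(3)[OF that] D_works] Suc.prems that by simp
  have "k_smooth_on k S (\<lambda>x. D (\<lambda>x. inverse (f x)) x v)" for v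
    by (rule k_smooth_on_cong[OF assms(1) mult[OF k_smooth_on_const[of _ _ "-1"] mult[OF mult[OF Suc.IH, of "\<lambda>x. D f x v"] Suc.IH]]])
      (use Suc.prems k_smooth_on_Suc_imp D_eqI[OF d] in auto)
  with d show ?case by (auto simp: differentiable_def)
qed

lemma smooth_on_cong: "open S \<Longrightarrow> smooth_on S f \<Longrightarrow> (\<And>x. x \<in> S \<Longrightarrow> f x = g x) \<Longrightarrow> smooth_on S g"
  unfolding smooth_on_def using k_smooth_on_cong by metis

lemma smooth_on_const: "smooth_on S (\<lambda>x. c)"
  by (simp add: smooth_on_def k_smooth_on_const)

lemma smooth_on_add: "open S \<Longrightarrow> smooth_on S f \<Longrightarrow> smooth_on S g \<Longrightarrow> smooth_on S (\<lambda>x. f x + g x)"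
  by (simp add: smooth_on_def k_smooth_on_add)

lemma (in bounded_linear) smooth_on: "open S \<Longrightarrow> smooth_on S g \<Longrightarrow> smooth_on S (\<lambda>x. f (g x))"
  by (simp add: smooth_on_def k_smooth_on)

lemma (in bounded_bilinear) smooth_on:
  "open S \<Longrightarrow> smooth_on S f \<Longrightarrow> smooth_on S g \<Longrightarrow> smooth_on S (\<lambda>x. prod (f x) (g x))"
  by (simp add: smooth_on_def k_smooth_on)

lemmas smooth_on_mult = bounded_bilinear.smooth_on[OF bounded_bilinear_mult]
lemmas smooth_on_scaleR = bounded_bilinear.smooth_on[OF bounded_bilinear_scaleR]
lemmas smooth_on_nth = bounded_linear.smooth_on[OF bounded_linear_vec_nth]

lemma smooth_on_diff:
  fixes f g :: "'a::euclidean_space \<Rightarrow> 'b::real_normed_vector"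
  assumes "open S" "smooth_on S f" "smooth_on S g"
  shows "smooth_on S (\<lambda>x. f x - g x)"
  using smooth_on_add[OF assms(1,2) bounded_linear.smooth_on[OF bounded_linear_minus[OF bounded_linear_ident] assms(1,3)]] by simp

lemma smooth_on_inverse:
  fixes f :: "'a::euclidean_space \<Rightarrow> real"
  shows "open S \<Longrightarrow> smooth_on S f \<Longrightarrow> (\<And>x. x \<in> S \<Longrightarrow> f x \<noteq> 0) \<Longrightarrow> smooth_on S (\<lambda>x. inverse (f x))"
  by (simp add: smooth_on_def k_smooth_on_inverse)

lemma smooth_on_sum:
  "open S \<Longrightarrow> (\<And>i. i \<in> I \<Longrightarrow> smooth_on S (f i)) \<Longrightarrow> smooth_on S (\<lambda>x. \<Sum>i\<in>I. f i x)"
  by (induction I rule: infinite_finite_induct) (auto intro: smooth_on_const smooth_on_add)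

lemma smooth_on_prod:
  fixes f :: "'i \<Rightarrow> 'a::euclidean_space \<Rightarrow> real"
  shows "open S \<Longrightarrow> (\<And>i. i \<in> I \<Longrightarrow> smooth_on S (f i)) \<Longrightarrow> smooth_on S (\<lambda>x. \<Prod>i\<in>I. f i x)"
  by (induction I rule: infinite_finite_induct) (auto intro: smooth_on_const smooth_on_mult)

lemma smooth_on_vec:
  fixes f :: "'n::finite \<Rightarrow> 'a::euclidean_space \<Rightarrow> real"
  assumes "open S" "\<And>i. smooth_on S (f i)"
  shows "smooth_on S (\<lambda>x. \<chi> i. f i x)"
proof -
  have "(\<chi> i. f i x) = (\<Sum>i\<in>UNIV. f i x *\<^sub>R axis i 1)" for x
    by (simp add: vec_eq_iff axis_def if_distrib cong: if_cong)
  then show ?thesis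
    using assms by (auto intro!: smooth_on_sum smooth_on_scaleR smooth_on_const)
qed

lemma smooth_on_D: "smooth_on S f \<Longrightarrow> smooth_on S (\<lambda>x. D f x v)"
  unfolding smooth_on_def by (metis k_smooth_on.simps(2))

lemma smooth_on_differentiable: "smooth_on S f \<Longrightarrow> x \<in> S \<Longrightarrow> f differentiable (at x)"
  unfolding smooth_on_def by (metis k_smooth_on.simps(2))

lemma smooth_on_continuous: "smooth_on S f \<Longrightarrow> continuous_on S f"
  unfolding smooth_on_def by (metis k_smooth_on.simps(1))

section \<open>Symmetry of second derivatives\<close>

lemma second_derivative_symmetric_real:
  fixes f :: "'a::euclidean_space \<Rightarrow> real"
  assumes S: "open S" "x \<in> S" and f: "smooth_on S f"
  shows "D (\<lambda>y. D f y v) x u = D (\<lambda>y. D f y u) x v"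
proof -
  text \<open>The mixed difference quotient is symmetric in \<open>u\<close> and \<open>v\<close>, and by the mean value theorem (twice)
    it is a value of either mixed derivative near \<open>x\<close>.\<close>
  have mean: "\<exists>y. dist y x \<le> h * (norm u + norm v) \<and>
      f (x + h *\<^sub>R u + h *\<^sub>R v) - f (x + h *\<^sub>R u) - f (x + h *\<^sub>R v) + f x = h * h * D (\<lambda>y. D f y u) y v"
    if h: "h > 0" "cball x (h * (norm u + norm v)) \<subseteq> S" for h u v
  proof -
    have inS: "x + s *\<^sub>R u + t *\<^sub>R v \<in> S" "dist (x + s *\<^sub>R u + t *\<^sub>R v) x \<le> h * (norm u + norm v)"
      if "0 \<le> s" "s \<le> h" "0 \<le> t" "t \<le> h" for s t
    proof -
      have "norm (s *\<^sub>R u + t *\<^sub>R v) \<le> s * norm u + t * norm v"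
        using that norm_triangle_ineq[of "s *\<^sub>R u" "t *\<^sub>R v"] by simp
      also have "\<dots> \<le> h * (norm u + norm v)"
        using that by (auto simp: distrib_left intro!: add_mono mult_right_mono)
      finally show "dist (x + s *\<^sub>R u + t *\<^sub>R v) x \<le> h * (norm u + norm v)" by (simp add: dist_norm add.assoc)
      then show "x + s *\<^sub>R u + t *\<^sub>R v \<in> S" using h(2) by (auto simp: dist_commute)
    qed
    define \<phi> where "\<phi> s = f (x + s *\<^sub>R u + h *\<^sub>R v) - f (x + s *\<^sub>R u)" for s
    have "\<exists>s>0. s < h \<and> \<phi> h - \<phi> 0 = (h - 0) * (D f (x + s *\<^sub>R u + h *\<^sub>R v) u - D f (x + s *\<^sub>R u) u)"
    proof (rule MVT2[OF h(1)])
      fix s assume s: "0 \<le> s" "s \<le> h"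
      have "((\<lambda>s. f (x + s *\<^sub>R u + c)) has_derivative (\<lambda>k. D f (x + s *\<^sub>R u + c) (k *\<^sub>R u))) (at s)"
        if "x + s *\<^sub>R u + c \<in> S" for c
        by (rule has_derivative_compose[of "\<lambda>s. x + s *\<^sub>R u + c", OF _ D_works[OF smooth_on_differentiable[OF f that]]])
           (auto intro!: derivative_eq_intros)
      moreover have "D f (x + s *\<^sub>R u + c) (k *\<^sub>R u) = D f (x + s *\<^sub>R u + c) u * k"
        if "x + s *\<^sub>R u + c \<in> S" for c k
        using linear_scale[OF linear_frechet_derivative[OF smooth_on_differentiable[OF f that]]] by simp
      ultimately have *: "((\<lambda>s. f (x + s *\<^sub>R u + c)) has_real_derivative D f (x + s *\<^sub>R u + c) u) (at s)"
        if "x + s *\<^sub>R u + c \<in> S" for c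
        using that by (simp add: has_field_derivative_def)
      show "(\<phi> has_real_derivative D f (x + s *\<^sub>R u + h *\<^sub>R v) u - D f (x + s *\<^sub>R u) u) (at s)"
        unfolding \<phi>_def using *[of "h *\<^sub>R v"] *[of 0] inS[of s h] inS[of s 0] s h(1)
        by (auto intro!: derivative_intros)
    qed
    then obtain s where s: "0 < s" "s < h"
      "\<phi> h - \<phi> 0 = h * (D f (x + s *\<^sub>R u + h *\<^sub>R v) u - D f (x + s *\<^sub>R u) u)" by auto
    note f' = smooth_on_D[OF f, of u]
    have "\<exists>t>0. t < h \<and> D f (x + s *\<^sub>R u + h *\<^sub>R v) u - D f (x + s *\<^sub>R u + 0 *\<^sub>R v) u =
       (h - 0) * D (\<lambda>y. D f y u) (x + s *\<^sub>R u + t *\<^sub>R v) v"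
    proof (rule MVT2[OF h(1)])
      fix t assume t: "0 \<le> t" "t \<le> h"
      have xin: "x + s *\<^sub>R u + t *\<^sub>R v \<in> S" using inS t s by simp
      have "((\<lambda>t. D f (x + s *\<^sub>R u + t *\<^sub>R v) u) has_derivative
         (\<lambda>k. D (\<lambda>y. D f y u) (x + s *\<^sub>R u + t *\<^sub>R v) (k *\<^sub>R v))) (at t)"
        by (rule has_derivative_compose[of "\<lambda>t. x + s *\<^sub>R u + t *\<^sub>R v", OF _ D_works[OF smooth_on_differentiable[OF f' xin]]])
           (auto intro!: derivative_eq_intros)
      moreover have "D (\<lambda>y. D f y u) (x + s *\<^sub>R u + t *\<^sub>R v) (k *\<^sub>R v) = D (\<lambda>y. D f y u) (x + s *\<^sub>R u + t *\<^sub>R v) v * k" for k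
        using linear_scale[OF linear_frechet_derivative[OF smooth_on_differentiable[OF f' xin]]] by simp
      ultimately show "((\<lambda>t. D f (x + s *\<^sub>R u + t *\<^sub>R v) u) has_real_derivative
         D (\<lambda>y. D f y u) (x + s *\<^sub>R u + t *\<^sub>R v) v) (at t)"
        by (simp add: has_field_derivative_def)
    qed
    then obtain t where t: "0 < t" "t < h" "D f (x + s *\<^sub>R u + h *\<^sub>R v) u - D f (x + s *\<^sub>R u) u =
       h * D (\<lambda>y. D f y u) (x + s *\<^sub>R u + t *\<^sub>R v) v" by auto
    have "f (x + h *\<^sub>R u + h *\<^sub>R v) - f (x + h *\<^sub>R u) - f (x + h *\<^sub>R v) + f x = \<phi> h - \<phi> 0"
      by (simp add: \<phi>_def)
    also have "\<dots> = h * h * D (\<lambda>y. D f y u) (x + s *\<^sub>R u + t *\<^sub>R v) v" using s t by simp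
    finally show ?thesis
      using inS(2)[of s t] s t h(1) by (intro exI[of _ "x + s *\<^sub>R u + t *\<^sub>R v"]) auto
  qed
  have cont: "continuous (at x) (\<lambda>y. D (\<lambda>y. D f y u) y v)" for u v
    using smooth_on_continuous[OF smooth_on_D[OF smooth_on_D[OF f]]] S by (metis continuous_on_eq_continuous_at)
  have "\<bar>D (\<lambda>y. D f y v) x u - D (\<lambda>y. D f y u) x v\<bar> \<le> \<epsilon>" if \<epsilon>: "\<epsilon> > 0" for \<epsilon>
  proof -
    obtain d1 where d1: "d1 > 0" "\<And>y. dist y x < d1 \<Longrightarrow> dist (D (\<lambda>y. D f y v) y u) (D (\<lambda>y. D f y v) x u) < \<epsilon>/2"
      using cont[of v u] \<epsilon> unfolding continuous_at_eps_delta by (metis half_gt_zero)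
    obtain d2 where d2: "d2 > 0" "\<And>y. dist y x < d2 \<Longrightarrow> dist (D (\<lambda>y. D f y u) y v) (D (\<lambda>y. D f y u) x v) < \<epsilon>/2"
      using cont[of u v] \<epsilon> unfolding continuous_at_eps_delta by (metis half_gt_zero)
    obtain d3 where d3: "d3 > 0" "cball x d3 \<subseteq> S" using S open_contains_cball by blast
    define \<delta> where "\<delta> = Min {d1/2, d2/2, d3}"
    have \<delta>: "\<delta> > 0" "\<delta> < d1" "\<delta> < d2" "\<delta> \<le> d3" using d1(1) d2(1) d3(1) by (auto simp: \<delta>_def min_def)
    \<comment> \<open>The summand 1 keeps the denominator positive when both directions are
      0.\<close>
    define h where "h = \<delta> / (norm u + norm v + 1)"
    have h: "h > 0" "h * (norm u + norm v) \<le> \<delta>"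
      using \<delta>(1) by (auto simp: h_def divide_simps add_nonneg_pos mult_left_mono)
    have sub: "cball x (h * (norm u + norm v)) \<subseteq> S" using d3 h(2) \<delta>(4) by (auto simp: subset_iff)
    obtain y where y: "dist y x \<le> h * (norm u + norm v)"
      "f (x + h *\<^sub>R u + h *\<^sub>R v) - f (x + h *\<^sub>R u) - f (x + h *\<^sub>R v) + f x = h * h * D (\<lambda>y. D f y u) y v"
      using mean[OF h(1) sub] by blast
    obtain z where z: "dist z x \<le> h * (norm u + norm v)"
      "f (x + h *\<^sub>R v + h *\<^sub>R u) - f (x + h *\<^sub>R v) - f (x + h *\<^sub>R u) + f x = h * h * D (\<lambda>y. D f y v) z u"
      using mean[OF h(1), of v u] sub by (auto simp: add.commute)
    have "h * h * D (\<lambda>y. D f y u) y v = h * h * D (\<lambda>y. D f y v) z u"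
      using y(2) z(2) by (simp add: algebra_simps)
    then have "D (\<lambda>y. D f y u) y v = D (\<lambda>y. D f y v) z u" using h(1) by simp
    then show ?thesis
      using d1(2)[of z] d2(2)[of y] y(1) z(1) h(2) \<delta> unfolding dist_real_def by linarith
  qed
  then have "\<bar>D (\<lambda>y. D f y v) x u - D (\<lambda>y. D f y u) x v\<bar> \<le> 0"
    by (rule dense_ge)
  then show ?thesis by simp
qed

lemma second_derivative_symmetric:
  fixes f :: "'a::euclidean_space \<Rightarrow> real^'n"
  assumes S: "open S" "x \<in> S" and f: "smooth_on S f"
  shows "D (\<lambda>y. D f y v) x u = D (\<lambda>y. D f y u) x v"
proof -
  have nth: "D (\<lambda>y. g y $ i) y w = D g y w $ i" if "g differentiable (at y)" for g :: "'a \<Rightarrow> real^'n" and i y w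
    using D_eqI[OF bounded_linear.has_derivative[OF bounded_linear_vec_nth D_works[OF that]]] by metis
  have "D (\<lambda>y. D f y v) x u $ i = D (\<lambda>y. D (\<lambda>z. f z $ i) y v) x u" for u v i
  proof -
    note f' = smooth_on_differentiable[OF smooth_on_D[OF f] S(2), of v]
    have "D (\<lambda>y. D f y v) x u $ i = D (\<lambda>y. D f y v $ i) x u" using nth[OF f'] by simp
    also have "D (\<lambda>y. D f y v $ i) x = D (\<lambda>y. D (\<lambda>z. f z $ i) y v) x"
    proof (rule D_cong[OF S])
      show "D f y v $ i = D (\<lambda>z. f z $ i) y v" if "y \<in> S" for y
        using nth[OF smooth_on_differentiable[OF f that]] by simp
      show "(\<lambda>y. D f y v $ i) differentiable (at x)"
        using bounded_linear.has_derivative[OF bounded_linear_vec_nth D_works[OF f']]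
        unfolding differentiable_def by blast
    qed
    finally show ?thesis .
  qed
  then show ?thesis
    using second_derivative_symmetric_real[OF S smooth_on_nth[OF S(1) f]] by (simp add: vec_eq_iff)
qed

text \<open>Differentiates \<open>B (z s) (f s) (h s)\<close> where \<open>B y\<close> is only known to be bilinear and differentiable
  in \<open>y\<close> for fixed arguments.\<close>

lemma has_derivative_bilinear_field:
  fixes B :: "'x::euclidean_space \<Rightarrow> 'u::euclidean_space \<Rightarrow> 'v::euclidean_space \<Rightarrow> 'w::real_normed_vector"
  assumes X: "open X" "z a \<in> X" and bil: "\<And>y. y \<in> X \<Longrightarrow> bilinear (B y)"
    and diff: "\<And>u v. (\<lambda>y. B y u v) differentiable (at (z a))"
    and z: "(z has_derivative z') (at a within S)"
    and f: "(f has_derivative f') (at a within S)"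
    and h: "(h has_derivative h') (at a within S)"
    and a: "a \<in> S"
  shows "((\<lambda>s. B (z s) (f s) (h s)) has_derivative
    (\<lambda>k. D (\<lambda>y. B y (f a) (h a)) (z a) (z' k) + B (z a) (f' k) (h a) + B (z a) (f a) (h' k))) (at a within S)"
proof -
  \<comment> \<open>Over pairs of basis vectors the base point, \<open>u\<close> and
    \<open>v\<close> separate into scalar factors, so knowledge for fixed arguments
    suffices.\<close>
  have expand: "B y u v = (\<Sum>(i,j)\<in>Basis \<times> Basis. ((u \<bullet> i) * (v \<bullet> j)) *\<^sub>R B y i j)" if "y \<in> X" for y u v
  proof -
    have "B y (\<Sum>i\<in>Basis. (u \<bullet> i) *\<^sub>R i) (\<Sum>j\<in>Basis. (v \<bullet> j) *\<^sub>R j) =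
      (\<Sum>(i,j)\<in>Basis \<times> Basis. B y ((u \<bullet> i) *\<^sub>R i) ((v \<bullet> j) *\<^sub>R j))"
      by (rule bilinear_sum[OF bil[OF that]])
    then show ?thesis
      by (simp add: euclidean_representation mult.commute bilinear_lmul[OF bil[OF that]] bilinear_rmul[OF bil[OF that]])
  qed
  have Dz: "((\<lambda>y. B y u v) has_derivative D (\<lambda>y. B y u v) (z a)) (at (z a))" for u v
    by (rule D_works[OF diff])
  have c: "((\<lambda>s. \<Sum>(i,j)\<in>Basis \<times> Basis. ((f s \<bullet> i) * (h s \<bullet> j)) *\<^sub>R B (z s) i j) has_derivative
     (\<lambda>k. \<Sum>(i,j)\<in>Basis \<times> Basis. ((f a \<bullet> i) * (h a \<bullet> j)) *\<^sub>R D (\<lambda>y. B y i j) (z a) (z' k) +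
        ((f a \<bullet> i) * (h' k \<bullet> j) + (f' k \<bullet> i) * (h a \<bullet> j)) *\<^sub>R B (z a) i j)) (at a within S)"
    unfolding split_def
    by (intro has_derivative_sum has_derivative_scaleR has_derivative_mult
       has_derivative_inner_left f h has_derivative_compose[OF z] Dz)
  \<comment> \<open>The expansion needs bilinearity, known only on \<open>X\<close>; near
    \<open>a\<close> the curve stays there.\<close>
  have ev: "\<forall>\<^sub>F s in at a within S. z s \<in> X"
    using topological_tendstoD[OF has_derivative_continuous[OF z, unfolded continuous_within] X] .
  have d: "D (\<lambda>y. B y u v) (z a) w = (\<Sum>(i,j)\<in>Basis \<times> Basis. ((u \<bullet> i) * (v \<bullet> j)) *\<^sub>R D (\<lambda>y. B y i j) (z a) w)" for u v w
  proof -
    have "((\<lambda>y. \<Sum>(i,j)\<in>Basis \<times> Basis. ((u \<bullet> i) * (v \<bullet> j)) *\<^sub>R B y i j) has_derivative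
       (\<lambda>w. \<Sum>(i,j)\<in>Basis \<times> Basis. ((u \<bullet> i) * (v \<bullet> j)) *\<^sub>R D (\<lambda>y. B y i j) (z a) w)) (at (z a))"
      unfolding split_def by (intro has_derivative_sum has_derivative_scaleR_right Dz)
    from has_derivative_transform_within_open[OF this X expand[symmetric]] show ?thesis
      by (simp add: D_eqI)
  qed
  have eq: "(\<lambda>k. \<Sum>(i,j)\<in>Basis \<times> Basis. ((f a \<bullet> i) * (h a \<bullet> j)) *\<^sub>R D (\<lambda>y. B y i j) (z a) (z' k) +
        ((f a \<bullet> i) * (h' k \<bullet> j) + (f' k \<bullet> i) * (h a \<bullet> j)) *\<^sub>R B (z a) i j)
     = (\<lambda>k. D (\<lambda>y. B y (f a) (h a)) (z a) (z' k) + B (z a) (f' k) (h a) + B (z a) (f a) (h' k))"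
  proof
    fix k
    have "D (\<lambda>y. B y (f a) (h a)) (z a) (z' k) + B (z a) (f' k) (h a) + B (z a) (f a) (h' k) =
       (\<Sum>p\<in>Basis \<times> Basis. ((f a \<bullet> fst p) * (h a \<bullet> snd p)) *\<^sub>R D (\<lambda>y. B y (fst p) (snd p)) (z a) (z' k)
         + ((f' k \<bullet> fst p) * (h a \<bullet> snd p)) *\<^sub>R B (z a) (fst p) (snd p)
         + ((f a \<bullet> fst p) * (h' k \<bullet> snd p)) *\<^sub>R B (z a) (fst p) (snd p))"
      by (subst d, subst expand[OF X(2), of "f' k" "h a"], subst expand[OF X(2), of "f a" "h' k"])
        (simp only: sum.distrib split_def)
    also have "\<dots> = (\<Sum>(i,j)\<in>Basis \<times> Basis. ((f a \<bullet> i) * (h a \<bullet> j)) *\<^sub>R D (\<lambda>y. B y i j) (z a) (z' k) +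
        ((f a \<bullet> i) * (h' k \<bullet> j) + (f' k \<bullet> i) * (h a \<bullet> j)) *\<^sub>R B (z a) i j)"
      by (intro sum.cong refl) (simp add: split_def scaleR_add_left)
    finally show "(\<Sum>(i,j)\<in>Basis \<times> Basis. ((f a \<bullet> i) * (h a \<bullet> j)) *\<^sub>R D (\<lambda>y. B y i j) (z a) (z' k) +
        ((f a \<bullet> i) * (h' k \<bullet> j) + (f' k \<bullet> i) * (h a \<bullet> j)) *\<^sub>R B (z a) i j)
     = D (\<lambda>y. B y (f a) (h a)) (z a) (z' k) + B (z a) (f' k) (h a) + B (z a) (f a) (h' k)" by (rule sym)
  qed
  show ?thesis
  proof (rule has_derivative_transform_eventually[OF c[unfolded eq] _ _ a])
    show "\<forall>\<^sub>F s in at a within S. (\<Sum>(i,j)\<in>Basis \<times> Basis. ((f s \<bullet> i) * (h s \<bullet> j)) *\<^sub>R B (z s) i j) = B (z s) (f s) (h s)"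
      using ev by eventually_elim (rule expand[symmetric])
  qed (rule expand[OF X(2), symmetric])
qed

text \<open>The bilinear case for scalar times \<open>L\<close>, with the scalar held at 1.\<close>

lemma has_derivative_linear_field:
  fixes L :: "'x::euclidean_space \<Rightarrow> 'v::euclidean_space \<Rightarrow> 'w::real_normed_vector"
  assumes X: "open X" "z a \<in> X" and lin: "\<And>y. y \<in> X \<Longrightarrow> linear (L y)"
    and diff: "\<And>v. (\<lambda>y. L y v) differentiable (at (z a))"
    and z: "(z has_derivative z') (at a within S)"
    and h: "(h has_derivative h') (at a within S)"
    and a: "a \<in> S"
  shows "((\<lambda>s. L (z s) (h s)) has_derivative
    (\<lambda>k. D (\<lambda>y. L y (h a)) (z a) (z' k) + L (z a) (h' k))) (at a within S)"
proof -
  have bil: "bilinear (\<lambda>(r::real) v. r *\<^sub>R L y v)" if "y \<in> X" for y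
    unfolding bilinear_def
    by (intro conjI allI linearI)
      (simp_all add: linear_add[OF lin[OF that]] linear_scale[OF lin[OF that]] scaleR_add_left scaleR_add_right)
  have diff': "(\<lambda>y. r *\<^sub>R L y v) differentiable (at (z a))" for r and v
    using bounded_linear.has_derivative[OF bounded_linear_scaleR_right D_works[OF diff]]
    unfolding differentiable_def by blast
  have "((\<lambda>s. 1 *\<^sub>R L (z s) (h s)) has_derivative
    (\<lambda>k. D (\<lambda>y. 1 *\<^sub>R L y (h a)) (z a) (z' k) + 0 *\<^sub>R L (z a) (h a) + 1 *\<^sub>R L (z a) (h' k))) (at a within S)"
    by (rule has_derivative_bilinear_field[where B = "\<lambda>y (r::real) v. r *\<^sub>R L y v" and f = "\<lambda>_. 1" and f' = "\<lambda>_. 0" and X = X and z = z])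
      (use X z h a bil diff' in auto)
  then show ?thesis by simp
qed

section \<open>Inverse matrices depending on a parameter\<close>

lemma det_ne_0_matrix_inv:
  fixes A :: "real^'n^'n"
  assumes "det A \<noteq> 0"
  shows "A ** matrix_inv A = mat 1" "matrix_inv A ** A = mat 1"
proof -
  obtain B where "A ** B = mat 1 \<and> B ** A = mat 1"
    using assms invertible_det_nz[of A] unfolding invertible_def by blast
  then have "A ** matrix_inv A = mat 1 \<and> matrix_inv A ** A = mat 1"
    unfolding matrix_inv_def by (rule someI)
  then show "A ** matrix_inv A = mat 1" "matrix_inv A ** A = mat 1" by simp_all
qed

text \<open>Entries of the inverse become quotients of polynomials in the entries of
  \<open>A\<close>, which reduces their smoothness and differentiability to sums, products and
  quotients.\<close>

lemma matrix_inv_cramer: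
  fixes A :: "real^'n^'n"
  assumes "det A \<noteq> 0"
  shows "matrix_inv A $ k $ l = det (\<chi> i j. if j = k then axis l 1 $ i else A $ i $ j) / det A"
proof -
  have "A *v (matrix_inv A *v axis l 1) = axis l 1"
    by (simp add: matrix_vector_mul_assoc det_ne_0_matrix_inv[OF assms])
  then have "matrix_inv A *v axis l 1 = (\<chi> k. det (\<chi> i j. if j = k then axis l 1 $ i else A $ i $ j) / det A)"
    by (rule cramer[OF assms, THEN iffD1])
  then have "(matrix_inv A *v axis l 1) $ k = det (\<chi> i j. if j = k then axis l 1 $ i else A $ i $ j) / det A"
    by simp
  then show ?thesis by (simp add: matrix_vector_mult_basis column_def)
qed

lemma smooth_on_det:
  fixes A :: "'a::euclidean_space \<Rightarrow> real^'n^'n"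
  assumes "open S" "\<And>i j. smooth_on S (\<lambda>x. A x $ i $ j)"
  shows "smooth_on S (\<lambda>x. det (A x))"
  unfolding det_def by (intro smooth_on_sum smooth_on_mult smooth_on_prod smooth_on_const assms)

lemma smooth_on_matrix_inv:
  fixes A :: "'a::euclidean_space \<Rightarrow> real^'n^'n"
  assumes S: "open S" and A: "\<And>i j. smooth_on S (\<lambda>x. A x $ i $ j)" and nz: "\<And>x. x \<in> S \<Longrightarrow> det (A x) \<noteq> 0"
  shows "smooth_on S (\<lambda>x. matrix_inv (A x) $ k $ l)"
proof (rule smooth_on_cong[OF S])
  show "smooth_on S (\<lambda>x. det (\<chi> i j. if j = k then axis l 1 $ i else A x $ i $ j) * inverse (det (A x)))"
  proof (intro smooth_on_mult smooth_on_det smooth_on_inverse S A nz)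
    fix i j
    show "smooth_on S (\<lambda>x. (\<chi> i j. if j = k then axis l 1 $ i else A x $ i $ j) $ i $ j)"
      using A by (cases "j = k") (simp_all add: smooth_on_const)
  qed
  show "det (\<chi> i j. if j = k then axis l 1 $ i else A x $ i $ j) * inverse (det (A x)) = matrix_inv (A x) $ k $ l"
    if "x \<in> S" for x
    unfolding matrix_inv_cramer[OF nz[OF that]] divide_inverse ..
qed

lemma differentiable_det:
  fixes A :: "real \<Rightarrow> real^'n^'n"
  assumes "\<And>i j. (\<lambda>x. A x $ i $ j) differentiable (at x within S)"
  shows "(\<lambda>x. det (A x)) differentiable (at x within S)"
proof -
  have prod: "(\<lambda>x. \<Prod>i\<in>I. f i x) differentiable (at x within S)"
    if "\<And>i. (f i) differentiable (at x within S)" for I and f :: "'n \<Rightarrow> real \<Rightarrow> real"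
    using that by (induction I rule: infinite_finite_induct) (auto intro: differentiable_mult)
  then show ?thesis
    unfolding det_def by (intro differentiable_sum differentiable_mult differentiable_const prod assms ballI) auto
qed

lemma differentiable_matrix_inv:
  fixes A :: "real \<Rightarrow> real^'n^'n"
  assumes A: "\<And>i j. (\<lambda>x. A x $ i $ j) differentiable (at x within S)"
    and nz: "det (A x) \<noteq> 0" and x: "x \<in> S"
  shows "(\<lambda>x. matrix_inv (A x) $ k $ l) differentiable (at x within S)"
proof -
  have c: "(\<lambda>x. (\<chi> i j. if j = k then axis l 1 $ i else A x $ i $ j) $ i $ j) differentiable (at x within S)" for i j
    using A by (cases "j = k") simp_all
  have "(\<lambda>x. det (\<chi> i j. if j = k then axis l 1 $ i else A x $ i $ j) / det (A x)) differentiable (at x within S)"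
    by (intro differentiable_divide differentiable_det c A nz)
  then obtain d where d: "((\<lambda>x. det (\<chi> i j. if j = k then axis l 1 $ i else A x $ i $ j) / det (A x)) has_derivative d) (at x within S)"
    unfolding differentiable_def by blast
  have ev: "\<forall>\<^sub>F y in at x within S. det (A y) \<noteq> 0"
    by (rule tendsto_imp_eventually_ne[OF differentiable_imp_continuous_within[OF differentiable_det[OF A], unfolded continuous_within] nz])
  have "((\<lambda>x. matrix_inv (A x) $ k $ l) has_derivative d) (at x within S)"
  proof (rule has_derivative_transform_eventually[OF d])
    show "\<forall>\<^sub>F y in at x within S. det (\<chi> i j. if j = k then axis l 1 $ i else A y $ i $ j) / det (A y) = matrix_inv (A y) $ k $ l"
      using ev by eventually_elim (rule matrix_inv_cramer[symmetric])
  qed (use x matrix_inv_cramer[OF nz] in simp_all)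
  then show ?thesis by (auto simp: differentiable_def)
qed

section \<open>Levi-Civita connections in a coordinate patch\<close>

lemma bilinear_rules:
  assumes "bilinear h"
  shows "h (x + y) z = h x z + h y z" "h x (y + z) = h x y + h x z"
    "h (x - y) z = h x z - h y z" "h x (y - z) = h x y - h x z"
    "h (- x) z = - h x z" "h x (- z) = - h x z"
    "h (c *\<^sub>R x) z = c *\<^sub>R h x z" "h x (c *\<^sub>R z) = c *\<^sub>R h x z" "h 0 z = 0" "h x 0 = 0"
  using assms
  by (auto simp: bilinear_ladd bilinear_radd bilinear_lsub bilinear_rsub bilinear_lneg bilinear_rneg
      bilinear_lmul bilinear_rmul bilinear_lzero bilinear_rzero)

lemma D_bilinear_field:
  fixes B :: "'x::euclidean_space \<Rightarrow> 'u::euclidean_space \<Rightarrow> 'v::euclidean_space \<Rightarrow> 'w::real_normed_vector"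
  assumes X: "open X" "z x \<in> X" and bil: "\<And>y. y \<in> X \<Longrightarrow> bilinear (B y)"
    and sm: "\<And>u v. smooth_on X (\<lambda>y. B y u v)"
    and z: "z differentiable (at x)" and f: "f differentiable (at x)" and h: "h differentiable (at x)"
  shows "D (\<lambda>y. B (z y) (f y) (h y)) x k =
    D (\<lambda>y. B y (f x) (h x)) (z x) (D z x k) + B (z x) (D f x k) (h x) + B (z x) (f x) (D h x k)"
  using D_eqI[OF has_derivative_bilinear_field[where B = B and X = X and z = z, OF X bil smooth_on_differentiable[OF sm X(2)] D_works[OF z] D_works[OF f] D_works[OF h]]]
  by simp

text \<open>A coordinate patch without indices: the metric and the Christoffel symbols are fields of
  bilinear maps. The Koszul formula characterizes \<open>\<Gamma>\<close> because \<open>g\<close>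
  is nondegenerate, so no inverse matrix appears.\<close>

locale local_metric =
  fixes X :: "(real^'n) set" and g :: "real^'n \<Rightarrow> real^'n \<Rightarrow> real^'n \<Rightarrow> real"
    and \<Gamma> :: "real^'n \<Rightarrow> real^'n \<Rightarrow> real^'n \<Rightarrow> real^'n"
  assumes open_X: "open X"
    and g_bil: "x \<in> X \<Longrightarrow> bilinear (g x)"
    and g_smooth: "smooth_on X (\<lambda>y. g y u v)"
    and g_sym: "x \<in> X \<Longrightarrow> g x u v = g x v u"
    and g_pos: "x \<in> X \<Longrightarrow> u \<noteq> 0 \<Longrightarrow> g x u u > 0"
    and \<Gamma>_bil: "x \<in> X \<Longrightarrow> bilinear (\<Gamma> x)"
    and \<Gamma>_smooth: "smooth_on X (\<lambda>y. \<Gamma> y u v)"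
    and koszul: "x \<in> X \<Longrightarrow> 2 * g x (\<Gamma> x u v) w =
      D (\<lambda>y. g y v w) x u + D (\<lambda>y. g y u w) x v - D (\<lambda>y. g y u v) x w"
begin

text \<open>R(u,v)w for coordinate fields with constant components, whose Lie brackets
  vanish.\<close>

definition Rc where
  "Rc x u v w = D (\<lambda>y. \<Gamma> y v w) x u - D (\<lambda>y. \<Gamma> y u w) x v + \<Gamma> x u (\<Gamma> x v w) - \<Gamma> x v (\<Gamma> x u w)"

lemma nondegenerate:
  assumes "x \<in> X" "\<And>w. g x u w = g x v w"
  shows "u = v"
proof (rule ccontr)
  assume "u \<noteq> v"
  then have "g x (u - v) (u - v) > 0" using g_pos assms(1) by simp
  then show False using assms(2) by (simp add: bilinear_rules[OF g_bil[OF assms(1)]])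
qed

lemma g_D_sym: "x \<in> X \<Longrightarrow> D (\<lambda>y. g y u v) x = D (\<lambda>y. g y v u) x"
  by (rule D_cong[OF open_X]) (auto intro: g_sym smooth_on_differentiable[OF g_smooth])

lemma \<Gamma>_sym: "x \<in> X \<Longrightarrow> \<Gamma> x u v = \<Gamma> x v u"
  by (rule nondegenerate) (use koszul[of x u v] koszul[of x v u] g_D_sym[of x u v] in \<open>auto\<close>, smt (verit))

lemma \<Gamma>_D_sym: "x \<in> X \<Longrightarrow> D (\<lambda>y. \<Gamma> y u v) x = D (\<lambda>y. \<Gamma> y v u) x"
  by (rule D_cong[OF open_X]) (auto intro: \<Gamma>_sym smooth_on_differentiable[OF \<Gamma>_smooth])

text \<open>In the sum of the Koszul formulas for (w,u,v) and (w,v,u) the derivatives along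
  \<open>u\<close> and \<open>v\<close> cancel.\<close>

lemma compatible:
  assumes "x \<in> X"
  shows "D (\<lambda>y. g y u v) x w = g x (\<Gamma> x w u) v + g x u (\<Gamma> x w v)"
proof -
  have "g x u (\<Gamma> x w v) = g x (\<Gamma> x w v) u" using g_sym assms by blast
  then show ?thesis
    using koszul[OF assms, of w u v] koszul[OF assms, of w v u] g_D_sym[OF assms, of u v]
      g_D_sym[OF assms, of w u] g_D_sym[OF assms, of v w] by auto
qed

lemma Rc_antisym: "Rc x u v w = - Rc x v u w"
  by (simp add: Rc_def)

lemma bianchi: "x \<in> X \<Longrightarrow> Rc x u v w + Rc x v w u + Rc x w u v = 0"
  unfolding Rc_def
  using \<Gamma>_sym[of x u v] \<Gamma>_sym[of x v w] \<Gamma>_sym[of x w u]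
    \<Gamma>_D_sym[of x u v] \<Gamma>_D_sym[of x v w] \<Gamma>_D_sym[of x w u] by simp

text \<open>Differentiating g(u,v) twice with \<open>compatible\<close> gives terms symmetric in the
  two directions plus curvature terms; as second derivatives commute, the antisymmetric part is the
  claim.\<close>

lemma Rc_skew:
  assumes x: "x \<in> X"
  shows "g x (Rc x a b u) v = - g x u (Rc x a b v)"
proof -
  note dg = smooth_on_differentiable[OF g_smooth x]
  note d\<Gamma> = smooth_on_differentiable[OF \<Gamma>_smooth x]
  have second: "D (\<lambda>y. D (\<lambda>z. g z u v) y b) x a =
     g x (\<Gamma> x a (\<Gamma> x b u)) v + g x (\<Gamma> x b u) (\<Gamma> x a v) + g x (D (\<lambda>y. \<Gamma> y b u) x a) v
      + (g x (\<Gamma> x a u) (\<Gamma> x b v) + g x u (\<Gamma> x a (\<Gamma> x b v)) + g x u (D (\<lambda>y. \<Gamma> y b v) x a))" for a b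
  proof -
    have c: "D (\<lambda>y. g y (p y) (r y)) x a = g x (\<Gamma> x a (p x)) (r x) + g x (p x) (\<Gamma> x a (r x))
       + g x (D p x a) (r x) + g x (p x) (D r x a)" (is "_ = ?rhs p r")
      and c': "(\<lambda>y. g y (p y) (r y)) differentiable (at x)"
      if "p differentiable (at x)" "r differentiable (at x)" for p r
    proof -
      show "D (\<lambda>y. g y (p y) (r y)) x a = ?rhs p r"
        using D_bilinear_field[where z = "\<lambda>y. y" and B = g, OF open_X x g_bil g_smooth _ that] compatible[OF x]
        by (simp add: add.assoc)
      show "(\<lambda>y. g y (p y) (r y)) differentiable (at x)"
        using has_derivative_bilinear_field[where z = "\<lambda>y. y" and B = g, OF open_X x g_bil smooth_on_differentiable[OF g_smooth] _ D_works[OF that(1)] D_works[OF that(2)], OF _ x has_derivative_ident UNIV_I]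
        unfolding differentiable_def by blast
    qed
    have "D (\<lambda>y. D (\<lambda>z. g z u v) y b) x a = D (\<lambda>y. g y (\<Gamma> y b u) v + g y u (\<Gamma> y b v)) x a"
      by (rule D_cong[OF open_X x, THEN fun_cong])
        (auto simp: compatible intro: smooth_on_differentiable[OF smooth_on_D[OF g_smooth] x])
    also have "\<dots> = D (\<lambda>y. g y (\<Gamma> y b u) v) x a + D (\<lambda>y. g y u (\<Gamma> y b v)) x a"
      by (rule D_eqI[THEN fun_cong], rule has_derivative_add; rule D_works, rule c') (auto intro: d\<Gamma>)
    also have "\<dots> = g x (\<Gamma> x a (\<Gamma> x b u)) v + g x (\<Gamma> x b u) (\<Gamma> x a v) + g x (D (\<lambda>y. \<Gamma> y b u) x a) v
      + (g x (\<Gamma> x a u) (\<Gamma> x b v) + g x u (\<Gamma> x a (\<Gamma> x b v)) + g x u (D (\<lambda>y. \<Gamma> y b v) x a))"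
      by (subst (1 2) c) (auto intro: d\<Gamma> simp: bilinear_rules[OF g_bil[OF x]])
    finally show ?thesis .
  qed
  have "D (\<lambda>y. D (\<lambda>z. g z u v) y b) x a = D (\<lambda>y. D (\<lambda>z. g z u v) y a) x b"
    by (rule second_derivative_symmetric_real[OF open_X x g_smooth])
  then show ?thesis
    unfolding second Rc_def by (simp add: bilinear_rules[OF g_bil[OF x]])
qed

text \<open>The Jacobi operator R(.,a)a is self-adjoint. This is the pair symmetry of the curvature
  tensor, a linear consequence of both antisymmetries and the Bianchi identity.\<close>

lemma Rc_pair:
  assumes x: "x \<in> X"
  shows "g x (Rc x u a a) v = g x u (Rc x v a a)"
proof -
  define B where "B p q r s = g x (Rc x p q r) s" for p q r s
  have 1: "B p q r s = - B q p r s" for p q r s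
    unfolding B_def by (subst Rc_antisym) (simp add: bilinear_rules[OF g_bil[OF x]])
  have 2: "B p q r s = - B p q s r" for p q r s
    unfolding B_def using Rc_skew[OF x] g_sym[OF x] by metis
  have 3: "B p q r s + B q r p s + B r p q s = 0" for p q r s
    unfolding B_def using bianchi[OF x, of p q r]
    by (simp flip: bilinear_rules(1)[OF g_bil[OF x]]) (simp add: bilinear_rules[OF g_bil[OF x]])
  have "B u a a v = B v a a u"
    using 3[of u a a v] 3[of a v u a] 3[of a v a u] 3[of u v a a] 3[of v a a u] 3[of a u v a] 3[of u a v a]
      1[of u a a v] 1[of a a u v] 1[of v a a u] 1[of a v u a] 1[of v u a a] 1[of u a v a] 1[of a v a u] 1[of a a v u]
      2[of u a a v] 2[of a a u v] 2[of v a a u] 2[of a v u a] 2[of v u a a] 2[of u a v a] 2[of a v a u]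
      2[of u v a a] by linarith
  then show ?thesis unfolding B_def using g_sym[OF x] by metis
qed

end

text \<open>Models a change of charts. Surjectivity of the differential lets every test vector in
  the target be written as the image of one in the source.\<close>

locale local_isometry = dom: local_metric X g \<Gamma> + cod: local_metric X' g' \<Gamma>'
  for X :: "(real^'n) set" and g \<Gamma> and X' :: "(real^'n) set" and g' \<Gamma>' +
  fixes U :: "(real^'n) set" and \<phi> :: "real^'n \<Rightarrow> real^'n"
  assumes open_U: "open U" and U_sub: "U \<subseteq> X" and maps: "x \<in> U \<Longrightarrow> \<phi> x \<in> X'"
    and \<phi>_smooth: "smooth_on U \<phi>"
    and \<phi>_surj: "x \<in> U \<Longrightarrow> surj (D \<phi> x)"
    and isometric: "x \<in> U \<Longrightarrow> g x u v = g' (\<phi> x) (D \<phi> x u) (D \<phi> x v)"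
begin

abbreviation \<phi>2 where "\<phi>2 x u v \<equiv> D (\<lambda>y. D \<phi> y v) x u"

lemma \<phi>2_sym: "x \<in> U \<Longrightarrow> \<phi>2 x u v = \<phi>2 x v u"
  by (rule second_derivative_symmetric[OF open_U _ \<phi>_smooth])

lemma D\<phi>_linear: "x \<in> U \<Longrightarrow> linear (D \<phi> x)"
  by (rule linear_frechet_derivative[OF smooth_on_differentiable[OF \<phi>_smooth]])

text \<open>Differentiating the isometry condition expresses the Koszul terms of \<open>g\<close> by
  those of \<open>g'\<close> and second derivatives of \<open>\<phi>\<close>; symmetry of the latter
  leaves a single one, and testing with \<open>g'\<close> identifies the vector.\<close>

lemma \<Gamma>_transform:
  assumes x: "x \<in> U"
  shows "D \<phi> x (\<Gamma> x u v) = \<phi>2 x u v + \<Gamma>' (\<phi> x) (D \<phi> x u) (D \<phi> x v)"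
proof (rule cod.nondegenerate[OF maps[OF x]])
  fix w'
  obtain w where w: "w' = D \<phi> x w" using \<phi>_surj[OF x] by (metis surjD)
  have xX: "x \<in> X" and x': "\<phi> x \<in> X'" using x U_sub maps by auto
  note bil' = bilinear_rules[OF cod.g_bil[OF x']]
  have dg: "D (\<lambda>y. g y p r) x k = D (\<lambda>z. g' z (D \<phi> x p) (D \<phi> x r)) (\<phi> x) (D \<phi> x k)
     + g' (\<phi> x) (\<phi>2 x k p) (D \<phi> x r) + g' (\<phi> x) (D \<phi> x p) (\<phi>2 x k r)" for p r k
  proof -
    have "D (\<lambda>y. g y p r) x k = D (\<lambda>y. g' (\<phi> y) (D \<phi> y p) (D \<phi> y r)) x k"
      by (rule D_cong[OF open_U x, THEN fun_cong])
        (auto simp: isometric intro: smooth_on_differentiable[OF dom.g_smooth xX])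
    also have "\<dots> = D (\<lambda>z. g' z (D \<phi> x p) (D \<phi> x r)) (\<phi> x) (D \<phi> x k)
     + g' (\<phi> x) (\<phi>2 x k p) (D \<phi> x r) + g' (\<phi> x) (D \<phi> x p) (\<phi>2 x k r)"
      by (rule D_bilinear_field[where B = g' and X = X' and z = \<phi>])
        (auto intro: cod.open_X x' cod.g_bil cod.g_smooth smooth_on_differentiable[OF _ x] \<phi>_smooth smooth_on_D)
    finally show ?thesis .
  qed
  have "2 * g' (\<phi> x) (D \<phi> x (\<Gamma> x u v)) w' = 2 * g x (\<Gamma> x u v) w" by (simp add: w isometric[OF x])
  also have "\<dots> = 2 * g' (\<phi> x) (\<phi>2 x u v + \<Gamma>' (\<phi> x) (D \<phi> x u) (D \<phi> x v)) w'"
    unfolding dom.koszul[OF xX] dg w bil' distrib_left cod.koszul[OF x']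
    using \<phi>2_sym[OF x, of u v] \<phi>2_sym[OF x, of u w] \<phi>2_sym[OF x, of v w]
      cod.g_sym[OF x', of "D \<phi> x v"] cod.g_sym[OF x', of "D \<phi> x u"] by simp
  finally show "g' (\<phi> x) (D \<phi> x (\<Gamma> x u v)) w' = g' (\<phi> x) (\<phi>2 x u v + \<Gamma>' (\<phi> x) (D \<phi> x u) (D \<phi> x v)) w'"
    by simp
qed

text \<open>Although Christoffel symbols transform with a second derivative, curvature is a tensor:
  differentiating their law leaves second and third derivatives of \<open>\<phi>\<close> that cancel
  on exchanging \<open>u\<close> and \<open>v\<close>.\<close>

lemma Rc_transform:
  assumes x: "x \<in> U"
  shows "D \<phi> x (dom.Rc x u v w) = cod.Rc (\<phi> x) (D \<phi> x u) (D \<phi> x v) (D \<phi> x w)"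
proof -
  have xX: "x \<in> X" and x': "\<phi> x \<in> X'" using x U_sub maps by auto
  note bil' = bilinear_rules[OF cod.\<Gamma>_bil[OF x']]
  note d\<Gamma> = smooth_on_differentiable[OF dom.\<Gamma>_smooth xX]
  let ?P = "D \<phi> x"
  \<comment> \<open>Half of the curvature, before antisymmetrizing in \<open>a\<close> and
    \<open>b\<close>. The terms with \<open>\<phi>2 x a (\<Gamma> x b w)\<close> from the two sides
    have already cancelled here.\<close>
  have half: "?P (D (\<lambda>y. \<Gamma> y b w) x a + \<Gamma> x a (\<Gamma> x b w)) =
      D (\<lambda>y. \<phi>2 y b w) x a + D (\<lambda>z. \<Gamma>' z (?P b) (?P w)) (\<phi> x) (?P a)
      + \<Gamma>' (\<phi> x) (\<phi>2 x a b) (?P w) + \<Gamma>' (\<phi> x) (?P b) (\<phi>2 x a w) + \<Gamma>' (\<phi> x) (?P a) (\<phi>2 x b w)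
      + \<Gamma>' (\<phi> x) (?P a) (\<Gamma>' (\<phi> x) (?P b) (?P w))" for a b
  proof -
    have lin: "((\<lambda>y. D \<phi> y (\<Gamma> y b w)) has_derivative
       (\<lambda>k. D (\<lambda>y. D \<phi> y (\<Gamma> x b w)) x k + ?P (D (\<lambda>y. \<Gamma> y b w) x k))) (at x)"
      by (rule has_derivative_linear_field[where z = "\<lambda>y. y" and X = U and L = "D \<phi>"])
        (auto intro: open_U x D\<phi>_linear D_works d\<Gamma> smooth_on_differentiable[OF smooth_on_D[OF \<phi>_smooth]])
    have 1: "D (\<lambda>y. D \<phi> y (\<Gamma> y b w)) x a = \<phi>2 x a (\<Gamma> x b w) + ?P (D (\<lambda>y. \<Gamma> y b w) x a)"
      using D_eqI[OF lin] by simp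
    have rhs: "((\<lambda>y. \<Gamma>' (\<phi> y) (D \<phi> y b) (D \<phi> y w)) has_derivative
       (\<lambda>k. D (\<lambda>z. \<Gamma>' z (?P b) (?P w)) (\<phi> x) (?P k) + \<Gamma>' (\<phi> x) (\<phi>2 x k b) (?P w) + \<Gamma>' (\<phi> x) (?P b) (\<phi>2 x k w))) (at x)"
      by (rule has_derivative_bilinear_field[where X = X' and z = \<phi>])
        (auto intro: cod.open_X x' cod.\<Gamma>_bil D_works smooth_on_differentiable[OF cod.\<Gamma>_smooth x']
          smooth_on_differentiable[OF _ x] \<phi>_smooth smooth_on_D)
    have "D (\<lambda>y. D \<phi> y (\<Gamma> y b w)) x a = D (\<lambda>y. \<phi>2 y b w + \<Gamma>' (\<phi> y) (D \<phi> y b) (D \<phi> y w)) x a"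
      by (rule D_cong[OF open_U x, THEN fun_cong]) (use lin \<Gamma>_transform in \<open>auto simp: differentiable_def\<close>)
    also have "\<dots> = D (\<lambda>y. \<phi>2 y b w) x a +
        (D (\<lambda>z. \<Gamma>' z (?P b) (?P w)) (\<phi> x) (?P a) + \<Gamma>' (\<phi> x) (\<phi>2 x a b) (?P w) + \<Gamma>' (\<phi> x) (?P b) (\<phi>2 x a w))"
      by (rule D_eqI[THEN fun_cong], rule has_derivative_add[OF D_works rhs])
        (rule smooth_on_differentiable[OF smooth_on_D[OF smooth_on_D[OF \<phi>_smooth]] x])
    finally have 2: "\<phi>2 x a (\<Gamma> x b w) + ?P (D (\<lambda>y. \<Gamma> y b w) x a) = \<dots>" unfolding 1 .
    have "?P (D (\<lambda>y. \<Gamma> y b w) x a + \<Gamma> x a (\<Gamma> x b w)) = ?P (D (\<lambda>y. \<Gamma> y b w) x a) + ?P (\<Gamma> x a (\<Gamma> x b w))"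
      by (rule linear_add[OF D\<phi>_linear[OF x]])
    also have "?P (\<Gamma> x a (\<Gamma> x b w)) = \<phi>2 x a (\<Gamma> x b w) + (\<Gamma>' (\<phi> x) (?P a) (\<phi>2 x b w)
      + \<Gamma>' (\<phi> x) (?P a) (\<Gamma>' (\<phi> x) (?P b) (?P w)))"
      by (simp add: \<Gamma>_transform[OF x] bil')
    finally show ?thesis using 2 by (simp add: algebra_simps)
  qed
  have sym3: "D (\<lambda>y. \<phi>2 y u w) x v = D (\<lambda>y. \<phi>2 y v w) x u"
    by (rule second_derivative_symmetric[OF open_U x smooth_on_D[OF \<phi>_smooth]])
  have "?P (dom.Rc x u v w) = ?P (D (\<lambda>y. \<Gamma> y v w) x u + \<Gamma> x u (\<Gamma> x v w)) - ?P (D (\<lambda>y. \<Gamma> y u w) x v + \<Gamma> x v (\<Gamma> x u w))"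
    by (subst linear_diff[OF D\<phi>_linear[OF x], symmetric]) (simp add: dom.Rc_def algebra_simps)
  also have "\<dots> = cod.Rc (\<phi> x) (?P u) (?P v) (?P w)"
    unfolding half cod.Rc_def using sym3 \<phi>2_sym[OF x, of u v] by simp
  finally show ?thesis .
qed

end

section \<open>Linear differential equations\<close>

lemma linear_Basis_expand:
  assumes "linear (f :: 'e::euclidean_space \<Rightarrow> 'b::real_vector)"
  shows "f y = (\<Sum>i\<in>Basis. (y \<bullet> i) *\<^sub>R f i)"
proof -
  have "f y = f (\<Sum>i\<in>Basis. (y \<bullet> i) *\<^sub>R i)" by (simp add: euclidean_representation)
  then show ?thesis by (simp only: linear_sum[OF assms] linear_scale[OF assms])
qed

text \<open>Each of the finitely many basis vectors has a bounded image over the compact interval,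
  and linearity sums these bounds to a uniform operator bound.\<close>

lemma linear_family_bounded:
  fixes f :: "real \<Rightarrow> 'e::euclidean_space \<Rightarrow> 'e"
  assumes lin: "\<And>t. t \<in> {a..b} \<Longrightarrow> linear (f t)"
    and cont: "\<And>y. continuous_on {a..b} (\<lambda>t. f t y)"
  obtains L where "L \<ge> 0" "\<And>t y. t \<in> {a..b} \<Longrightarrow> norm (f t y) \<le> L * norm y"
proof -
  have "\<forall>i. \<exists>B. \<forall>t\<in>{a..b}. norm (f t i) \<le> B"
    using compact_continuous_image[OF cont compact_Icc] compact_imp_bounded
    by (metis bounded_iff image_eqI)
  then obtain B where B: "\<And>i t. t \<in> {a..b} \<Longrightarrow> norm (f t i) \<le> B i" by metis
  define L where "L = (\<Sum>i\<in>Basis. \<bar>B i\<bar>)"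
  have "norm (f t y) \<le> L * norm y" if t: "t \<in> {a..b}" for t y
  proof -
    have "norm (f t y) \<le> (\<Sum>i\<in>Basis. norm ((y \<bullet> i) *\<^sub>R f t i))"
      by (subst linear_Basis_expand[OF lin[OF t]]) (rule norm_sum)
    also have "\<dots> \<le> (\<Sum>i\<in>Basis. \<bar>B i\<bar> * norm y)"
    proof (rule sum_mono)
      fix i :: 'e assume i: "i \<in> Basis"
      have "\<bar>y \<bullet> i\<bar> * norm (f t i) \<le> norm y * \<bar>B i\<bar>"
        using B[OF t, of i] Basis_le_norm[OF i, of y] by (intro mult_mono) auto
      then show "norm ((y \<bullet> i) *\<^sub>R f t i) \<le> \<bar>B i\<bar> * norm y" by (simp add: mult.commute)
    qed
    finally show ?thesis by (simp add: L_def sum_distrib_right)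
  qed
  then show thesis by (intro that[of L]) (auto simp: L_def sum_nonneg)
qed

text \<open>Picard iteration: on so short an interval the integral operator contracts the supremum
  distance by 1/2 whatever the initial value, so the admissible length depends only on
  \<open>L\<close>.\<close>

lemma linear_ode_short_time:
  fixes f :: "real \<Rightarrow> 'e::euclidean_space \<Rightarrow> 'e"
  assumes ab: "a \<le> b" and lin: "\<And>t. t \<in> {a..b} \<Longrightarrow> linear (f t)"
    and cont: "\<And>y. continuous_on {a..b} (\<lambda>t. f t y)"
    and bound: "\<And>t y. t \<in> {a..b} \<Longrightarrow> norm (f t y) \<le> L * norm y" "L \<ge> 0"
    and short: "L * (b - a) \<le> 1/2"
  obtains y where "y a = y0" "\<And>t. t \<in> {a..b} \<Longrightarrow> (y has_vector_derivative f t (y t)) (at t within {a..b})"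
proof -
  have cf: "continuous_on {a..b} (\<lambda>s. f s (y s))" if "continuous_on {a..b} y" for y
  proof -
    have "continuous_on {a..b} (\<lambda>s. \<Sum>i\<in>Basis. (y s \<bullet> i) *\<^sub>R f s i)"
      using that cont by (intro continuous_intros)
    then show ?thesis by (rule continuous_on_eq) (simp add: linear_Basis_expand[OF lin, symmetric])
  qed
  have cb: "continuous_on {a..b} (apply_bcontfun y)" for y :: "real \<Rightarrow>\<^sub>C 'e"
    by (rule continuous_on_apply_bcontfun)
  define g where "g y t = y0 + integral {a..t} (\<lambda>s. f s (apply_bcontfun y s))" for y :: "real \<Rightarrow>\<^sub>C 'e" and t
  have int: "(\<lambda>s. f s (apply_bcontfun y s)) integrable_on {a..t}" if "t \<in> {a..b}" for y t
    by (rule integrable_continuous_interval) (use cf[OF cb, of y] that in \<open>auto elim: continuous_on_subset\<close>)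
  have "continuous_on (cbox a b) (g y)" for y
    unfolding g_def using int[of b y] ab
    by (auto intro!: continuous_intros indefinite_integral_continuous_1)
  \<comment> \<open>Clamping extends each iterate constantly beyond [a, b], so the fixed point
    theorem can be used on the complete space of bounded continuous functions on the line.\<close>
  then have "\<exists>T. (\<forall>x\<in>cbox a b. apply_bcontfun T x = g y x) \<and> (\<forall>x. apply_bcontfun T x = g y (clamp a b x))" for y
    by (meson continuous_on_cbox_bcontfunE)
  then obtain T where T: "\<And>y x. x \<in> {a..b} \<Longrightarrow> apply_bcontfun (T y) x = g y x"
    "\<And>y x. apply_bcontfun (T y) x = g y (clamp a b x)" unfolding cbox_interval by metis
  have "dist (T y) (T z) \<le> 1/2 * dist y z" for y z
  proof (rule dist_bound)
    fix x
    define c where "c = clamp a b x"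
    have c: "c \<in> {a..b}" using clamp_in_interval[of a b x] ab by (simp add: c_def)
    have "dist (T y x) (T z x) = norm (integral {a..c} (\<lambda>s. f s (y s)) - integral {a..c} (\<lambda>s. f s (z s)))"
      by (simp add: T(2) g_def dist_norm c_def)
    also have "\<dots> = norm (integral {a..c} (\<lambda>s. f s (y s) - f s (z s)))"
      by (subst integral_diff[OF int[OF c] int[OF c]]) simp
    also have "\<dots> \<le> L * dist y z * (c - a)"
    proof (rule integral_bound)
      fix s assume s: "s \<in> {a..c}"
      then have s': "s \<in> {a..b}" using c by auto
      have "norm (f s (y s) - f s (z s)) = norm (f s (y s - z s))" by (simp add: linear_diff[OF lin[OF s']])
      also have "\<dots> \<le> L * norm (y s - z s)" by (rule bound(1)[OF s'])
      also have "\<dots> \<le> L * dist y z"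
        using bound(2) dist_bounded[of y s z] by (intro mult_left_mono) (simp_all add: dist_norm)
      finally show "norm (f s (y s) - f s (z s)) \<le> L * dist y z" .
    qed (use c in \<open>auto intro!: continuous_intros continuous_on_subset[OF cf[OF cb]]\<close>)
    also have "\<dots> = (L * (c - a)) * dist y z" by simp
    also have "\<dots> \<le> 1/2 * dist y z"
    proof (rule mult_right_mono)
      have "L * (c - a) \<le> L * (b - a)" using c bound(2) by (intro mult_left_mono) auto
      then show "L * (c - a) \<le> 1/2" using short by simp
    qed simp
    finally show "dist (T y x) (T z x) \<le> 1/2 * dist y z" .
  qed
  then obtain y where y: "T y = y" using banach_fix_type[of "1/2" T] by auto
  have eq: "apply_bcontfun y t = g y t" if "t \<in> {a..b}" for t using T(1)[OF that, of y] y by simp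
  show thesis
  proof (rule that[of "apply_bcontfun y"])
    show "apply_bcontfun y a = y0" using eq[of a] ab by (simp add: g_def)
    fix t assume t: "t \<in> {a..b}"
    have "(g y has_vector_derivative f t (y t)) (at t within {a..b})"
      unfolding g_def using integral_has_vector_derivative[OF cf[OF cb[of y]] t]
      by (auto intro!: derivative_eq_intros)
    then show "(apply_bcontfun y has_vector_derivative f t (y t)) (at t within {a..b})"
      using has_vector_derivative_transform[of t "{a..b}" "apply_bcontfun y" "g y"] t eq by auto
  qed
qed

section \<open>Riemannian manifolds in charts\<close>

lemma linear_axis_expand:
  fixes f :: "real^'n \<Rightarrow> 'b::real_vector"
  assumes "linear f"
  shows "f u = (\<Sum>i\<in>UNIV. u $ i *\<^sub>R f (axis i 1))"
proof -
  have "f u = f (\<Sum>i\<in>UNIV. u $ i *\<^sub>R axis i 1)"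
    using basis_expansion[of u] by (simp add: scalar_mult_eq_scaleR)
  then show ?thesis by (simp only: linear_sum[OF assms] linear_scale[OF assms])
qed

lemma mform_sum: "mform H u v = (\<Sum>i\<in>UNIV. \<Sum>j\<in>UNIV. H $ i $ j * u $ i * v $ j)"
  by (simp add: mform_def inner_vec_def matrix_vector_mult_def sum_distrib_left mult_ac)

lemma mform_axis: "mform H (axis i 1) (axis j 1) = H $ i $ j"
  by (simp add: mform_def inner_axis' matrix_vector_mult_basis column_def)

lemma posdef_det_ne_0:
  fixes H :: "real^'n^'n"
  assumes "\<And>v. v \<noteq> 0 \<Longrightarrow> mform H v v > 0"
  shows "det H \<noteq> 0"
proof -
  have "x = 0" if "H *v x = 0" for x using assms[of x] that by (auto simp: mform_def)
  then have "invertible H" using matrix_left_invertible_ker[of H] invertible_left_inverse by blast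
  then show ?thesis by (simp add: invertible_det_nz)
qed

text \<open>Christoffel symbols as a bilinear map, in the form demanded of \<open>\<Gamma>\<close>
  by \<open>local_metric\<close>; \<open>Rm\<close> does the same for curvature.\<close>

definition chr ::
    "('m, 'n::finite, 'z) manifold_scheme \<Rightarrow> ('m, 'n) chart \<Rightarrow> real ^ 'n \<Rightarrow> real ^ 'n \<Rightarrow> real ^ 'n \<Rightarrow> real ^ 'n" where
  "chr M c x u v = (\<chi> k. \<Sum>i\<in>UNIV. \<Sum>j\<in>UNIV. christoffel M c k i j x * u $ i * v $ j)"

definition Rm ::
    "('m, 'n::finite, 'z) manifold_scheme \<Rightarrow> ('m, 'n) chart \<Rightarrow> real ^ 'n \<Rightarrow>
      real ^ 'n \<Rightarrow> real ^ 'n \<Rightarrow> real ^ 'n \<Rightarrow> real ^ 'n" where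
  "Rm M c x u v w =
    (\<chi> l. \<Sum>i\<in>UNIV. \<Sum>j\<in>UNIV. \<Sum>k\<in>UNIV. riemann M c l i j k x * u $ i * v $ j * w $ k)"

lemma bilinear_chr: "bilinear (chr M c x)"
  unfolding bilinear_def chr_def
  by (intro conjI allI linearI)
    (simp_all add: vec_eq_iff algebra_simps sum.distrib sum_distrib_left)

lemma chr_axis: "chr M c x (axis i 1) v $ k = (\<Sum>j\<in>UNIV. christoffel M c k i j x * v $ j)"
  "chr M c x (axis i 1) (axis j 1) $ k = christoffel M c k i j x"
proof -
  show *: "chr M c x (axis i 1) v $ k = (\<Sum>j\<in>UNIV. christoffel M c k i j x * v $ j)" for v
  proof -
    have "chr M c x (axis i 1) v $ k = (\<Sum>i'\<in>UNIV. if i' = i then \<Sum>j\<in>UNIV. christoffel M c k i' j x * v $ j else 0)"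
      unfolding chr_def vec_lambda_beta by (intro sum.cong refl) (simp add: axis_def)
    then show ?thesis by simp
  qed
  show "chr M c x (axis i 1) (axis j 1) $ k = christoffel M c k i j x"
    unfolding * by (simp add: axis_def if_distrib cong: if_cong)
qed

lemma D_vec_nth: "f differentiable (at x) \<Longrightarrow> D (\<lambda>y. f y $ i) x w = D f x w $ i"
  using D_eqI[OF bounded_linear.has_derivative[OF bounded_linear_vec_nth D_works]] by metis

context local_metric
begin

lemma \<Gamma>_D_linear:
  assumes x: "x \<in> X"
  shows "linear (\<lambda>w. D (\<lambda>y. \<Gamma> y v w) x u)"
proof (rule linearI)
  note d = D_works[OF smooth_on_differentiable[OF \<Gamma>_smooth x]]
  fix w w' :: "real^'n" and r :: real
  have "((\<lambda>y. \<Gamma> y v w + \<Gamma> y v w') has_derivative (\<lambda>k. D (\<lambda>y. \<Gamma> y v w) x k + D (\<lambda>y. \<Gamma> y v w') x k)) (at x)"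
    by (intro has_derivative_add d)
  from has_derivative_transform_within_open[OF this open_X x]
  have "((\<lambda>y. \<Gamma> y v (w + w')) has_derivative (\<lambda>k. D (\<lambda>y. \<Gamma> y v w) x k + D (\<lambda>y. \<Gamma> y v w') x k)) (at x)"
    by (simp add: bilinear_rules[OF \<Gamma>_bil])
  from D_eqI[OF this] show "D (\<lambda>y. \<Gamma> y v (w + w')) x u = D (\<lambda>y. \<Gamma> y v w) x u + D (\<lambda>y. \<Gamma> y v w') x u" by simp
  have "((\<lambda>y. r *\<^sub>R \<Gamma> y v w) has_derivative (\<lambda>k. r *\<^sub>R D (\<lambda>y. \<Gamma> y v w) x k)) (at x)"
    by (intro has_derivative_scaleR_right d)
  from has_derivative_transform_within_open[OF this open_X x]
  have "((\<lambda>y. \<Gamma> y v (r *\<^sub>R w)) has_derivative (\<lambda>k. r *\<^sub>R D (\<lambda>y. \<Gamma> y v w) x k)) (at x)"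
    by (simp add: bilinear_rules[OF \<Gamma>_bil])
  from D_eqI[OF this] show "D (\<lambda>y. \<Gamma> y v (r *\<^sub>R w)) x u = r *\<^sub>R D (\<lambda>y. \<Gamma> y v w) x u" by simp
qed

lemma Rc_linear:
  assumes x: "x \<in> X"
  shows "linear (\<lambda>u. Rc x u v w)" "linear (\<lambda>v. Rc x u v w)" "linear (\<lambda>w. Rc x u v w)"
proof -
  note b = bilinear_rules[OF \<Gamma>_bil[OF x]]
  have D1: "linear (D (\<lambda>y. \<Gamma> y v w) x)" for v w
    by (rule linear_frechet_derivative[OF smooth_on_differentiable[OF \<Gamma>_smooth x]])
  have D2: "linear (\<lambda>v. D (\<lambda>y. \<Gamma> y v w) x u)" for w u
    using \<Gamma>_D_linear[OF x, of w u] \<Gamma>_D_sym[OF x] by simp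
  note D3 = \<Gamma>_D_linear[OF x]
  show l: "linear (\<lambda>u. Rc x u v w)" for v w
    unfolding Rc_def by (rule linearI) (simp_all add: linear_add[OF D1] linear_scale[OF D1]
       linear_add[OF D2] linear_scale[OF D2] b algebra_simps)
  show "linear (\<lambda>v. Rc x u v w)"
    unfolding Rc_antisym[of x u _ w] using linear_compose_neg[OF l] .
  show "linear (\<lambda>w. Rc x u v w)"
    unfolding Rc_def by (rule linearI) (simp_all add: linear_add[OF D3] linear_scale[OF D3] b algebra_simps)
qed

end

section \<open>Charts, Jacobians and components of tangent vectors\<close>

locale riemannian =
  fixes M :: "('m, 'n::finite, 'z) manifold_scheme"
  assumes rm: "riemannian_manifold M"
begin

abbreviation dom where "dom c \<equiv> snd c ` fst c"
abbreviation overlap where "overlap c d \<equiv> snd c ` (fst c \<inter> fst d)"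
abbreviation gform where "gform c x \<equiv> mform (gmat M c x)"

lemma is_chart: "c \<in> atlas M \<Longrightarrow> is_chart (mtop M) c"
  using rm by (simp add: riemannian_manifold_def smooth_manifold_def)

lemma open_dom: "c \<in> atlas M \<Longrightarrow> open (dom c)"
  using is_chart by (simp add: is_chart_def)

lemma openin_fst: "c \<in> atlas M \<Longrightarrow> openin (mtop M) (fst c)"
  using is_chart by (simp add: is_chart_def)

lemma fst_subset: "c \<in> atlas M \<Longrightarrow> fst c \<subseteq> topspace (mtop M)"
  using openin_fst openin_subset by blast

lemma inj_chart: "c \<in> atlas M \<Longrightarrow> inj_on (snd c) (fst c)"
  using is_chart[of c] fst_subset[of c] unfolding is_chart_def
  by (metis homeomorphic_imp_injective_map topspace_subtopology_subset)

lemma chart_inv_snd: "c \<in> atlas M \<Longrightarrow> p \<in> fst c \<Longrightarrow> chart_inv c (snd c p) = p"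
  unfolding chart_inv_def using inj_chart inv_into_f_f by metis

lemma transition_snd: "c \<in> atlas M \<Longrightarrow> p \<in> fst c \<Longrightarrow> transition c d (snd c p) = snd d p"
  by (simp add: transition_def chart_inv_snd)

lemma open_overlap:
  assumes "c \<in> atlas M" "d \<in> atlas M"
  shows "open (overlap c d)"
proof -
  have "openin (subtopology (mtop M) (fst c)) (fst c \<inter> fst d)"
    using openin_fst[OF assms(2)] by (auto simp: openin_subtopology)
  moreover have "homeomorphic_map (subtopology (mtop M) (fst c)) (top_of_set (dom c)) (snd c)"
    using is_chart[OF assms(1)] by (simp add: is_chart_def)
  ultimately have "openin (top_of_set (dom c)) (overlap c d)"
    using homeomorphic_map_openness[of "subtopology (mtop M) (fst c)" _ "snd c" "fst c \<inter> fst d"] openin_subset by blast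
  then show ?thesis using open_dom[OF assms(1)] openin_open_trans by blast
qed

lemma transition_smooth: "c \<in> atlas M \<Longrightarrow> d \<in> atlas M \<Longrightarrow> smooth_on (overlap c d) (transition c d)"
  using rm by (simp add: riemannian_manifold_def smooth_manifold_def)

abbreviation J where "J c d p \<equiv> D (transition c d) (snd c p)"

lemma transition_differentiable:
  "chart_at M p c \<Longrightarrow> chart_at M p d \<Longrightarrow> transition c d differentiable (at (snd c p))"
  by (rule smooth_on_differentiable[OF transition_smooth]) (auto simp: chart_at_def)

lemma J_linear: "chart_at M p c \<Longrightarrow> chart_at M p d \<Longrightarrow> linear (J c d p)"
  by (rule linear_frechet_derivative[OF transition_differentiable])

lemma J_self: "chart_at M p c \<Longrightarrow> J c c p a = a"
proof -
  assume p: "chart_at M p c"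
  then have c: "c \<in> atlas M" "p \<in> fst c" by (auto simp: chart_at_def)
  have "D (transition c c) (snd c p) = D (\<lambda>x. x) (snd c p)"
    by (rule D_cong[OF open_dom[OF c(1)]]) (use c transition_differentiable[OF p p] in \<open>auto simp: transition_snd\<close>)
  then show ?thesis by simp
qed

text \<open>The chain rule; the two transition maps compose to the third only where all three charts
  overlap, an open set around the point.\<close>

lemma J_comp:
  assumes "chart_at M p c" "chart_at M p d" "chart_at M p e"
  shows "J d e p (J c d p a) = J c e p a"
proof -
  have at: "c \<in> atlas M" "d \<in> atlas M" "e \<in> atlas M" "p \<in> fst c" "p \<in> fst d" "p \<in> fst e"
    using assms by (auto simp: chart_at_def)
  have 1: "((\<lambda>x. transition d e (transition c d x)) has_derivative (\<lambda>k. J d e p (J c d p k))) (at (snd c p))"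
    by (rule has_derivative_compose[OF D_works[OF transition_differentiable]])
      (use assms D_works[OF transition_differentiable[OF assms(2,3)]] in \<open>auto simp: transition_snd at\<close>)
  have "open (overlap c d \<inter> overlap c e)" by (intro open_Int open_overlap at)
  then have "((\<lambda>x. transition c e x) has_derivative (\<lambda>k. J d e p (J c d p k))) (at (snd c p))"
  proof (rule has_derivative_transform_within_open[OF 1])
    show "snd c p \<in> overlap c d \<inter> overlap c e" using at by blast
    fix x assume "x \<in> overlap c d \<inter> overlap c e"
    then obtain q where "x = snd c q" "q \<in> fst c" "q \<in> fst d" by blast
    then show "transition d e (transition c d x) = transition c e x" by (simp add: transition_snd at)
  qed
  from D_eqI[OF this] show ?thesis by simp
qed

lemma J_surj: "chart_at M p c \<Longrightarrow> chart_at M p d \<Longrightarrow> surj (J c d p)"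
  by (rule surjI[where f = "J d c p"]) (simp add: J_comp J_self)

lemma coord_vec_in: "chart_at M p c \<Longrightarrow> coord_vec M c p a \<in> tangent_space M p"
  by (simp add: tangent_space_def coord_vec_def J_comp del: split_paired_All)

lemma coord_vec_self: "chart_at M p c \<Longrightarrow> coord_vec M c p a c = a"
  by (simp add: coord_vec_def J_self)

lemma tangent_transform:
  "v \<in> tangent_space M p \<Longrightarrow> chart_at M p c \<Longrightarrow> chart_at M p d \<Longrightarrow> v d = J c d p (v c)"
  unfolding tangent_space_def by blast

lemma tangent_zero: "v \<in> tangent_space M p \<Longrightarrow> \<not> chart_at M p c \<Longrightarrow> v c = 0"
  unfolding tangent_space_def by blast

lemma coord_vec_eq: "v \<in> tangent_space M p \<Longrightarrow> chart_at M p c \<Longrightarrow> coord_vec M c p (v c) = v"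
  unfolding coord_vec_def
  by (rule ext) (metis tangent_transform tangent_zero)

lemma tangent_lincomb:
  assumes "u \<in> tangent_space M p" "v \<in> tangent_space M p"
  shows "(\<lambda>c. a *\<^sub>R u c + b *\<^sub>R v c) \<in> tangent_space M p"
proof -
  have "a *\<^sub>R u d + b *\<^sub>R v d = J c d p (a *\<^sub>R u c + b *\<^sub>R v c)" if "chart_at M p c" "chart_at M p d" for c d
    unfolding linear_add[OF J_linear[OF that]] linear_scale[OF J_linear[OF that]]
    using tangent_transform[OF assms(1) that] tangent_transform[OF assms(2) that] by simp
  moreover have "a *\<^sub>R u c + b *\<^sub>R v c = 0" if "\<not> chart_at M p c" for c
    using tangent_zero[OF assms(1) that] tangent_zero[OF assms(2) that] by simp
  ultimately show ?thesis unfolding tangent_space_def by blast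
qed

lemma topspace_chart: "chart_at M p c \<Longrightarrow> p \<in> topspace (mtop M)"
  unfolding chart_at_def using fst_subset[of c] by blast

lemma
  assumes "chart_at M p c" "u \<in> tangent_space M p" "v \<in> tangent_space M p"
  shows rmetric_sym: "rmetric M p u v = rmetric M p v u"
    and rmetric_pos: "u \<noteq> (\<lambda>_. 0) \<Longrightarrow> rmetric M p u u > 0"
    and rmetric_lin: "w \<in> tangent_space M p \<Longrightarrow>
      rmetric M p (\<lambda>c. a *\<^sub>R u c + b *\<^sub>R v c) w = a * rmetric M p u w + b * rmetric M p v w"
  using rm topspace_chart[OF assms(1)] assms(2,3) unfolding riemannian_manifold_def by blast+

text \<open>\<open>gmat\<close> records the metric on coordinate vectors only. Linearity in the
  first argument and symmetry make the metric bilinear in components, hence determined by these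
  values.\<close>

lemma rmetric_gform:
  assumes c: "chart_at M p c" and u: "u \<in> tangent_space M p" and v: "v \<in> tangent_space M p"
  shows "rmetric M p u v = gform c (snd c p) (u c) (v c)"
proof -
  define r where "r a b = rmetric M p (coord_vec M c p a) (coord_vec M c p b)" for a b
  have lin: "coord_vec M c p (\<alpha> *\<^sub>R a + \<beta> *\<^sub>R b) = (\<lambda>d. \<alpha> *\<^sub>R coord_vec M c p a d + \<beta> *\<^sub>R coord_vec M c p b d)" for \<alpha> \<beta> a b
    by (auto simp: coord_vec_def linear_add[OF J_linear[OF c]] linear_scale[OF J_linear[OF c]])
  have r1: "r (\<alpha> *\<^sub>R a + \<beta> *\<^sub>R b) w = \<alpha> * r a w + \<beta> * r b w" for \<alpha> \<beta> a b w
    unfolding r_def lin by (rule rmetric_lin[OF c]) (rule coord_vec_in[OF c])+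
  have sym: "r a b = r b a" for a b
    unfolding r_def by (rule rmetric_sym[OF c]) (rule coord_vec_in[OF c])+
  have l: "linear (\<lambda>a. r a w)" for w
    using r1[of 1 _ 1] r1[of _ _ 0 0] by (intro linearI) auto
  have "linear (r w)" for w using l[of w] unfolding sym[of _ w] .
  with l have "bilinear r" unfolding bilinear_def by blast
  then have "r = gform c (snd c p)"
  proof (rule bilinear_eq_stdbasis[OF _ bilinear_mform])
    fix i j :: "real^'n" assume "i \<in> Basis" "j \<in> Basis"
    then obtain i' j' where "i = axis i' 1" "j = axis j' 1" by (auto simp: Basis_vec_def)
    then show "r i j = gform c (snd c p) i j"
      using c by (simp add: mform_axis r_def gmat_def chart_inv_snd chart_at_def)
  qed
  then show ?thesis using coord_vec_eq[OF u c] coord_vec_eq[OF v c] unfolding r_def by metis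
qed

lemma gform_coord:
  "chart_at M p c \<Longrightarrow> gform c (snd c p) u v = rmetric M p (coord_vec M c p u) (coord_vec M c p v)"
  by (simp add: rmetric_gform coord_vec_in coord_vec_self)

lemma gform_sym: "chart_at M p c \<Longrightarrow> gform c (snd c p) u v = gform c (snd c p) v u"
  unfolding gform_coord by (intro rmetric_sym coord_vec_in)

lemma gform_pos:
  assumes "chart_at M p c" "u \<noteq> 0"
  shows "gform c (snd c p) u u > 0"
proof -
  have "coord_vec M c p u \<noteq> (\<lambda>_. 0)" using coord_vec_self[OF assms(1), of u] assms(2) by metis
  then show ?thesis
    unfolding gform_coord[OF assms(1)] using rmetric_pos[OF assms(1)] coord_vec_in[OF assms(1)] by blast
qed

lemma domE:
  assumes "c \<in> atlas M" "x \<in> dom c"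
  obtains p where "chart_at M p c" "x = snd c p"
  using assms by (auto simp: chart_at_def)

lemma det_gmat:
  assumes "c \<in> atlas M" "x \<in> dom c"
  shows "det (gmat M c x) \<noteq> 0"
proof -
  obtain p where "chart_at M p c" "x = snd c p" using domE[OF assms] .
  then show ?thesis using posdef_det_ne_0[of "gmat M c x"] gform_pos[of p c] by blast
qed

lemma gmat_smooth:
  assumes "c \<in> atlas M"
  shows "smooth_on (dom c) (\<lambda>x. gmat M c x $ i $ j)"
proof -
  have "smooth_on (dom c) (gmat M c)" using rm assms unfolding riemannian_manifold_def by blast
  then show ?thesis by (intro smooth_on_nth open_dom assms)
qed

lemma gform_smooth: "c \<in> atlas M \<Longrightarrow> smooth_on (dom c) (\<lambda>x. gform c x u v)"
  unfolding mform_sum by (intro smooth_on_sum smooth_on_mult smooth_on_const gmat_smooth open_dom)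

lemma christoffel_smooth: "c \<in> atlas M \<Longrightarrow> smooth_on (dom c) (christoffel M c k i j)"
  unfolding christoffel_def[abs_def] partial_deriv_def divide_inverse
  by (intro smooth_on_sum smooth_on_mult smooth_on_const smooth_on_add smooth_on_diff smooth_on_D
      gmat_smooth open_dom smooth_on_matrix_inv det_gmat)

lemma chr_smooth: "c \<in> atlas M \<Longrightarrow> smooth_on (dom c) (\<lambda>x. chr M c x u v)"
  unfolding chr_def
  by (intro smooth_on_vec smooth_on_sum smooth_on_mult smooth_on_const christoffel_smooth open_dom)

lemma riemann_smooth: "c \<in> atlas M \<Longrightarrow> smooth_on (dom c) (riemann M c l i j k)"
  unfolding riemann_def[abs_def] partial_deriv_def
  by (intro smooth_on_sum smooth_on_mult smooth_on_add smooth_on_diff smooth_on_D christoffel_smooth open_dom)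

lemma gform_D:
  assumes c: "c \<in> atlas M" and x: "x \<in> dom c"
  shows "D (\<lambda>y. gform c y p q) x r =
    (\<Sum>a\<in>UNIV. \<Sum>b\<in>UNIV. \<Sum>m\<in>UNIV. p $ a * q $ b * r $ m * partial_deriv m (\<lambda>y. gmat M c y $ a $ b) x)"
proof -
  have d: "(\<lambda>y. gmat M c y $ a $ b) differentiable (at x)" for a b
    by (rule smooth_on_differentiable[OF gmat_smooth[OF c] x])
  have "((\<lambda>y. gform c y p q) has_derivative
     (\<lambda>r. \<Sum>a\<in>UNIV. \<Sum>b\<in>UNIV. D (\<lambda>y. gmat M c y $ a $ b) x r * p $ a * q $ b)) (at x)"
    unfolding mform_sum by (intro has_derivative_sum has_derivative_mult_left D_works d)
  from D_eqI[OF this] have "D (\<lambda>y. gform c y p q) x r = (\<Sum>a\<in>UNIV. \<Sum>b\<in>UNIV. D (\<lambda>y. gmat M c y $ a $ b) x r * p $ a * q $ b)"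
    by simp
  also have "\<dots> = (\<Sum>a\<in>UNIV. \<Sum>b\<in>UNIV. \<Sum>m\<in>UNIV. p $ a * q $ b * r $ m * partial_deriv m (\<lambda>y. gmat M c y $ a $ b) x)"
    by (subst linear_axis_expand[OF linear_frechet_derivative[OF d]])
      (simp add: partial_deriv_def sum_distrib_left sum_distrib_right mult_ac)
  finally show ?thesis .
qed

text \<open>Multiplying by the metric matrix lowers the upper index and removes
  \<open>matrix_inv\<close>; the three remaining sums are directional derivatives of the
  metric.\<close>

lemma chr_koszul:
  assumes c: "c \<in> atlas M" and x: "x \<in> dom c"
  shows "2 * gform c x (chr M c x u v) w =
      D (\<lambda>y. gform c y v w) x u + D (\<lambda>y. gform c y u w) x v - D (\<lambda>y. gform c y u v) x w"
proof -
  let ?H = "gmat M c x"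
  define dg where "dg m a b = partial_deriv m (\<lambda>y. gmat M c y $ a $ b) x" for m a b
  \<comment> \<open>Twice the Christoffel symbols of the first kind, contracted with
    \<open>u\<close> and \<open>v\<close>.\<close>
  define \<kappa> :: "real^'n" where "\<kappa> = (\<chi> l. \<Sum>i\<in>UNIV. \<Sum>j\<in>UNIV. (dg i j l + dg j i l - dg l i j) * u $ i * v $ j)"
  have "chr M c x u v $ k = (matrix_inv ?H *v \<kappa>) $ k / 2" for k
  proof -
    have "chr M c x u v $ k = (\<Sum>i\<in>UNIV. \<Sum>j\<in>UNIV. \<Sum>l\<in>UNIV. matrix_inv ?H $ k $ l * (dg i j l + dg j i l - dg l i j) * u $ i * v $ j / 2)"
      by (simp add: chr_def christoffel_def dg_def sum_distrib_left sum_distrib_right sum_divide_distrib mult_ac)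
    also have "\<dots> = (\<Sum>l\<in>UNIV. \<Sum>i\<in>UNIV. \<Sum>j\<in>UNIV. matrix_inv ?H $ k $ l * (dg i j l + dg j i l - dg l i j) * u $ i * v $ j / 2)"
      by (subst (2) sum.swap, subst sum.swap, rule refl)
    also have "\<dots> = (matrix_inv ?H *v \<kappa>) $ k / 2"
      by (simp add: \<kappa>_def matrix_vector_mult_def sum_distrib_left sum_divide_distrib mult_ac)
    finally show ?thesis .
  qed
  then have "chr M c x u v = (1/2) *\<^sub>R (matrix_inv ?H *v \<kappa>)" by (simp add: vec_eq_iff)
  then have "?H *v chr M c x u v = (1/2) *\<^sub>R \<kappa>"
    using det_ne_0_matrix_inv(1)[OF det_gmat[OF c x]]
    by (simp add: matrix_vector_mult_scaleR matrix_vector_mul_assoc)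
  moreover have "gform c x (chr M c x u v) w = w \<bullet> (?H *v chr M c x u v)"
    using gform_sym domE[OF c x] unfolding mform_def by metis
  ultimately have "2 * gform c x (chr M c x u v) w = w \<bullet> \<kappa>" by simp
  also have "\<dots> = (\<Sum>l\<in>UNIV. \<Sum>i\<in>UNIV. \<Sum>j\<in>UNIV. v $ j * w $ l * u $ i * dg i j l)
     + (\<Sum>l\<in>UNIV. \<Sum>i\<in>UNIV. \<Sum>j\<in>UNIV. u $ i * w $ l * v $ j * dg j i l)
     - (\<Sum>l\<in>UNIV. \<Sum>i\<in>UNIV. \<Sum>j\<in>UNIV. u $ i * v $ j * w $ l * dg l i j)"
    by (simp add: \<kappa>_def inner_vec_def sum_distrib_left sum.distrib[symmetric] sum_subtractf[symmetric])
      (simp add: algebra_simps)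
  also have "(\<Sum>l\<in>UNIV. \<Sum>i\<in>UNIV. \<Sum>j\<in>UNIV. v $ j * w $ l * u $ i * dg i j l) = D (\<lambda>y. gform c y v w) x u"
    unfolding gform_D[OF c x] dg_def[symmetric] by (subst (2) sum.swap, subst sum.swap, rule refl)
  also have "(\<Sum>l\<in>UNIV. \<Sum>i\<in>UNIV. \<Sum>j\<in>UNIV. u $ i * w $ l * v $ j * dg j i l) = D (\<lambda>y. gform c y u w) x v"
    unfolding gform_D[OF c x] dg_def[symmetric] by (subst sum.swap, rule refl)
  also have "(\<Sum>l\<in>UNIV. \<Sum>i\<in>UNIV. \<Sum>j\<in>UNIV. u $ i * v $ j * w $ l * dg l i j) = D (\<lambda>y. gform c y u v) x w"
    unfolding gform_D[OF c x] dg_def[symmetric] by (subst sum.swap, subst (2) sum.swap, rule refl)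
  finally show ?thesis .
qed

lemma local_metric: "c \<in> atlas M \<Longrightarrow> local_metric (dom c) (gform c) (chr M c)"
  by unfold_locales
    (auto intro: open_dom bilinear_mform bilinear_chr gform_smooth chr_smooth gform_sym gform_pos chr_koszul
       simp: chart_at_def)

text \<open>Both sides are trilinear, so comparing coordinate vectors suffices; this makes the
  index-free curvature identities available for \<open>riemann\<close>.\<close>

lemma Rm_eq_Rc:
  assumes c: "c \<in> atlas M" and x: "x \<in> dom c"
  shows "Rm M c x u v w = local_metric.Rc (chr M c) x u v w"
proof -
  interpret local_metric "dom c" "gform c" "chr M c" by (rule local_metric[OF c])
  have dchr: "(\<lambda>y. chr M c y u v) differentiable (at x)" for u v
    by (rule smooth_on_differentiable[OF \<Gamma>_smooth x])
  have "Rc x (axis i 1) (axis j 1) (axis k 1) $ l = riemann M c l i j k x" for i j k l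
  proof -
    have 1: "D (\<lambda>y. chr M c y (axis j 1) (axis k 1)) x w $ l = D (christoffel M c l j k) x w" for j k w
      unfolding D_vec_nth[OF dchr, symmetric] chr_axis(2) ..
    have 2: "chr M c x (axis i 1) (chr M c x (axis j 1) (axis k 1)) $ l
       = (\<Sum>p\<in>UNIV. christoffel M c l i p x * christoffel M c p j k x)" for i j k
      unfolding chr_axis(1)[of M c x i "chr M c x (axis j 1) (axis k 1)"] chr_axis(2) ..
    show ?thesis by (simp add: Rc_def riemann_def partial_deriv_def 1 2 sum_subtractf)
  qed
  moreover have "Rc x u v w = (\<Sum>i\<in>UNIV. u $ i *\<^sub>R (\<Sum>j\<in>UNIV. v $ j *\<^sub>R (\<Sum>k\<in>UNIV. w $ k *\<^sub>R Rc x (axis i 1) (axis j 1) (axis k 1))))"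
    by (subst linear_axis_expand[OF Rc_linear(1)[OF x]], subst linear_axis_expand[OF Rc_linear(2)[OF x]],
        subst linear_axis_expand[OF Rc_linear(3)[OF x]]) (rule refl)
  ultimately show ?thesis
    by (simp add: Rm_def vec_eq_iff sum_distrib_left mult_ac)
qed

text \<open>The metric evaluates tangent vectors, not components, so its two coordinate expressions
  on an overlap differ by the Jacobian only.\<close>

lemma local_isometry:
  assumes c: "c \<in> atlas M" and d: "d \<in> atlas M"
  shows "local_isometry (dom c) (gform c) (chr M c) (dom d) (gform d) (chr M d) (overlap c d) (transition c d)"
proof -
  interpret dom: local_metric "dom c" "gform c" "chr M c" by (rule local_metric[OF c])
  interpret cod: local_metric "dom d" "gform d" "chr M d" by (rule local_metric[OF d])
  show ?thesis
  proof unfold_locales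
    fix x u v assume "x \<in> overlap c d"
    then obtain p where p: "x = snd c p" "chart_at M p c" "chart_at M p d" using c d by (auto simp: chart_at_def)
    then show "transition c d x \<in> dom d" using c by (simp add: transition_snd chart_at_def)
    show "surj (D (transition c d) x)" using p J_surj by simp
    show "gform c x u v = gform d (transition c d x) (D (transition c d) x u) (D (transition c d) x v)"
      unfolding p(1) gform_coord[OF p(2)] rmetric_gform[OF p(3) coord_vec_in[OF p(2)] coord_vec_in[OF p(2)]]
      using p by (simp add: transition_snd chart_at_def coord_vec_def)
  qed (use open_overlap[OF c d] transition_smooth[OF c d] in auto)
qed

lemma chr_transform:
  assumes "chart_at M p c" "chart_at M p d"
  shows "J c d p (chr M c (snd c p) u v) =
     D (\<lambda>y. D (transition c d) y v) (snd c p) u + chr M d (snd d p) (J c d p u) (J c d p v)"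
proof -
  have cd: "c \<in> atlas M" "d \<in> atlas M" "p \<in> fst c" "p \<in> fst d" using assms by (auto simp: chart_at_def)
  interpret local_isometry "dom c" "gform c" "chr M c" "dom d" "gform d" "chr M d" "overlap c d" "transition c d"
    by (rule local_isometry[OF cd(1,2)])
  show ?thesis using \<Gamma>_transform[of "snd c p"] cd by (auto simp: transition_snd)
qed

lemma Rm_transform:
  assumes "chart_at M p c" "chart_at M p d"
  shows "J c d p (Rm M c (snd c p) u v w) = Rm M d (snd d p) (J c d p u) (J c d p v) (J c d p w)"
proof -
  have cd: "c \<in> atlas M" "d \<in> atlas M" "p \<in> fst c" "p \<in> fst d" using assms by (auto simp: chart_at_def)
  interpret local_isometry "dom c" "gform c" "chr M c" "dom d" "gform d" "chr M d" "overlap c d" "transition c d"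
    by (rule local_isometry[OF cd(1,2)])
  show ?thesis using Rc_transform[of "snd c p"] cd by (auto simp: transition_snd Rm_eq_Rc)
qed

lemma curv_eq: "chart_at M p c \<Longrightarrow> curv M p u v w c = Rm M c (snd c p) (u c) (v c) (w c)"
  by (simp add: curv_def Rm_def)

end

section \<open>Jacobi fields along a geodesic\<close>

locale unit_geodesic = riemannian M
  for M :: "('m, 'n::finite, 'z) manifold_scheme" +
  fixes \<gamma> :: "real \<Rightarrow> 'm" and \<rho> :: real
  assumes \<rho>: "\<rho> > 0"
    and geodesic: "geodesic_on M {0..\<rho>} \<gamma>"
    and unit_speed: "unit_speed_on M {0..\<rho>} \<gamma>"
begin

abbreviation I where "I \<equiv> {0..\<rho>}"
abbreviation vel where "vel \<equiv> velocity M I \<gamma>"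
abbreviation at_c where "at_c t c \<equiv> chart_at M (\<gamma> t) c"
abbreviation pos where "pos c t \<equiv> snd c (\<gamma> t)"

text \<open>Every point of the interval, end points included, is a limit point of it; this makes
  one-sided derivatives unique.\<close>

lemma not_bot: "t \<in> I \<Longrightarrow> at t within I \<noteq> bot"
  using \<rho> by (auto simp: trivial_limit_within intro!: islimpt_closure_open[where s = "{0<..<\<rho>}"])

lemma I_unique:
  "t \<in> I \<Longrightarrow> (f has_vector_derivative f') (at t within I) \<Longrightarrow> (f has_vector_derivative f'') (at t within I) \<Longrightarrow> f' = f''"
  by (rule vector_derivative_unique_within[OF not_bot])

lemma pos_derivative:
  assumes "t \<in> I" "at_c t c"
  shows "(pos c has_vector_derivative vel t c) (at t within I)"
proof -
  have "(snd c \<circ> \<gamma>) differentiable (at t within I)" using geodesic assms unfolding geodesic_on_def by blast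
  then show ?thesis using assms by (simp add: vector_derivative_works velocity_def o_def)
qed

lemma chart_nbhd:
  assumes "t \<in> I" "at_c t c"
  obtains \<delta> where "\<delta> > 0" "\<And>s. s \<in> I \<Longrightarrow> \<bar>s - t\<bar> < \<delta> \<Longrightarrow> at_c s c"
proof -
  have c: "c \<in> atlas M" "\<gamma> t \<in> fst c" using assms by (auto simp: chart_at_def)
  have "continuous_map (top_of_set I) (mtop M) \<gamma>" using geodesic by (simp add: geodesic_on_def)
  then have "openin (top_of_set I) {s \<in> topspace (top_of_set I). \<gamma> s \<in> fst c}"
    by (rule openin_continuous_map_preimage) (rule openin_fst[OF c(1)])
  then obtain T where T: "open T" "{s \<in> I. \<gamma> s \<in> fst c} = I \<inter> T" by (auto simp: openin_open)
  then have "t \<in> T" using assms c by blast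
  then obtain \<delta> where "\<delta> > 0" "ball t \<delta> \<subseteq> T" using T(1) open_contains_ball by blast
  then show thesis
    using T(2) c(1) by (intro that[of \<delta>]) (auto simp: chart_at_def dist_real_def subset_iff abs_minus_commute)
qed

lemma ex_chart:
  assumes "t \<in> I"
  obtains c where "at_c t c"
proof -
  have "\<gamma> t \<in> topspace (mtop M)"
    using geodesic assms continuous_map_image_subset_topspace[of "top_of_set I" "mtop M" \<gamma>]
    by (auto simp: geodesic_on_def)
  then obtain c where "c \<in> atlas M" "\<gamma> t \<in> fst c"
    using rm unfolding riemannian_manifold_def smooth_manifold_def by blast
  then show thesis using that by (simp add: chart_at_def)
qed

lemma vel_tangent:
  assumes t: "t \<in> I"
  shows "vel t \<in> tangent_space M (\<gamma> t)"
proof -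
  have "vel t d = J c d (\<gamma> t) (vel t c)" if c: "at_c t c" and d: "at_c t d" for c d
  proof (rule I_unique[OF t pos_derivative[OF t d]])
    have "((\<lambda>s. transition c d (pos c s)) has_derivative (\<lambda>k. J c d (\<gamma> t) (k *\<^sub>R vel t c))) (at t within I)"
      by (rule has_derivative_compose[OF pos_derivative[OF t c, unfolded has_vector_derivative_def] D_works[OF transition_differentiable[OF c d]]])
    then have hd: "((\<lambda>s. transition c d (pos c s)) has_vector_derivative J c d (\<gamma> t) (vel t c)) (at t within I)"
      by (simp add: has_vector_derivative_def linear_scale[OF J_linear[OF c d]])
    obtain \<delta> where \<delta>: "\<delta> > 0" "\<And>s. s \<in> I \<Longrightarrow> \<bar>s - t\<bar> < \<delta> \<Longrightarrow> at_c s c" using chart_nbhd[OF t c] by blast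
    show "(pos d has_vector_derivative J c d (\<gamma> t) (vel t c)) (at t within I)"
      by (rule has_vector_derivative_transform_within[OF hd \<delta>(1) t])
        (use \<delta>(2) in \<open>auto simp: dist_real_def chart_at_def transition_snd\<close>)
  qed
  moreover have "vel t c = 0" if "\<not> at_c t c" for c using that by (simp add: velocity_def)
  ultimately show ?thesis unfolding tangent_space_def by blast
qed

lemma vel_derivative:
  assumes t: "t \<in> I" and c: "at_c t c"
  shows "((\<lambda>s. vel s c) has_vector_derivative - chr M c (pos c t) (vel t c) (vel t c)) (at t within I)"
proof -
  have d: "(\<lambda>s. vel s c) differentiable (at t within I)"
    and "cov_deriv M I \<gamma> vel t = (\<lambda>_. 0)"
    using geodesic t c unfolding geodesic_on_def differentiable_along_def by blast+
  then have "cov_deriv M I \<gamma> vel t c = 0" by simp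
  then have "vector_derivative (\<lambda>s. vel s c) (at t within I) + chr M c (pos c t) (vel t c) (vel t c) = 0"
    using c by (simp add: cov_deriv_def chr_def)
  then have "vector_derivative (\<lambda>s. vel s c) (at t within I) = - chr M c (pos c t) (vel t c) (vel t c)"
    by (simp add: eq_neg_iff_add_eq_0)
  then show ?thesis using d by (metis vector_derivative_works)
qed

lemma vel_nonzero:
  assumes t: "t \<in> I" and c: "at_c t c"
  shows "vel t c \<noteq> 0"
proof
  assume "vel t c = 0"
  then have "rmetric M (\<gamma> t) (vel t) (vel t) = 0"
    using rmetric_gform[OF c vel_tangent[OF t] vel_tangent[OF t]] by (simp add: mform_def)
  then show False using unit_speed t by (simp add: unit_speed_on_def)
qed

section \<open>Covariant derivatives along the geodesic and existence of Jacobi fields\<close>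

definition cov_field :: "real set \<Rightarrow> (real \<Rightarrow> ('m, 'n) tvec) \<Rightarrow> (real \<Rightarrow> ('m, 'n) tvec) \<Rightarrow> bool" where
  "cov_field S V W \<longleftrightarrow> (\<forall>t\<in>S. \<forall>c. at_c t c \<longrightarrow>
     ((\<lambda>s. V s c) has_vector_derivative W t c - chr M c (pos c t) (vel t c) (V t c)) (at t within S))"

definition tangent_field :: "real set \<Rightarrow> (real \<Rightarrow> ('m, 'n) tvec) \<Rightarrow> bool" where
  "tangent_field S V \<longleftrightarrow> (\<forall>t\<in>S. V t \<in> tangent_space M (\<gamma> t))"

text \<open>\<open>cov_field S V W\<close> expresses \<open>DV/dt = W\<close>; a \<open>jacobi_pair\<close> is a Jacobi field with its covariant
  derivative, with derivatives taken within \<open>S\<close>, which may be smaller than the domain of \<open>\<gamma>\<close>.\<close>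

definition jacobi_pair :: "real set \<Rightarrow> (real \<Rightarrow> ('m, 'n) tvec) \<Rightarrow> (real \<Rightarrow> ('m, 'n) tvec) \<Rightarrow> bool" where
  "jacobi_pair S V K \<longleftrightarrow> tangent_field S V \<and> tangent_field S K \<and> cov_field S V K \<and>
     cov_field S K (\<lambda>t c. - Rm M c (pos c t) (V t c) (vel t c) (vel t c))"

text \<open>An equation solved in one chart holds in all: the derivative of the Jacobian along the
  curve cancels the inhomogeneous term in the law for Christoffel symbols.\<close>

lemma cov_field_from_chart:
  assumes c: "\<And>t. t \<in> S \<Longrightarrow> at_c t c" and S: "S \<subseteq> I"
    and y: "\<And>t. t \<in> S \<Longrightarrow> (y has_vector_derivative w t - chr M c (pos c t) (vel t c) (y t)) (at t within S)"
    and W: "\<And>t d. t \<in> S \<Longrightarrow> at_c t d \<Longrightarrow> W t d = J c d (\<gamma> t) (w t)"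
  shows "cov_field S (\<lambda>t. coord_vec M c (\<gamma> t) (y t)) W"
  unfolding cov_field_def
proof (intro ballI allI impI)
  fix t d assume t: "t \<in> S" and d: "at_c t d"
  have tI: "t \<in> I" using t S by blast
  note ct = c[OF t]
  have cd: "c \<in> atlas M" "d \<in> atlas M" using ct d by (auto simp: chart_at_def)
  let ?P = "J c d (\<gamma> t)"
  have "((\<lambda>s. D (transition c d) (pos c s) (y s)) has_derivative
      (\<lambda>k. D (\<lambda>z. D (transition c d) z (y t)) (pos c t) (k *\<^sub>R vel t c)
         + ?P (k *\<^sub>R (w t - chr M c (pos c t) (vel t c) (y t))))) (at t within S)"
  proof (rule has_derivative_linear_field[where X = "overlap c d" and z = "pos c"])
    show "linear (D (transition c d) z)" if "z \<in> overlap c d" for z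
      by (rule linear_frechet_derivative[OF smooth_on_differentiable[OF transition_smooth[OF cd] that]])
    show inO: "pos c t \<in> overlap c d" using ct d by (auto simp: chart_at_def)
    show "(\<lambda>z. D (transition c d) z v) differentiable (at (pos c t))" for v
      by (rule smooth_on_differentiable[OF smooth_on_D[OF transition_smooth[OF cd]] inO])
    show "(pos c has_derivative (\<lambda>k. k *\<^sub>R vel t c)) (at t within S)"
      using has_derivative_subset[OF pos_derivative[OF tI ct, unfolded has_vector_derivative_def] S] .
  qed (use open_overlap[OF cd] t y[OF t] in \<open>auto simp: has_vector_derivative_def\<close>)
  also have "(\<lambda>k. D (\<lambda>z. D (transition c d) z (y t)) (pos c t) (k *\<^sub>R vel t c)
         + ?P (k *\<^sub>R (w t - chr M c (pos c t) (vel t c) (y t)))) =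
     (\<lambda>k. k *\<^sub>R (W t d - chr M d (pos d t) (vel t d) (?P (y t))))"
  proof
    fix k
    have inO: "pos c t \<in> overlap c d" using ct d by (auto simp: chart_at_def)
    have l2: "linear (D (\<lambda>z. D (transition c d) z (y t)) (pos c t))"
      by (rule linear_frechet_derivative[OF smooth_on_differentiable[OF smooth_on_D[OF transition_smooth[OF cd]] inO]])
    have vd: "vel t d = ?P (vel t c)" by (rule tangent_transform[OF vel_tangent[OF tI] ct d])
    show "D (\<lambda>z. D (transition c d) z (y t)) (pos c t) (k *\<^sub>R vel t c)
         + ?P (k *\<^sub>R (w t - chr M c (pos c t) (vel t c) (y t))) =
       k *\<^sub>R (W t d - chr M d (pos d t) (vel t d) (?P (y t)))"
      using chr_transform[OF ct d, of "vel t c" "y t"]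
      by (simp add: W[OF t d] vd linear_scale[OF l2] linear_scale[OF J_linear[OF ct d]] linear_diff[OF J_linear[OF ct d]]
          flip: scaleR_add_right)
  qed
  finally have hd: "((\<lambda>s. J c d (\<gamma> s) (y s)) has_vector_derivative
     (W t d - chr M d (pos d t) (vel t d) (?P (y t)))) (at t within S)"
    by (simp add: has_vector_derivative_def)
  obtain \<delta> where \<delta>: "\<delta> > 0" "\<And>s. s \<in> I \<Longrightarrow> \<bar>s - t\<bar> < \<delta> \<Longrightarrow> at_c s d" using chart_nbhd[OF tI d] by blast
  have "((\<lambda>s. coord_vec M c (\<gamma> s) (y s) d) has_vector_derivative
     (W t d - chr M d (pos d t) (vel t d) (?P (y t)))) (at t within S)"
    by (rule has_vector_derivative_transform_within[OF hd \<delta>(1) t])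
      (use \<delta>(2) S in \<open>auto simp: dist_real_def coord_vec_def subset_iff\<close>)
  then show "((\<lambda>s. coord_vec M c (\<gamma> s) (y s) d) has_vector_derivative
     W t d - chr M d (pos d t) (vel t d) (coord_vec M c (\<gamma> t) (y t) d)) (at t within S)"
    using d by (simp add: coord_vec_def)
qed

lemma continuous_coefficients:
  assumes c: "\<And>t. t \<in> S \<Longrightarrow> at_c t c" and S: "S \<subseteq> I" and v: "continuous_on S v"
  shows "continuous_on S (\<lambda>t. chr M c (pos c t) (vel t c) (v t))"
    and "continuous_on S (\<lambda>t. Rm M c (pos c t) (v t) (vel t c) (vel t c))"
proof -
  have pos: "continuous_on S (pos c)"
    unfolding continuous_on_eq_continuous_within
    using pos_derivative c S by (meson continuous_within_subset has_vector_derivative_continuous subsetD)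
  have vel: "continuous_on S (\<lambda>t. vel t c)"
    unfolding continuous_on_eq_continuous_within
    using vel_derivative c S by (meson continuous_within_subset has_vector_derivative_continuous subsetD)
  have im: "pos c ` S \<subseteq> dom c" using c by (auto simp: chart_at_def)
  have 1: "continuous_on S (\<lambda>t. christoffel M c k i j (pos c t))" if "c \<in> atlas M" for k i j
    by (rule continuous_on_compose2[OF smooth_on_continuous[OF christoffel_smooth[OF that]] pos im])
  have 2: "continuous_on S (\<lambda>t. riemann M c l i j k (pos c t))" if "c \<in> atlas M" for l i j k
    by (rule continuous_on_compose2[OF smooth_on_continuous[OF riemann_smooth[OF that]] pos im])
  have nth: "continuous_on S (\<lambda>t. f t $ i)" if "continuous_on S f" for f :: "real \<Rightarrow> real^'n" and i
    using that by (intro continuous_intros)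
  show "continuous_on S (\<lambda>t. chr M c (pos c t) (vel t c) (v t))"
  proof (cases "S = {}")
    case False
    then have "c \<in> atlas M" using c by (auto simp: chart_at_def)
    then show ?thesis unfolding chr_def
      by (intro continuous_on_vec_lambda continuous_on_sum continuous_on_mult 1 nth vel v)
  qed simp
  show "continuous_on S (\<lambda>t. Rm M c (pos c t) (v t) (vel t c) (vel t c))"
  proof (cases "S = {}")
    case False
    then have "c \<in> atlas M" using c by (auto simp: chart_at_def)
    then show ?thesis unfolding Rm_def
      by (intro continuous_on_vec_lambda continuous_on_sum continuous_on_mult 2 nth vel v)
  qed simp
qed

lemma Rm_linear:
  assumes "at_c t c"
  shows "linear (\<lambda>u. Rm M c (pos c t) u v w)"
proof -
  have c: "c \<in> atlas M" "pos c t \<in> dom c" using assms by (auto simp: chart_at_def)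
  interpret local_metric "dom c" "gform c" "chr M c" by (rule local_metric[OF c(1)])
  show ?thesis unfolding Rm_eq_Rc[OF c] by (rule Rc_linear(1)[OF c(2)])
qed

text \<open>In a chart the Jacobi equation is a first-order linear system for the field and its
  covariant derivative. Allowing every short interval around \<open>\<tau>\<close>, with data at its
  left end, fits the bisection argument.\<close>

lemma jacobi_pair_local:
  assumes \<tau>: "\<tau> \<in> I"
  obtains \<delta> where "\<delta> > 0" "\<And>a b v k. 0 \<le> a \<Longrightarrow> a \<le> \<tau> \<Longrightarrow> \<tau> \<le> b \<Longrightarrow> b \<le> \<rho> \<Longrightarrow> b - a < \<delta> \<Longrightarrow>
    v \<in> tangent_space M (\<gamma> a) \<Longrightarrow> k \<in> tangent_space M (\<gamma> a) \<Longrightarrow> \<exists>V K. jacobi_pair {a..b} V K \<and> V a = v \<and> K a = k"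
proof -
  obtain c where c\<tau>: "at_c \<tau> c" using ex_chart[OF \<tau>] .
  obtain \<delta>1 where \<delta>1: "\<delta>1 > 0" "\<And>s. s \<in> I \<Longrightarrow> \<bar>s - \<tau>\<bar> < \<delta>1 \<Longrightarrow> at_c s c" using chart_nbhd[OF \<tau> c\<tau>] by blast
  \<comment> \<open>Halving \<open>\<delta>1\<close> keeps the closed interval inside the
    chart.\<close>
  define a0 b0 where "a0 = max 0 (\<tau> - \<delta>1/2)" and "b0 = min \<rho> (\<tau> + \<delta>1/2)"
  have S: "{a0..b0} \<subseteq> I" by (auto simp: a0_def b0_def)
  have c: "at_c t c" if "t \<in> {a0..b0}" for t using \<delta>1 S that by (auto simp: a0_def b0_def)
  define f where "f t y = (snd y - chr M c (pos c t) (vel t c) (fst y),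
      - Rm M c (pos c t) (fst y) (vel t c) (vel t c) - chr M c (pos c t) (vel t c) (snd y))" for t and y :: "(real^'n) \<times> (real^'n)"
  have lin: "linear (f t)" if "t \<in> {a0..b0}" for t
    unfolding f_def using bilinear_rules[OF bilinear_chr[of M c "pos c t"]]
      linear_add[OF Rm_linear[OF c[OF that]]] linear_scale[OF Rm_linear[OF c[OF that]]]
    by (intro linearI) (auto simp: algebra_simps)
  have cont: "continuous_on {a0..b0} (\<lambda>t. f t y)" for y
    unfolding f_def by (intro continuous_intros continuous_coefficients c S)
  obtain L where L: "L \<ge> 0" "\<And>t y. t \<in> {a0..b0} \<Longrightarrow> norm (f t y) \<le> L * norm y"
    using linear_family_bounded[OF lin cont] by blast
  \<comment> \<open>The second bound gives the contraction condition L (b - a) \<le> 1/2; adding 1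
    covers L = 0.\<close>
  define \<delta> where "\<delta> = min (\<delta>1/2) (1 / (2 * (L + 1)))"
  show thesis
  proof (rule that[of \<delta>])
    show "\<delta> > 0" using \<delta>1 L(1) by (simp add: \<delta>_def)
    fix a b v k assume ab: "0 \<le> a" "a \<le> \<tau>" "\<tau> \<le> b" "b \<le> \<rho>" "b - a < \<delta>"
      and vk: "v \<in> tangent_space M (\<gamma> a)" "k \<in> tangent_space M (\<gamma> a)"
    have sub: "{a..b} \<subseteq> {a0..b0}" using ab by (auto simp: a0_def b0_def \<delta>_def)
    have "L * (b - a) \<le> L * (1 / (2 * (L + 1)))" using ab L(1) by (intro mult_left_mono) (auto simp: \<delta>_def)
    also have "\<dots> \<le> 1/2" using L(1) by (simp add: divide_simps)
    finally have short: "L * (b - a) \<le> 1/2" .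
    obtain y where y: "y a = (v c, k c)" "\<And>t. t \<in> {a..b} \<Longrightarrow> (y has_vector_derivative f t (y t)) (at t within {a..b})"
      using linear_ode_short_time[of a b f L "(v c, k c)"] ab lin L short sub continuous_on_subset[OF cont sub]
      by (smt (verit) subsetD)
    have c': "at_c t c" and tI: "t \<in> I" if "t \<in> {a..b}" for t using that sub S c by blast+
    define V where "V t = coord_vec M c (\<gamma> t) (fst (y t))" for t
    define K where "K t = coord_vec M c (\<gamma> t) (snd (y t))" for t
    have y1: "((\<lambda>s. fst (y s)) has_vector_derivative snd (y t) - chr M c (pos c t) (vel t c) (fst (y t))) (at t within {a..b})"
      and y2: "((\<lambda>s. snd (y s)) has_vector_derivative - Rm M c (pos c t) (fst (y t)) (vel t c) (vel t c)
        - chr M c (pos c t) (vel t c) (snd (y t))) (at t within {a..b})" if "t \<in> {a..b}" for t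
      using bounded_linear.has_vector_derivative[OF bounded_linear_fst y(2)[OF that]]
        bounded_linear.has_vector_derivative[OF bounded_linear_snd y(2)[OF that]] by (simp_all add: f_def)
    have subI: "{a..b} \<subseteq> I" using sub S by blast
    have "cov_field {a..b} V K"
      unfolding V_def by (rule cov_field_from_chart[OF c' subI y1]) (auto simp: K_def coord_vec_def)
    moreover have "cov_field {a..b} K (\<lambda>t d. - Rm M d (pos d t) (V t d) (vel t d) (vel t d))"
      unfolding K_def
    proof (rule cov_field_from_chart[OF c' subI y2])
      fix t d assume t: "t \<in> {a..b}" and d: "at_c t d"
      show "- Rm M d (pos d t) (V t d) (vel t d) (vel t d)
        = J c d (\<gamma> t) (- Rm M c (pos c t) (fst (y t)) (vel t c) (vel t c))"
        using Rm_transform[OF c'[OF t] d] d tangent_transform[OF vel_tangent[OF tI[OF t]] c'[OF t] d]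
        by (simp add: V_def coord_vec_def linear_neg[OF J_linear[OF c'[OF t] d]])
    qed
    moreover have "tangent_field {a..b} V" "tangent_field {a..b} K"
      unfolding tangent_field_def V_def K_def using coord_vec_in c' by blast+
    moreover have "V a = v" "K a = k"
      using y(1) coord_vec_eq[OF vk(1) c'] coord_vec_eq[OF vk(2) c'] ab by (auto simp: V_def K_def)
    ultimately show "\<exists>V K. jacobi_pair {a..b} V K \<and> V a = v \<and> K a = k" unfolding jacobi_pair_def by blast
  qed
qed

text \<open>At the junction the values and the prescribed covariant derivatives agree, hence so do
  the left and right derivatives in coordinates.\<close>

lemma cov_field_concat:
  assumes V1: "cov_field {a..b} V1 W1" and V2: "cov_field {b..e} V2 W2" and ab: "a \<le> b" "b \<le> e"
    and eq: "V1 b = V2 b" "W1 b = W2 b"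
  shows "cov_field {a..e} (\<lambda>t. if t \<le> b then V1 t else V2 t) (\<lambda>t. if t \<le> b then W1 t else W2 t)"
  unfolding cov_field_def
proof (intro ballI allI impI)
  fix t c assume t: "t \<in> {a..e}" and c: "at_c t c"
  have S: "{a..b} \<union> (closure {a..b} \<inter> closure {b..e}) = {a..b}"
    "{b..e} \<union> (closure {a..b} \<inter> closure {b..e}) = {b..e}" "{a..e} = {a..b} \<union> {b..e}" using ab by auto
  have tb: "t = b" if "t \<in> closure {a..b}" "t \<in> closure {b..e}" using that by simp
  have "((\<lambda>s. if s \<in> {a..b} then V1 s c else V2 s c) has_vector_derivative
     (if t \<in> {a..b} then W1 t c - chr M c (pos c t) (vel t c) (V1 t c) else W2 t c - chr M c (pos c t) (vel t c) (V2 t c)))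
     (at t within {a..e})"
  proof (rule has_vector_derivative_If_within_closures[where f' = "\<lambda>t. W1 t c - chr M c (pos c t) (vel t c) (V1 t c)"
        and g' = "\<lambda>t. W2 t c - chr M c (pos c t) (vel t c) (V2 t c)", OF _ S(3), unfolded S(1,2)])
    show "t \<in> {a..b} \<union> {b..e}" using t S(3) by blast
    show "((\<lambda>s. V1 s c) has_vector_derivative W1 t c - chr M c (pos c t) (vel t c) (V1 t c)) (at t within {a..b})"
      if "t \<in> {a..b}" using V1 that c unfolding cov_field_def by blast
    show "((\<lambda>s. V2 s c) has_vector_derivative W2 t c - chr M c (pos c t) (vel t c) (V2 t c)) (at t within {b..e})"
      if "t \<in> {b..e}" using V2 that c unfolding cov_field_def by blast
    show "V1 t c = V2 t c" if "t \<in> closure {a..b}" "t \<in> closure {b..e}" using tb[OF that] eq by simp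
    show "W1 t c - chr M c (pos c t) (vel t c) (V1 t c) = W2 t c - chr M c (pos c t) (vel t c) (V2 t c)"
      if "t \<in> closure {a..b}" "t \<in> closure {b..e}" using tb[OF that] eq by simp
  qed
  moreover have "W1 t c - chr M c (pos c t) (vel t c) (V1 t c) = W2 t c - chr M c (pos c t) (vel t c) (V2 t c)" if "t = b"
    using eq that by simp
  ultimately have *: "((\<lambda>s. if s \<in> {a..b} then V1 s c else V2 s c) has_vector_derivative
     (if t \<le> b then W1 t else W2 t) c - chr M c (pos c t) (vel t c) ((if t \<le> b then V1 t else V2 t) c)) (at t within {a..e})"
    using t by auto
  show "((\<lambda>s. (if s \<le> b then V1 s else V2 s) c) has_vector_derivative
     (if t \<le> b then W1 t else W2 t) c - chr M c (pos c t) (vel t c) ((if t \<le> b then V1 t else V2 t) c)) (at t within {a..e})"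
    by (rule has_vector_derivative_transform[OF t _ *]) auto
qed

lemma jacobi_pair_concat:
  assumes 1: "jacobi_pair {a..b} V1 K1" and 2: "jacobi_pair {b..e} V2 K2" and ab: "a \<le> b" "b \<le> e"
    and eq: "V1 b = V2 b" "K1 b = K2 b"
  shows "jacobi_pair {a..e} (\<lambda>t. if t \<le> b then V1 t else V2 t) (\<lambda>t. if t \<le> b then K1 t else K2 t)"
proof -
  have "cov_field {a..e} (\<lambda>t. if t \<le> b then K1 t else K2 t)
    (\<lambda>t. if t \<le> b then (\<lambda>c. - Rm M c (pos c t) (V1 t c) (vel t c) (vel t c))
        else (\<lambda>c. - Rm M c (pos c t) (V2 t c) (vel t c) (vel t c)))"
    using 1 2 eq by (intro cov_field_concat ab) (auto simp: jacobi_pair_def)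
  also have "(\<lambda>t. if t \<le> b then (\<lambda>c. - Rm M c (pos c t) (V1 t c) (vel t c) (vel t c))
        else (\<lambda>c. - Rm M c (pos c t) (V2 t c) (vel t c) (vel t c))) =
     (\<lambda>t c. - Rm M c (pos c t) ((if t \<le> b then V1 t else V2 t) c) (vel t c) (vel t c))"
    by (auto simp: fun_eq_iff)
  finally have "cov_field {a..e} (\<lambda>t. if t \<le> b then K1 t else K2 t)
     (\<lambda>t c. - Rm M c (pos c t) ((if t \<le> b then V1 t else V2 t) c) (vel t c) (vel t c))" .
  moreover have "cov_field {a..e} (\<lambda>t. if t \<le> b then V1 t else V2 t) (\<lambda>t. if t \<le> b then K1 t else K2 t)"
    using 1 2 by (intro cov_field_concat ab eq) (auto simp: jacobi_pair_def)
  moreover have "tangent_field {a..e} (\<lambda>t. if t \<le> b then V1 t else V2 t)"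
      "tangent_field {a..e} (\<lambda>t. if t \<le> b then K1 t else K2 t)"
    using 1 2 by (auto simp: jacobi_pair_def tangent_field_def)
  ultimately show ?thesis unfolding jacobi_pair_def by blast
qed

text \<open>Existence in a chart over short intervals is glued by the bisection principle \<open>Bolzano\<close>.\<close>

lemma jacobi_pair_exists:
  assumes "v \<in> tangent_space M (\<gamma> 0)" "k \<in> tangent_space M (\<gamma> 0)"
  shows "\<exists>V K. jacobi_pair I V K \<and> V 0 = v \<and> K 0 = k"
proof -
  define P where "P a b \<longleftrightarrow> (0 \<le> a \<longrightarrow> b \<le> \<rho> \<longrightarrow> (\<forall>v\<in>tangent_space M (\<gamma> a). \<forall>k\<in>tangent_space M (\<gamma> a).
     \<exists>V K. jacobi_pair {a..b} V K \<and> V a = v \<and> K a = k))" for a b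
  have "P 0 \<rho>"
  proof (rule Bolzano)
    show "(0::real) \<le> \<rho>" using \<rho> by simp
  next
    fix a b e assume ab: "P a b" "P b e" "a \<le> b" "b \<le> e"
    show "P a e" unfolding P_def
    proof (intro impI ballI)
      fix v k assume "0 \<le> a" "e \<le> \<rho>" "v \<in> tangent_space M (\<gamma> a)" "k \<in> tangent_space M (\<gamma> a)"
      then obtain V1 K1 where 1: "jacobi_pair {a..b} V1 K1" "V1 a = v" "K1 a = k"
        using ab unfolding P_def by (meson order_trans)
      then have "V1 b \<in> tangent_space M (\<gamma> b)" "K1 b \<in> tangent_space M (\<gamma> b)"
        using ab(3) by (auto simp: jacobi_pair_def tangent_field_def)
      then obtain V2 K2 where 2: "jacobi_pair {b..e} V2 K2" "V2 b = V1 b" "K2 b = K1 b"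
        using ab \<open>0 \<le> a\<close> \<open>e \<le> \<rho>\<close> unfolding P_def by (meson order_trans)
      show "\<exists>V K. jacobi_pair {a..e} V K \<and> V a = v \<and> K a = k"
        using jacobi_pair_concat[OF 1(1) 2(1) ab(3,4)] 1 2 ab(3)
        by (intro exI[of _ "\<lambda>t. if t \<le> b then V1 t else V2 t"] exI[of _ "\<lambda>t. if t \<le> b then K1 t else K2 t"]) simp
    qed
  next
    fix \<tau> assume "0 \<le> \<tau>" "\<tau> \<le> \<rho>"
    then have "\<tau> \<in> I" by simp
    from jacobi_pair_local[OF this] show "\<exists>d>0. \<forall>a b. a \<le> \<tau> \<and> \<tau> \<le> b \<and> b - a < d \<longrightarrow> P a b"
      unfolding P_def by metis
  qed
  then show ?thesis using assms unfolding P_def by auto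
qed

end

lemma transpose_sandwich_entry:
  fixes C :: "real^'k^'n" and B :: "real^'m^'n" and G :: "real^'n^'n"
  shows "(transpose C ** G ** B) $ i $ j = mform G (column i C) (column j B)"
proof -
  have "(transpose C ** G ** B) $ i $ j = (\<Sum>b\<in>UNIV. \<Sum>a\<in>UNIV. G $ a $ b * C $ a $ i * B $ b $ j)"
    by (simp add: matrix_matrix_mult_def transpose_def sum_distrib_left sum_distrib_right mult_ac)
  also have "\<dots> = mform G (column i C) (column j B)"
    unfolding mform_sum by (subst sum.swap) (simp add: column_def)
  finally show ?thesis .
qed

lemma matrix_linear:
  fixes f :: "real^'n \<Rightarrow> real^'m"
  assumes "linear f"
  shows "matrix f *v u = f u"
  by (subst linear_axis_expand[OF assms])
    (simp add: vec_eq_iff matrix_def matrix_vector_mult_def mult.commute)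

section \<open>Algebra of Jacobi fields, the Wronskian and the Ricci trace\<close>

context unit_geodesic
begin

lemma cov_fieldD:
  "cov_field S V W \<Longrightarrow> t \<in> S \<Longrightarrow> at_c t c \<Longrightarrow>
    ((\<lambda>s. V s c) has_vector_derivative W t c - chr M c (pos c t) (vel t c) (V t c)) (at t within S)"
  unfolding cov_field_def by blast

lemma cov_deriv_eq: "cov_field I V W \<Longrightarrow> t \<in> I \<Longrightarrow> at_c t c \<Longrightarrow> cov_deriv M I \<gamma> V t c = W t c"
  using vector_derivative_within[OF not_bot cov_fieldD, of t V W c]
  by (simp add: cov_deriv_def chr_def)

lemma cov_field_cong:
  assumes "cov_field S V W" "\<And>t. t \<in> S \<Longrightarrow> V' t = V t"
  shows "cov_field S V' W"
  unfolding cov_field_def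
proof (intro ballI allI impI)
  fix t c assume t: "t \<in> S" "at_c t c"
  then have "((\<lambda>s. V s c) has_vector_derivative W t c - chr M c (pos c t) (vel t c) (V t c)) (at t within S)"
    by (rule cov_fieldD[OF assms(1)])
  then show "((\<lambda>s. V' s c) has_vector_derivative W t c - chr M c (pos c t) (vel t c) (V' t c)) (at t within S)"
    using assms(2) t by (intro has_vector_derivative_transform[OF t(1), of "\<lambda>s. V' s c" "\<lambda>s. V s c"]) simp_all
qed

lemma cov_field_differentiable: "cov_field I V W \<Longrightarrow> differentiable_along M I \<gamma> V"
  unfolding cov_field_def differentiable_along_def using differentiableI_vector by blast

lemma jacobi_pair_jacobi_field:
  assumes "jacobi_pair I V K"
  shows "jacobi_field M I \<gamma> V"
proof -
  have V: "tangent_field I V" "tangent_field I K" "cov_field I V K"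
    and K: "cov_field I K (\<lambda>t c. - Rm M c (pos c t) (V t c) (vel t c) (vel t c))"
    using assms by (auto simp: jacobi_pair_def)
  have eq: "cov_deriv M I \<gamma> V t = K t" if t: "t \<in> I" for t
  proof
    fix c
    show "cov_deriv M I \<gamma> V t c = K t c"
    proof (cases "at_c t c")
      case True
      then show ?thesis using cov_deriv_eq[OF V(3) t] by simp
    next
      case False
      \<comment> \<open>Off the charts around the point both families are 0 by convention, which
        upgrades equality of components to equality of functions.\<close>
      then show ?thesis using V(2) t tangent_zero[of "K t" "\<gamma> t" c] by (simp add: cov_deriv_def tangent_field_def)
    qed
  qed
  have dV: "cov_field I (cov_deriv M I \<gamma> V) (\<lambda>t c. - Rm M c (pos c t) (V t c) (vel t c) (vel t c))"
    by (rule cov_field_cong[OF K eq])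
  have "cov_deriv M I \<gamma> (cov_deriv M I \<gamma> V) t c + curv M (\<gamma> t) (V t) (vel t) (vel t) c = 0" if t: "t \<in> I" for t c
  proof (cases "at_c t c")
    case True
    then show ?thesis using cov_deriv_eq[OF dV t True] by (simp add: curv_eq)
  next
    case False
    then show ?thesis by (simp add: cov_deriv_def curv_def)
  qed
  then show ?thesis
    using V(1) cov_field_differentiable[OF V(3)] cov_field_differentiable[OF dV]
    unfolding jacobi_field_def tangent_field_def by blast
qed

lemma zero_tangent: "(\<lambda>_. 0) \<in> tangent_space M p"
  unfolding tangent_space_def using linear_0[OF J_linear] by (simp del: split_paired_All)

lemma tangent_sum:
  fixes V :: "'i \<Rightarrow> ('m, 'n) tvec"
  assumes "\<And>i. i \<in> F \<Longrightarrow> V i \<in> tangent_space M p"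
  shows "(\<lambda>c. \<Sum>i\<in>F. a i *\<^sub>R V i c) \<in> tangent_space M p"
  using assms
proof (induction F rule: infinite_finite_induct)
  case (insert i F)
  then show ?case
    using tangent_lincomb[of "V i" p "\<lambda>c. \<Sum>i\<in>F. a i *\<^sub>R V i c" "a i" 1] by simp
qed (simp_all add: zero_tangent)

lemma cov_field_lincomb:
  assumes "\<And>i. cov_field S (V i) (W i)"
  shows "cov_field S (\<lambda>t c. \<Sum>i\<in>(UNIV::'n set). a i *\<^sub>R V i t c) (\<lambda>t c. \<Sum>i\<in>UNIV. a i *\<^sub>R W i t c)"
  unfolding cov_field_def
proof (intro ballI allI impI)
  fix t c assume t: "t \<in> S" "at_c t c"
  have lin: "linear (chr M c (pos c t) (vel t c))" using bilinear_chr[of M c "pos c t"] unfolding bilinear_def by blast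
  have "((\<lambda>s. \<Sum>i\<in>UNIV. a i *\<^sub>R V i s c) has_vector_derivative
     (\<Sum>i\<in>UNIV. a i *\<^sub>R (W i t c - chr M c (pos c t) (vel t c) (V i t c)))) (at t within S)"
    using assms t unfolding cov_field_def
    by (intro has_vector_derivative_sum bounded_linear.has_vector_derivative[OF bounded_linear_scaleR_right]) blast
  also have "(\<Sum>i\<in>UNIV. a i *\<^sub>R (W i t c - chr M c (pos c t) (vel t c) (V i t c))) =
     (\<Sum>i\<in>UNIV. a i *\<^sub>R W i t c) - chr M c (pos c t) (vel t c) (\<Sum>i\<in>UNIV. a i *\<^sub>R V i t c)"
    by (simp add: linear_sum[OF lin] linear_scale[OF lin] scaleR_diff_right sum_subtractf)
  finally show "((\<lambda>s. \<Sum>i\<in>UNIV. a i *\<^sub>R V i s c) has_vector_derivative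
     (\<Sum>i\<in>UNIV. a i *\<^sub>R W i t c) - chr M c (pos c t) (vel t c) (\<Sum>i\<in>UNIV. a i *\<^sub>R V i t c)) (at t within S)" .
qed

lemma jacobi_pair_lincomb:
  assumes "\<And>i. jacobi_pair S (V i) (K i)" and S: "S \<subseteq> I"
  shows "jacobi_pair S (\<lambda>t c. \<Sum>i\<in>(UNIV::'n set). a i *\<^sub>R V i t c) (\<lambda>t c. \<Sum>i\<in>UNIV. a i *\<^sub>R K i t c)"
proof -
  have "cov_field S (\<lambda>t c. \<Sum>i\<in>UNIV. a i *\<^sub>R K i t c)
     (\<lambda>t c. \<Sum>i\<in>UNIV. a i *\<^sub>R - Rm M c (pos c t) (V i t c) (vel t c) (vel t c))"
    using assms(1) by (intro cov_field_lincomb) (simp add: jacobi_pair_def)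
  moreover have "(\<Sum>i\<in>UNIV. a i *\<^sub>R - Rm M c (pos c t) (V i t c) (vel t c) (vel t c)) =
     - Rm M c (pos c t) (\<Sum>i\<in>UNIV. a i *\<^sub>R V i t c) (vel t c) (vel t c)" if "at_c t c" for t c
    by (simp add: linear_sum[OF Rm_linear[OF that]] linear_scale[OF Rm_linear[OF that]] sum_negf)
  ultimately have "cov_field S (\<lambda>t c. \<Sum>i\<in>UNIV. a i *\<^sub>R K i t c)
     (\<lambda>t c. - Rm M c (pos c t) (\<Sum>i\<in>UNIV. a i *\<^sub>R V i t c) (vel t c) (vel t c))"
    unfolding cov_field_def by (simp del: scaleR_minus_right)
  then show ?thesis
    using assms(1) unfolding jacobi_pair_def tangent_field_def
    by (auto intro!: tangent_sum cov_field_lincomb)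
qed

lemma cov_field_vel: "cov_field I vel (\<lambda>_ _. 0)"
  unfolding cov_field_def using vel_derivative by simp

text \<open>The velocity is parallel, so the second covariant derivative of t times it is 0, and
  R(v,v)v = 0 by antisymmetry.\<close>

lemma jacobi_pair_tangential: "jacobi_pair I (\<lambda>t c. t *\<^sub>R vel t c) vel"
proof -
  have "tangent_field I (\<lambda>t c. t *\<^sub>R vel t c)"
    unfolding tangent_field_def
  proof
    fix t assume "t \<in> I"
    then show "(\<lambda>c. t *\<^sub>R vel t c) \<in> tangent_space M (\<gamma> t)"
      using tangent_lincomb[of "vel t" "\<gamma> t" "vel t" t 0] vel_tangent by simp
  qed
  moreover have "cov_field I (\<lambda>t c. t *\<^sub>R vel t c) vel"
    unfolding cov_field_def
  proof (intro ballI allI impI)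
    fix t c assume t: "t \<in> I" "at_c t c"
    have "((\<lambda>s. s *\<^sub>R vel s c) has_vector_derivative
      t *\<^sub>R - chr M c (pos c t) (vel t c) (vel t c) + 1 *\<^sub>R vel t c) (at t within I)"
      by (rule has_vector_derivative_scaleR[OF _ vel_derivative[OF t]]) (auto intro: derivative_intros)
    then show "((\<lambda>s. s *\<^sub>R vel s c) has_vector_derivative
       vel t c - chr M c (pos c t) (vel t c) (t *\<^sub>R vel t c)) (at t within I)"
      by (simp add: bilinear_rules[OF bilinear_chr] algebra_simps)
  qed
  moreover have "cov_field I vel (\<lambda>t c. - Rm M c (pos c t) (t *\<^sub>R vel t c) (vel t c) (vel t c))"
  proof -
    have "Rm M c (pos c t) (t *\<^sub>R vel t c) (vel t c) (vel t c) = 0" if "at_c t c" for t c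
    proof -
      have c: "c \<in> atlas M" "pos c t \<in> dom c" using that by (auto simp: chart_at_def)
      interpret local_metric "dom c" "gform c" "chr M c" by (rule local_metric[OF c(1)])
      have "Rc (pos c t) (vel t c) (vel t c) (vel t c) = 0"
        using Rc_antisym[of "pos c t" "vel t c" "vel t c" "vel t c"] by (simp add: vec_eq_iff)
      then show ?thesis
        using linear_scale[OF Rm_linear[OF that]] by (simp add: Rm_eq_Rc[OF c])
    qed
    then show ?thesis using cov_field_vel unfolding cov_field_def by simp
  qed
  ultimately show ?thesis using vel_tangent by (simp add: jacobi_pair_def tangent_field_def)
qed

text \<open>Compatibility of the connection with the metric along the curve: the Christoffel terms
  of both fields absorb the derivative of the metric coefficients.\<close>

lemma rmetric_derivative:
  assumes V: "tangent_field I V" "cov_field I V V'" and W: "tangent_field I W" "cov_field I W W'"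
    and t: "t \<in> I" and c: "at_c t c"
  shows "((\<lambda>s. rmetric M (\<gamma> s) (V s) (W s)) has_real_derivative
     gform c (pos c t) (V' t c) (W t c) + gform c (pos c t) (V t c) (W' t c)) (at t within I)"
proof -
  have ca: "c \<in> atlas M" and x: "pos c t \<in> dom c" using c by (auto simp: chart_at_def)
  interpret local_metric "dom c" "gform c" "chr M c" by (rule local_metric[OF ca])
  have dV: "((\<lambda>s. V s c) has_derivative (\<lambda>k. k *\<^sub>R (V' t c - chr M c (pos c t) (vel t c) (V t c)))) (at t within I)"
    and dW: "((\<lambda>s. W s c) has_derivative (\<lambda>k. k *\<^sub>R (W' t c - chr M c (pos c t) (vel t c) (W t c)))) (at t within I)"
    using cov_fieldD[OF V(2) t c] cov_fieldD[OF W(2) t c] by (simp_all add: has_vector_derivative_def)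
  have "((\<lambda>s. gform c (pos c s) (V s c) (W s c)) has_derivative
    (\<lambda>k. D (\<lambda>y. gform c y (V t c) (W t c)) (pos c t) (k *\<^sub>R vel t c)
      + gform c (pos c t) (k *\<^sub>R (V' t c - chr M c (pos c t) (vel t c) (V t c))) (W t c)
      + gform c (pos c t) (V t c) (k *\<^sub>R (W' t c - chr M c (pos c t) (vel t c) (W t c))))) (at t within I)"
    by (rule has_derivative_bilinear_field[where X = "dom c" and z = "pos c"])
      (use open_X x g_bil smooth_on_differentiable[OF g_smooth x] pos_derivative[OF t c, unfolded has_vector_derivative_def] dV dW t in auto)
  also have "(\<lambda>k. D (\<lambda>y. gform c y (V t c) (W t c)) (pos c t) (k *\<^sub>R vel t c)
      + gform c (pos c t) (k *\<^sub>R (V' t c - chr M c (pos c t) (vel t c) (V t c))) (W t c)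
      + gform c (pos c t) (V t c) (k *\<^sub>R (W' t c - chr M c (pos c t) (vel t c) (W t c)))) =
    (*) (gform c (pos c t) (V' t c) (W t c) + gform c (pos c t) (V t c) (W' t c))"
    by (rule ext) (simp add: compatible[OF x] bilinear_rules[OF g_bil[OF x]] bilinear_rules[OF \<Gamma>_bil[OF x]] algebra_simps)
  finally have hd: "((\<lambda>s. gform c (pos c s) (V s c) (W s c)) has_derivative
    (*) (gform c (pos c t) (V' t c) (W t c) + gform c (pos c t) (V t c) (W' t c))) (at t within I)" .
  obtain \<delta> where \<delta>: "\<delta> > 0" "\<And>s. s \<in> I \<Longrightarrow> \<bar>s - t\<bar> < \<delta> \<Longrightarrow> at_c s c" using chart_nbhd[OF t c] by blast
  show ?thesis
    unfolding has_field_derivative_def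
  proof (rule has_derivative_transform_within[OF hd \<delta>(1) t])
    fix s assume s: "s \<in> I" "dist s t < \<delta>"
    then have "at_c s c" using \<delta>(2) by (simp add: dist_real_def)
    then show "gform c (pos c s) (V s c) (W s c) = rmetric M (\<gamma> s) (V s) (W s)"
      using rmetric_gform V(1) W(1) s(1) by (simp add: tangent_field_def)
  qed
qed

text \<open>The difference of the two sides is constant, since the curvature terms cancel by
  self-adjointness of the Jacobi operator, and it vanishes at 0 together with both fields.\<close>

lemma wronskian:
  assumes 1: "jacobi_pair I V1 K1" "V1 0 = (\<lambda>_. 0)" and 2: "jacobi_pair I V2 K2" "V2 0 = (\<lambda>_. 0)" and t: "t \<in> I" and c: "at_c t c"
  shows "gform c (pos c t) (V1 t c) (K2 t c) = gform c (pos c t) (K1 t c) (V2 t c)"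
proof -
  define w where "w s = rmetric M (\<gamma> s) (V1 s) (K2 s) - rmetric M (\<gamma> s) (K1 s) (V2 s)" for s
  have j: "tangent_field I V1" "tangent_field I K1" "cov_field I V1 K1" "tangent_field I V2" "tangent_field I K2" "cov_field I V2 K2"
     "cov_field I K1 (\<lambda>t c. - Rm M c (pos c t) (V1 t c) (vel t c) (vel t c))"
     "cov_field I K2 (\<lambda>t c. - Rm M c (pos c t) (V2 t c) (vel t c) (vel t c))"
    using 1 2 by (auto simp: jacobi_pair_def)
  have w_gform: "w s = gform c (pos c s) (V1 s c) (K2 s c) - gform c (pos c s) (K1 s c) (V2 s c)" if "s \<in> I" "at_c s c" for s c
    using rmetric_gform[OF that(2)] j that(1) by (simp add: w_def tangent_field_def)
  have "(w has_derivative (\<lambda>_. 0)) (at s within I)" if s: "s \<in> I" for s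
  proof -
    obtain c where c: "at_c s c" using ex_chart[OF s] by blast
    have ca: "c \<in> atlas M" and x: "pos c s \<in> dom c" using c by (auto simp: chart_at_def)
    interpret local_metric "dom c" "gform c" "chr M c" by (rule local_metric[OF ca])
    have "(w has_real_derivative 0) (at s within I)"
      unfolding w_def
      using DERIV_diff[OF rmetric_derivative[OF j(1,3,5,8) s c] rmetric_derivative[OF j(2,7,4,6) s c]]
        Rc_pair[OF x, of "V1 s c" "vel s c" "V2 s c"]
      by (simp add: bilinear_rules[OF g_bil[OF x]] Rm_eq_Rc[OF ca x])
    moreover have "(*) (0::real) = (\<lambda>_. 0)" by (rule ext) simp
    ultimately show ?thesis by (simp add: has_field_derivative_def)
  qed
  then have "w t = w 0"
    using has_derivative_zero_unique[of I w t 0] t \<rho> by auto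
  moreover have 0: "0 \<in> I" using \<rho> by simp
  obtain d where d: "at_c 0 d" using ex_chart[OF 0] by blast
  have "w 0 = 0" using w_gform[OF 0 d] 1(2) 2(2) by (simp add: bilinear_rules[OF bilinear_mform])
  ultimately show ?thesis using w_gform[OF t c] by simp
qed

definition Rmat where "Rmat c t = matrix (\<lambda>u. Rm M c (pos c t) u (vel t c) (vel t c))"

lemma Rmat_works: "at_c t c \<Longrightarrow> Rmat c t *v u = Rm M c (pos c t) u (vel t c) (vel t c)"
  unfolding Rmat_def by (rule matrix_linear[OF Rm_linear])

text \<open>Matrices of the Jacobi operator in two charts are similar through the Jacobians. Hence
  the arbitrary chart chosen in \<open>ricci\<close> is harmless.\<close>

lemma trace_Rmat_chart:
  assumes t: "t \<in> I" and c: "at_c t c" and d: "at_c t d"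
  shows "trace (Rmat c t) = trace (Rmat d t)"
proof -
  let ?P = "matrix (J c d (\<gamma> t))" and ?Q = "matrix (J d c (\<gamma> t))"
  have P: "?P *v v = J c d (\<gamma> t) v" and Q: "?Q *v v = J d c (\<gamma> t) v" for v
    by (rule matrix_linear[OF J_linear[OF c d]], rule matrix_linear[OF J_linear[OF d c]])
  have PQ: "?P ** ?Q = mat 1"
    unfolding matrix_eq by (simp add: matrix_vector_mul_assoc[symmetric] P Q J_comp[OF d c d] J_self[OF d])
  have vd: "vel t d = J c d (\<gamma> t) (vel t c)" by (rule tangent_transform[OF vel_tangent[OF t] c d])
  have "Rmat c t = ?Q ** (Rmat d t ** ?P)"
    unfolding matrix_eq
  proof
    fix u
    have "(?Q ** (Rmat d t ** ?P)) *v u = J d c (\<gamma> t) (Rm M d (pos d t) (J c d (\<gamma> t) u) (vel t d) (vel t d))"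
      unfolding matrix_vector_mul_assoc[symmetric] P Q Rmat_works[OF d] ..
    also have "\<dots> = Rm M c (pos c t) u (vel t c) (vel t c)"
      unfolding vd Rm_transform[OF c d, symmetric] J_comp[OF c d c] J_self[OF c] ..
    finally show "Rmat c t *v u = (?Q ** (Rmat d t ** ?P)) *v u" unfolding Rmat_works[OF c] ..
  qed
  then have "trace (Rmat c t) = trace (?Q ** (Rmat d t ** ?P))" by simp
  also have "\<dots> = trace ((Rmat d t ** ?P) ** ?Q)" by (rule trace_mul_sym)
  finally show ?thesis by (simp add: matrix_mul_assoc[symmetric] PQ)
qed

lemma ricci_eq_trace:
  assumes t: "t \<in> I" and c: "at_c t c"
  shows "ricci M (\<gamma> t) (vel t) (vel t) = trace (Rmat c t)"
proof -
  define c1 where "c1 = (SOME c. at_c t c)"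
  have c1: "at_c t c1" unfolding c1_def using c by (rule someI)
  have "ricci M (\<gamma> t) (vel t) (vel t) = (\<Sum>i\<in>UNIV. Rm M c1 (pos c1 t) (axis i 1) (vel t c1) (vel t c1) $ i)"
    unfolding ricci_def Let_def c1_def[symmetric] using c1 by (simp add: curv_eq coord_vec_self)
  also have "\<dots> = trace (Rmat c1 t)" by (simp add: trace_def Rmat_def matrix_def)
  finally show ?thesis using trace_Rmat_chart[OF t c1 c] by simp
qed

text \<open>The chart chosen inside \<open>ricci\<close> may vary wildly with the parameter, so near
  each point the trace is recomputed in one fixed chart.\<close>

lemma continuous_avg_radial_ricci: "continuous_on I (avg_radial_ricci M I \<gamma>)"
  unfolding continuous_on_eq_continuous_within
proof
  fix t assume t: "t \<in> I"
  obtain c where c: "at_c t c" using ex_chart[OF t] by blast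
  obtain \<delta> where \<delta>: "\<delta> > 0" "\<And>s. s \<in> I \<Longrightarrow> \<bar>s - t\<bar> < \<delta> \<Longrightarrow> at_c s c" using chart_nbhd[OF t c] by blast
  define S where "S = I \<inter> ball t \<delta>"
  have S: "S \<subseteq> I" "t \<in> S" and at: "\<And>s. s \<in> S \<Longrightarrow> at_c s c"
    using \<delta> t by (auto simp: S_def dist_real_def abs_minus_commute)
  have "continuous_on S (\<lambda>s. (\<Sum>i\<in>UNIV. Rm M c (pos c s) (axis i 1) (vel s c) (vel s c) $ i) / (real CARD('n) - 1))"
    unfolding divide_inverse
    by (intro continuous_intros continuous_coefficients(2)[OF at S(1)])
  then have "continuous_on S (avg_radial_ricci M I \<gamma>)"
  proof (rule continuous_on_eq)
    fix s assume "s \<in> S"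
    then show "(\<Sum>i\<in>UNIV. Rm M c (pos c s) (axis i 1) (vel s c) (vel s c) $ i) / (real CARD('n) - 1) = avg_radial_ricci M I \<gamma> s"
      using ricci_eq_trace[of s c] at S(1) by (auto simp: avg_radial_ricci_def trace_def Rmat_def matrix_def)
  qed
  then have "continuous (at t within S) (avg_radial_ricci M I \<gamma>)"
    using S(2) by (simp add: continuous_on_eq_continuous_within)
  moreover have "at t within S = at t within I"
    by (rule at_within_nhd[of t "ball t \<delta>"]) (use \<delta>(1) in \<open>auto simp: S_def\<close>)
  ultimately show "continuous (at t within I) (avg_radial_ricci M I \<gamma>)" by simp
qed

end

section \<open>The Riccati inequality of a Jacobi frame\<close>

text \<open>Jacobi fields vanishing at 0 with independent initial derivatives, independence being
  read off in \<open>c0\<close>. Index \<open>i0\<close> is reserved for the tangential field, the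
  eigenvector to be split off.\<close>

locale jacobi_frame = unit_geodesic M \<gamma> \<rho>
  for M :: "('m, 'n::finite, 'z) manifold_scheme" and \<gamma> \<rho> +
  fixes V K :: "'n \<Rightarrow> real \<Rightarrow> ('m, 'n) tvec" and i0 :: 'n and c0 :: "('m, 'n) chart"
  assumes c0: "chart_at M (\<gamma> 0) c0"
    and frame_jacobi: "jacobi_pair {0..\<rho>} (V i) (K i)" and frame_0: "V i 0 = (\<lambda>_. 0)"
    and tangential: "V i0 = (\<lambda>t c. t *\<^sub>R velocity M {0..\<rho>} \<gamma> t c)" "K i0 = velocity M {0..\<rho>} \<gamma>"
    and initial_independent: "(\<Sum>i\<in>UNIV. \<alpha> i *\<^sub>R K i 0 c0) = 0 \<Longrightarrow> \<alpha> i = 0"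
    and no_conjugate: "0 < r \<Longrightarrow> r < \<rho> \<Longrightarrow> \<not> conjugate_along M {0..\<rho>} \<gamma> 0 r"
begin

lemma frame:
  "tangent_field I (V i)" "tangent_field I (K i)" "cov_field I (V i) (K i)"
  "cov_field I (K i) (\<lambda>t c. - Rm M c (pos c t) (V i t c) (vel t c) (vel t c))"
  using frame_jacobi[of i] by (auto simp: jacobi_pair_def)

text \<open>A vanishing combination at \<open>t\<close> is a Jacobi field with zeros at 0 and
  \<open>t\<close>. Without conjugate points it is identically 0, so its covariant derivative at 0
  vanishes too, against the independence of the initial derivatives.\<close>

lemma frame_independent:
  assumes t: "0 < t" "t < \<rho>" and c: "at_c t c" and zero: "(\<Sum>i\<in>UNIV. \<alpha> i *\<^sub>R V i t c) = 0"
  shows "\<alpha> i = 0"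
proof -
  define Z where "Z t c = (\<Sum>i\<in>UNIV. \<alpha> i *\<^sub>R V i t c)" for t c
  define L where "L t c = (\<Sum>i\<in>UNIV. \<alpha> i *\<^sub>R K i t c)" for t c
  have jacobi_pair: "jacobi_pair I Z L"
    unfolding Z_def[abs_def] L_def[abs_def] by (rule jacobi_pair_lincomb[OF frame_jacobi]) simp
  have tI: "t \<in> I" and 0: "0 \<in> I" using t by auto
  have Zt: "Z t \<in> tangent_space M (\<gamma> t)" using jacobi_pair tI by (simp add: jacobi_pair_def tangent_field_def)
  have "Z t c = 0" using zero by (simp add: Z_def)
  then have "Z t = coord_vec M c (\<gamma> t) 0" using coord_vec_eq[OF Zt c] by simp
  also have "\<dots> = (\<lambda>_. 0)" using linear_0[OF J_linear[OF c]] by (auto simp: coord_vec_def)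
  finally have "Z t = (\<lambda>_. 0)" .
  moreover have "Z 0 = (\<lambda>_. 0)" by (simp add: Z_def fun_eq_iff frame_0)
  ultimately have Z0: "Z r = (\<lambda>_. 0)" if "r \<in> I" for r
    using no_conjugate[OF t] jacobi_pair_jacobi_field[OF jacobi_pair] that unfolding conjugate_along_def by blast
  have "L 0 c0 = 0"
  proof (rule I_unique[OF 0])
    have "((\<lambda>s. Z s c0) has_vector_derivative L 0 c0 - chr M c0 (pos c0 0) (vel 0 c0) (Z 0 c0)) (at 0 within I)"
      by (rule cov_fieldD[OF _ 0 c0]) (use jacobi_pair in \<open>simp add: jacobi_pair_def\<close>)
    then show "((\<lambda>s. Z s c0) has_vector_derivative L 0 c0) (at 0 within I)"
      by (simp add: Z0[OF 0] bilinear_rules[OF bilinear_chr])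
    show "((\<lambda>s. Z s c0) has_vector_derivative 0) (at 0 within I)"
      by (rule has_vector_derivative_transform[OF 0 _ has_vector_derivative_const[of 0]]) (simp add: Z0)
  qed
  then show ?thesis using initial_independent[of \<alpha> i] by (simp add: L_def)
qed

text \<open>Columns are the fields and rows the chart components, so independence of the frame is
  invertibility of \<open>Y\<close>.\<close>

definition Y where "Y c t = (\<chi> a i. V i t c $ a)"
definition W where "W c t = (\<chi> a i. K i t c $ a)"

lemma Y_mult: "Y c t *v \<alpha> = (\<Sum>i\<in>UNIV. \<alpha> $ i *\<^sub>R V i t c)"
  by (simp add: Y_def vec_eq_iff matrix_vector_mult_def mult.commute)

lemma column_Y: "column i (Y c t) = V i t c" and column_W: "column i (W c t) = K i t c"
  by (simp_all add: Y_def W_def column_def vec_eq_iff)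

lemma Y_inj:
  assumes "0 < t" "t < \<rho>" "at_c t c" "Y c t *v \<alpha> = 0"
  shows "\<alpha> = 0"
  using frame_independent[OF assms(1-3), of "\<lambda>i. \<alpha> $ i"] assms(4) by (simp add: Y_mult vec_eq_iff)

lemma det_Y:
  assumes "0 < t" "t < \<rho>" "at_c t c"
  shows "det (Y c t) \<noteq> 0"
proof -
  have "invertible (Y c t)"
    using Y_inj[OF assms] matrix_left_invertible_ker[of "Y c t"] invertible_left_inverse by blast
  then show ?thesis by (simp add: invertible_det_nz)
qed

text \<open>The matrix of \<open>D/dt\<close> in the frame \<open>V\<close>: \<open>K i = (\<Sum>j. A t $ j $ i *\<^sub>R V j)\<close> in every chart.\<close>

definition A where "A t = (let c = SOME c. at_c t c in matrix_inv (Y c t) ** W c t)"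

text \<open>A change of chart multiplies \<open>Y\<close> and \<open>W\<close> from the left by the
  same Jacobian, which cancels in the quotient. So \<open>A\<close> has no chart argument.\<close>

lemma A_works:
  assumes t: "0 < t" "t < \<rho>" and c: "at_c t c"
  shows "Y c t ** A t = W c t" "A t = matrix_inv (Y c t) ** W c t"
proof -
  define c1 where "c1 = (SOME c. at_c t c)"
  have c1: "at_c t c1" unfolding c1_def using c by (rule someI)
  have tI: "t \<in> I" using t by simp
  let ?P = "matrix (J c1 c (\<gamma> t))"
  have P: "?P *v v = J c1 c (\<gamma> t) v" for v by (rule matrix_linear[OF J_linear[OF c1 c]])
  have trans: "V i t c = ?P *v V i t c1" "K i t c = ?P *v K i t c1" for i
    unfolding P using tangent_transform[OF _ c1 c] frame(1,2) tI unfolding tangent_field_def by blast+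
  have "Y c t = ?P ** Y c1 t" "W c t = ?P ** W c1 t"
    unfolding Y_def W_def
    by (simp_all add: vec_eq_iff trans matrix_matrix_mult_def matrix_vector_mult_def)
  moreover have "A t = matrix_inv (Y c1 t) ** W c1 t" unfolding A_def c1_def Let_def ..
  ultimately show YA: "Y c t ** A t = W c t"
    using det_ne_0_matrix_inv(1)[OF det_Y[OF t c1]]
    by (simp add: matrix_mul_assoc) (simp add: matrix_mul_assoc[symmetric])
  show "A t = matrix_inv (Y c t) ** W c t"
    unfolding YA[symmetric] using det_ne_0_matrix_inv(2)[OF det_Y[OF t c]] by (simp add: matrix_mul_assoc)
qed

lemma A_expand:
  assumes "0 < t" "t < \<rho>" "at_c t c"
  shows "K i t c = (\<Sum>j\<in>UNIV. A t $ j $ i *\<^sub>R V j t c)"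
proof -
  have "K i t c = column i (Y c t ** A t)" unfolding A_works(1)[OF assms] column_W ..
  also have "\<dots> = (\<Sum>j\<in>UNIV. A t $ j $ i *\<^sub>R V j t c)"
    by (simp add: column_def matrix_matrix_mult_def Y_def vec_eq_iff mult.commute)
  finally show ?thesis .
qed

lemma interior_nbhd:
  assumes t: "0 < t" "t < \<rho>" and c: "at_c t c"
  obtains \<delta> where "\<delta> > 0" "\<And>s. s \<in> I \<Longrightarrow> dist s t < \<delta> \<Longrightarrow> 0 < s \<and> s < \<rho> \<and> at_c s c"
proof -
  have tI: "t \<in> I" using t by simp
  obtain \<delta> where \<delta>: "\<delta> > 0" "\<And>s. s \<in> I \<Longrightarrow> \<bar>s - t\<bar> < \<delta> \<Longrightarrow> at_c s c" using chart_nbhd[OF tI c] by blast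
  show thesis
    by (rule that[of "min \<delta> (min t (\<rho> - t))"]) (use \<delta> t in \<open>auto simp: dist_real_def\<close>)
qed

lemma A_differentiable:
  assumes t: "0 < t" "t < \<rho>"
  shows "(\<lambda>s. A s $ j $ i) differentiable (at t within I)"
proof -
  have tI: "t \<in> I" using t by simp
  obtain c where c: "at_c t c" using ex_chart[OF tI] by blast
  obtain \<delta> where \<delta>: "\<delta> > 0" "\<And>s. s \<in> I \<Longrightarrow> dist s t < \<delta> \<Longrightarrow> 0 < s \<and> s < \<rho> \<and> at_c s c"
    using interior_nbhd[OF t c] by blast
  have nth: "(\<lambda>s. f s $ a) differentiable (at t within I)" if "(f has_vector_derivative f') (at t within I)"
    for f :: "real \<Rightarrow> real^'n" and f' a
    using bounded_linear.has_vector_derivative[OF bounded_linear_vec_nth that] differentiableI_vector by blast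
  have dY: "(\<lambda>s. Y c s $ a $ b) differentiable (at t within I)" and dK: "(\<lambda>s. K b s c $ a) differentiable (at t within I)" for a b
    unfolding Y_def using nth[OF cov_fieldD[OF frame(3) tI c]] nth[OF cov_fieldD[OF frame(4) tI c]] by simp_all
  have "(\<lambda>s. \<Sum>k\<in>UNIV. matrix_inv (Y c s) $ j $ k * K i s c $ k) differentiable (at t within I)"
    by (intro differentiable_sum differentiable_mult ballI differentiable_matrix_inv dY dK det_Y[OF t c] tI) simp
  then show ?thesis
  proof (rule differentiable_transform_within[OF _ \<delta>(1) tI])
    fix s assume "s \<in> I" "dist s t < \<delta>"
    then have "A s = matrix_inv (Y c s) ** W c s" using \<delta>(2) A_works(2) by blast
    then show "(\<Sum>k\<in>UNIV. matrix_inv (Y c s) $ j $ k * K i s c $ k) = A s $ j $ i"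
      by (simp add: matrix_matrix_mult_def W_def)
  qed
qed

text \<open>Covariant differentiation of the frame expansion of \<open>K i\<close> gives A' = -
  inv(Y) R Y - A^2. Only the trace is kept, since it does not see the conjugation by
  \<open>Y\<close>.\<close>

lemma A_riccati:
  assumes t: "0 < t" "t < \<rho>" and c: "at_c t c"
  obtains A' where "\<And>j i. ((\<lambda>s. A s $ j $ i) has_real_derivative A' $ j $ i) (at t within I)"
    "trace A' = - trace (Rmat c t) - trace (A t ** A t)"
proof -
  have tI: "t \<in> I" using t by simp
  obtain a where a: "\<And>j i. ((\<lambda>s. A s $ j $ i) has_real_derivative a j i) (at t within I)"
    using A_differentiable[OF t] unfolding real_differentiable_def by metis
  define A' where "A' = (\<chi> j i. a j i)"
  let ?G = "chr M c (pos c t) (vel t c)"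
  have G: "linear ?G" using bilinear_chr[of M c "pos c t"] unfolding bilinear_def by blast
  obtain \<delta> where \<delta>: "\<delta> > 0" "\<And>s. s \<in> I \<Longrightarrow> dist s t < \<delta> \<Longrightarrow> 0 < s \<and> s < \<rho> \<and> at_c s c"
    using interior_nbhd[OF t c] by blast
  \<comment> \<open>Two coordinate derivatives of \<open>K i\<close> are compared, one from the
    expansion and one from the Jacobi equation; the Christoffel terms cancel because
    \<open>K i\<close> has the same expansion.\<close>
  have col: "(\<Sum>j\<in>UNIV. a j i *\<^sub>R V j t c) = - Rm M c (pos c t) (V i t c) (vel t c) (vel t c) - (\<Sum>j\<in>UNIV. A t $ j $ i *\<^sub>R K j t c)" for i
  proof -
    have d1: "((\<lambda>s. \<Sum>j\<in>UNIV. A s $ j $ i *\<^sub>R V j s c) has_vector_derivative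
        (\<Sum>j\<in>UNIV. A t $ j $ i *\<^sub>R (K j t c - ?G (V j t c)) + a j i *\<^sub>R V j t c)) (at t within I)"
      by (intro has_vector_derivative_sum has_vector_derivative_scaleR a cov_fieldD[OF frame(3) tI c])
    have "((\<lambda>s. K i s c) has_vector_derivative
        (\<Sum>j\<in>UNIV. A t $ j $ i *\<^sub>R (K j t c - ?G (V j t c)) + a j i *\<^sub>R V j t c)) (at t within I)"
      by (rule has_vector_derivative_transform_within[OF d1 \<delta>(1) tI]) (use \<delta>(2) A_expand in auto)
    from I_unique[OF tI this cov_fieldD[OF frame(4) tI c]]
    have "(\<Sum>j\<in>UNIV. A t $ j $ i *\<^sub>R (K j t c - ?G (V j t c)) + a j i *\<^sub>R V j t c) =
      - Rm M c (pos c t) (V i t c) (vel t c) (vel t c) - ?G (K i t c)" .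
    moreover have "?G (K i t c) = (\<Sum>j\<in>UNIV. A t $ j $ i *\<^sub>R ?G (V j t c))"
      by (subst A_expand[OF t c]) (simp add: linear_sum[OF G] linear_scale[OF G])
    ultimately show ?thesis
      by (simp add: scaleR_diff_right sum.distrib sum_subtractf algebra_simps)
  qed
  have "Y c t ** A' = - (Rmat c t ** Y c t) - W c t ** A t"
  proof -
    have "column i (Y c t ** A') = column i (- (Rmat c t ** Y c t) - W c t ** A t)" for i
    proof -
      have "column i (Y c t ** A') = (\<Sum>j\<in>UNIV. a j i *\<^sub>R V j t c)"
        by (simp add: column_def matrix_matrix_mult_def Y_def A'_def vec_eq_iff mult.commute)
      moreover have "column i (W c t ** A t) = (\<Sum>j\<in>UNIV. A t $ j $ i *\<^sub>R K j t c)"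
        by (simp add: column_def matrix_matrix_mult_def W_def vec_eq_iff mult.commute)
      moreover have "column i (Rmat c t ** Y c t) = Rm M c (pos c t) (V i t c) (vel t c) (vel t c)"
      proof -
        have "column i (Rmat c t ** Y c t) = Rmat c t *v V i t c"
          by (simp add: column_def matrix_matrix_mult_def matrix_vector_mult_def Y_def vec_eq_iff)
        then show ?thesis by (simp add: Rmat_works[OF c])
      qed
      moreover have "column i (- (Rmat c t ** Y c t) - W c t ** A t) = - column i (Rmat c t ** Y c t) - column i (W c t ** A t)"
        by (simp add: column_def vec_eq_iff)
      ultimately show ?thesis using col by simp
    qed
    then show ?thesis by (simp add: column_def vec_eq_iff)
  qed
  then have "A' = matrix_inv (Y c t) ** (- (Rmat c t ** Y c t) - W c t ** A t)"
    using det_ne_0_matrix_inv(2)[OF det_Y[OF t c]] by (metis matrix_mul_assoc matrix_mul_lid)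
  also have "\<dots> = (- (matrix_inv (Y c t) ** (Rmat c t ** Y c t))) - A t ** A t"
  proof -
    have neg: "P ** (- Q) = - (P ** Q)" for P Q :: "real^'n^'n"
      by (simp add: vec_eq_iff matrix_matrix_mult_def sum_negf)
    have "matrix_inv (Y c t) ** (W c t ** A t) = A t ** A t"
      by (subst (2) A_works(2)[OF t c]) (simp add: matrix_mul_assoc)
    then show ?thesis unfolding matrix_mult_diff neg by simp
  qed
  finally have "trace A' = - trace (matrix_inv (Y c t) ** (Rmat c t ** Y c t)) - trace (A t ** A t)"
    by (simp add: trace_def sum_subtractf sum_negf)
  also have "trace (matrix_inv (Y c t) ** (Rmat c t ** Y c t)) = trace (Rmat c t ** Y c t ** matrix_inv (Y c t))"
    by (rule trace_mul_sym)
  also have "\<dots> = trace (Rmat c t)"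
    using det_ne_0_matrix_inv(1)[OF det_Y[OF t c]] by (simp add: matrix_mul_assoc[symmetric])
  finally show thesis using a by (intro that[of A']) (simp_all add: A'_def)
qed

text \<open>\<open>trace_square_ge\<close> is applied in the moving frame, with the Gram matrix of
  the frame as inner product.\<close>

lemma A_trace_square:
  assumes t: "0 < t" "t < \<rho>" and n: "CARD('n) \<ge> 2"
  shows "trace (A t ** A t) - (1 / t)\<^sup>2 \<ge> (trace (A t) - 1 / t)\<^sup>2 / (real CARD('n) - 1)"
proof -
  have tI: "t \<in> I" using t by simp
  obtain c where c: "at_c t c" using ex_chart[OF tI] by blast
  define H where "H = transpose (Y c t) ** gmat M c (pos c t) ** Y c t"
  have Hij: "H $ i $ j = gform c (pos c t) (V i t c) (V j t c)" for i j
    by (simp add: H_def transpose_sandwich_entry column_Y)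
  have "transpose H = H" using gform_sym[OF c] by (simp add: vec_eq_iff transpose_def Hij)
  moreover have "mform H v v > 0" if "v \<noteq> 0" for v
  proof -
    have "mform H v v = mform (gmat M c (pos c t)) (Y c t *v v) (Y c t *v v)"
      unfolding mform_def H_def
      unfolding matrix_vector_mul_assoc[symmetric] inner_commute[of v] dot_transpose_left
      by (rule inner_commute)
    then show ?thesis using gform_pos[OF c] Y_inj[OF t c] that by fastforce
  qed
  \<comment> \<open>The entries of \<open>H ** A t\<close> pair \<open>V i\<close> with
    \<open>K j\<close>, and their symmetry is the Wronskian identity.\<close>
  moreover have "transpose (H ** A t) = H ** A t"
  proof -
    have HA: "H ** A t = transpose (Y c t) ** gmat M c (pos c t) ** W c t"
      by (simp add: H_def A_works(1)[OF t c, symmetric] matrix_mul_assoc)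
    have "(H ** A t) $ i $ j = (H ** A t) $ j $ i" for i j
      unfolding HA transpose_sandwich_entry column_Y column_W
      using wronskian[OF frame_jacobi frame_0 frame_jacobi frame_0 tI c, of i j] gform_sym[OF c] by metis
    then show ?thesis by (simp add: vec_eq_iff transpose_def)
  qed
  \<comment> \<open>The tangential column of \<open>Y\<close> is t times that of \<open>W\<close>,
    whence the eigenvalue 1/t.\<close>
  moreover have "A t *v axis i0 1 = (1 / t) *\<^sub>R axis i0 1"
  proof -
    have "A t *v axis i0 1 = matrix_inv (Y c t) *v (W c t *v axis i0 1)"
      by (simp add: A_works(2)[OF t c] matrix_vector_mul_assoc)
    also have "W c t *v axis i0 1 = (1 / t) *\<^sub>R (Y c t *v axis i0 1)"
      using t by (simp add: matrix_vector_mult_basis column_Y column_W tangential)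
    also have "matrix_inv (Y c t) *v \<dots> = (1 / t) *\<^sub>R axis i0 1"
      using det_ne_0_matrix_inv(2)[OF det_Y[OF t c]]
      by (simp add: matrix_vector_mult_scaleR matrix_vector_mul_assoc)
    finally show ?thesis .
  qed
  ultimately show ?thesis using trace_square_ge[of H "A t" "axis i0 1" "1 / t"] n by simp
qed

text \<open>\<open>u\<close> is the mean of the eigenvalues of \<open>A\<close> apart from the
  tangential one. Subtracting 1/t adds 1/t^2 to the derivative, the same square that
  \<open>A_trace_square\<close> removes, and the trace of the Jacobi operator is the Ricci
  term.\<close>

lemma riccati_inequality:
  assumes t: "0 < t" "t < \<rho>" and n: "CARD('n) \<ge> 2"
  defines "u \<equiv> \<lambda>t. (trace (A t) - 1 / t) / (real CARD('n) - 1)"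
  shows "\<exists>d. (u has_real_derivative d) (at t) \<and> d \<le> - ((u t)\<^sup>2 + avg_radial_ricci M I \<gamma> t)"
proof -
  let ?m = "real CARD('n) - 1"
  have m: "?m > 0" using n by simp
  have tI: "t \<in> I" using t by simp
  obtain c where c: "at_c t c" using ex_chart[OF tI] by blast
  obtain A' where A': "\<And>j i. ((\<lambda>s. A s $ j $ i) has_real_derivative A' $ j $ i) (at t within I)"
    "trace A' = - trace (Rmat c t) - trace (A t ** A t)" using A_riccati[OF t c] by blast
  have at: "at t within I = at t" using t by (rule at_within_Icc_at)
  define d where "d = (trace A' + 1 / t\<^sup>2) / ?m"
  have "((\<lambda>s. trace (A s)) has_real_derivative trace A') (at t)"
    unfolding trace_def using A'(1)[unfolded at] by (intro DERIV_sum)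
  then have "(u has_real_derivative d) (at t)"
    unfolding u_def d_def using t
    by (intro DERIV_cdivide) (auto intro!: derivative_eq_intros simp: power2_eq_square)
  moreover have "d \<le> - ((u t)\<^sup>2 + avg_radial_ricci M I \<gamma> t)"
  proof -
    have "?m * (u t)\<^sup>2 = (trace (A t) - 1 / t)\<^sup>2 / ?m"
      using m by (simp add: u_def power2_eq_square)
    moreover have "?m * avg_radial_ricci M I \<gamma> t = trace (Rmat c t)"
      using m by (simp add: avg_radial_ricci_def ricci_eq_trace[OF tI c])
    moreover have "?m * d = trace A' + (1 / t)\<^sup>2" using m by (simp add: d_def power_divide)
    moreover have "?m * (- ((u t)\<^sup>2 + avg_radial_ricci M I \<gamma> t)) = - (?m * (u t)\<^sup>2) - ?m * avg_radial_ricci M I \<gamma> t"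
      by (simp add: algebra_simps)
    ultimately have "?m * d \<le> ?m * (- ((u t)\<^sup>2 + avg_radial_ricci M I \<gamma> t))"
      using A_trace_square[OF t n] A'(2) by argo
    then show ?thesis using m by simp
  qed
  ultimately show ?thesis by blast
qed

end

context unit_geodesic
begin

lemma jacobi_frame_exists:
  assumes no_conj: "\<And>r. 0 < r \<Longrightarrow> r < \<rho> \<Longrightarrow> \<not> conjugate_along M I \<gamma> 0 r"
  shows "\<exists>V K i0 c0. jacobi_frame M \<gamma> \<rho> V K i0 c0"
proof -
  have 0: "0 \<in> I" using \<rho> by simp
  obtain c0 where c0: "at_c 0 c0" using ex_chart[OF 0] by blast
  define v where "v = vel 0 c0"
  \<comment> \<open>Exchange argument: the velocity replaces a coordinate vector along which it has
    a nonzero component, so the initial derivatives remain a basis.\<close>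
  obtain i0 where i0: "v $ i0 \<noteq> 0" using vel_nonzero[OF 0 c0] by (auto simp: v_def vec_eq_iff)
  have "\<exists>V K. jacobi_pair I V K \<and> V 0 = (\<lambda>_. 0) \<and> K 0 = coord_vec M c0 (\<gamma> 0) (axis i 1)" for i
    by (rule jacobi_pair_exists) (auto intro: zero_tangent coord_vec_in[OF c0])
  then obtain V K where VK: "\<And>i. jacobi_pair I (V i) (K i)" "\<And>i. V i 0 = (\<lambda>_. 0)"
    "\<And>i. K i 0 = coord_vec M c0 (\<gamma> 0) (axis i 1)" by metis
  define V' where "V' = V(i0 := (\<lambda>t c. t *\<^sub>R vel t c))"
  define K' where "K' = K(i0 := vel)"
  have "jacobi_frame M \<gamma> \<rho> V' K' i0 c0"
  proof unfold_locales
    fix \<alpha> :: "'n \<Rightarrow> real" and i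
    assume sum: "(\<Sum>i\<in>UNIV. \<alpha> i *\<^sub>R K' i 0 c0) = 0"
    have comp: "K' i 0 c0 = (if i = i0 then v else axis i 1)" for i
      by (simp add: K'_def v_def VK(3) coord_vec_self[OF c0])
    have "(\<Sum>i\<in>UNIV. \<alpha> i *\<^sub>R K' i 0 c0) $ k = \<alpha> i0 * v $ k + (if k = i0 then 0 else \<alpha> k)" for k
    proof -
      have "(\<Sum>i\<in>UNIV. \<alpha> i *\<^sub>R K' i 0 c0) $ k
        = (\<Sum>i\<in>UNIV. (if i = i0 then \<alpha> i0 * v $ k else 0) + (if i = k then (if k = i0 then 0 else \<alpha> k) else 0))"
        unfolding sum_component by (intro sum.cong refl) (auto simp: comp axis_def)
      then show ?thesis by (simp add: sum.distrib)
    qed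
    then have eq: "\<alpha> i0 * v $ k + (if k = i0 then 0 else \<alpha> k) = 0" for k using sum by simp
    have "\<alpha> i0 = 0" using eq[of i0] i0 by simp
    then show "\<alpha> i = 0" using eq[of i] by (cases "i = i0") auto
  qed (use c0 VK jacobi_pair_tangential no_conj in \<open>auto simp: V'_def K'_def\<close>)
  then show ?thesis by blast
qed

end

theorem theorem1p4:
  fixes M :: "('m, 'n::finite) manifold"
    and \<gamma> :: "real \<Rightarrow> 'm"
    and \<rho> :: real
    and q \<psi> :: "real \<Rightarrow> real"
  assumes "riemannian_manifold M"
    and "complete_manifold M"
    and "CARD('n) \<ge> 2"
    and "\<rho> > 0"
    and "geodesic_on M {0..\<rho>} \<gamma>"
    and "unit_speed_on M {0..\<rho>} \<gamma>"
    and "first_conjugate_along M {0..\<rho>} \<gamma> 0 \<rho>"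
    and "q = avg_radial_ricci M {0..\<rho>} \<gamma>"
    and "\<forall>r\<in>{0..\<rho>}. q r \<ge> 0"
    and "\<forall>r\<ge>0. \<psi> r > 0"
    and "mono_on {0..} \<psi> \<or> antimono_on {0..} \<psi>"
  shows "(\<lambda>r. \<psi> r * q r / ((\<psi> r)\<^sup>2 + q r)) integrable_on {0..\<rho>} \<and>
         integral {0..\<rho>} (\<lambda>r. \<psi> r * q r / ((\<psi> r)\<^sup>2 + q r))
           < 2 + 1 / 4 * \<bar>ln (\<psi> \<rho> / \<psi> 0)\<bar>"
proof -
  interpret unit_geodesic M \<gamma> \<rho>
    using assms by unfold_locales auto
  have "\<And>r. 0 < r \<Longrightarrow> r < \<rho> \<Longrightarrow> \<not> conjugate_along M I \<gamma> 0 r"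
    using assms(7) unfolding first_conjugate_along_def by blast
  then obtain V K i0 c0 where "jacobi_frame M \<gamma> \<rho> V K i0 c0"
    using jacobi_frame_exists by blast
  then interpret jacobi_frame M \<gamma> \<rho> V K i0 c0 .
  have q: "continuous_on {0..\<rho>} q" "\<And>r. r \<in> {0..\<rho>} \<Longrightarrow> q r \<ge> 0"
    using continuous_avg_radial_ricci assms(8,9) by auto
  have psi: "\<And>r. r \<ge> 0 \<Longrightarrow> \<psi> r > 0" using assms(10) by blast
  note bound = riccati_integral_bound[OF \<rho> q psi assms(11) riccati_inequality[OF _ _ assms(3), folded assms(8)]]
  show ?thesis by (intro conjI bound)
qed

end
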